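(* Consider the Clifford tori $T_\alpha\subset M_{t_0}\cong\mathbb S^3_{a_0}$, $0<\alpha<\pi/2$, in the time slice $t=t_0$ of the FLRW Lorentzian manifold $(\mathbb R\times\mathbb S^3,\,-dt^2+a(t)^2g_{\mathbb S^3})$, and assume that $\mathcal H_0=\dot a(t_0)/a(t_0)\neq0$. Then the minimal Clifford torus $T_{\pi/4}$ is fully area-constrained Willmore. Its mean-curvature vector is timelike, $|\vec H|^2=-P^2=-4\mathcal H_0^2<0$, and its common Lagrange multiplier is $$\lambda=\frac12P^2+\|\mathring B\|_h^2+2\operatorname{Ein}(\nu,\nu).$$ If, in addition, the ambient FLRW manifold satisfies the dominant energy condition, then $T_{\pi/4}$ is the unique fully area-constrained Willmore member of the Clifford family $\{T_\alpha\}_{0<\alpha<\pi/2}$.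
   Context: Setting. $a:\mathbb R\to(0,\infty)$ is smooth, $t_0\in\mathbb R$ fixed, $a_0=a(t_0)$, $M_{t_0}=\{t=t_0\}$ is identified with the round sphere $\mathbb S^3_{a_0}\subset\mathbb C^2$ of radius $a_0$; its second fundamental form is $K=\mathcal H_0g^{M_{t_0}}$ (with $K(X,Y)=\langle\nabla_Xn,Y\rangle$, $n=\partial_t$). The Clifford torus is $T_\alpha=\{(z_1,z_2)\in\mathbb S^3_{a_0}:|z_1|=a_0\cos\alpha,\ |z_2|=a_0\sin\alpha\}$, with induced metric $h$ and unit normal $\nu$ in $M_{t_0}$; $\mathring B$ is its trace-free second fundamental form in $M_{t_0}$, and $P=\operatorname{tr}_hK=2\mathcal H_0$. $\operatorname{Ein}=\operatorname{Ric}-\frac12\operatorname{Sc}\,\mathbf g$ is the Einstein tensor of the FLRW metric. Dominant energy condition: $\operatorname{Ein}(X,Y)\ge0$ for all future-directed causal $X,Y$. For a closed spacelike surface $\Sigma$: mean curvature vector $\vec H$ = trace of $\chi(X,Y)=-(\nabla_XY)^\perp$; $|\vec H|^2=\langle\vec H,\vec H\rangle$. $\delta_V$ denotes the derivative at time $0$ along a smooth variation with initial velocity the normal field $V$. $\Sigma$ is fully area-constrained Willmore if it is critical for $\int_\Sigma|\vec H|^2\,d\mu$ under all area-preserving normal variations; equivalently, there is a constant $\lambda\in\mathbb R$ (the common Lagrange multiplier) with $\delta_V\int_\Sigma|\vec H|^2\,d\mu=\lambda\,\delta_V|\Sigma|$ for every normal field $V$. *)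

theory Defs
  imports "HOL-Analysis.Analysis"
begin

text \<open>Throughout, the manifold \<open>\<real> \<times> S\<^sup>3\<close> is realised as the submanifold of
  \<open>\<real> \<times> \<complex>\<^sup>2\<close> consisting of the points \<open>(t, p)\<close> with \<open>p\<close> in the unit sphere.\<close>

subsection \<open>Smooth maps\<close>

text \<open>To be used on open sets only.  By induction on \<open>k\<close>, all iterated directional derivatives
  of order at most \<open>k\<close> exist and are continuous.\<close>

primrec Ck_on ::
  "nat \<Rightarrow> 'a::real_normed_vector set \<Rightarrow> ('a \<Rightarrow> 'b::real_normed_vector) \<Rightarrow> bool" where
  "Ck_on 0 S f \<longleftrightarrow> continuous_on S f"
| "Ck_on (Suc k) S f \<longleftrightarrow>
     (\<forall>x\<in>S. f differentiable at x) \<and> (\<forall>v. Ck_on k S (\<lambda>x. frechet_derivative f (at x) v))"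

definition smooth_on :: "'a::real_normed_vector set \<Rightarrow> ('a \<Rightarrow> 'b::real_normed_vector) \<Rightarrow> bool" where
  "smooth_on S f \<longleftrightarrow> (\<forall>k. Ck_on k S f)"


subsection \<open>The FLRW spacetime\<close>

type_synonym pt = "real \<times> complex \<times> complex"

definition spacetime :: "pt set" where
  "spacetime = {x. norm (snd x) = 1}"

definition tangent_space :: "pt \<Rightarrow> pt set" where
  "tangent_space x = {v. snd v \<bullet> snd x = 0}"

definition flrw_metric :: "(real \<Rightarrow> real) \<Rightarrow> pt \<Rightarrow> pt \<Rightarrow> pt \<Rightarrow> real" where
  "flrw_metric a x v w = - (fst v * fst w) + (a (fst x))\<^sup>2 * (snd v \<bullet> snd w)"

definition d_t :: pt where
  "d_t = (1, 0)"

text \<open>A vector field on the spacetime is represented by a smooth extension to the surrounding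
  vector space.  Every smooth field on the (closed) submanifold has such an extension, and only
  the values and tangential derivatives on the submanifold matter in what follows.\<close>

definition vector_field :: "(pt \<Rightarrow> pt) \<Rightarrow> bool" where
  "vector_field X \<longleftrightarrow> smooth_on UNIV X \<and> (\<forall>x\<in>spacetime. X x \<in> tangent_space x)"

definition directional_deriv :: "(pt \<Rightarrow> pt) \<Rightarrow> (pt \<Rightarrow> 'b::real_normed_vector) \<Rightarrow> pt \<Rightarrow> 'b" where
  "directional_deriv X f x = frechet_derivative f (at x) (X x)"

definition lie_bracket :: "(pt \<Rightarrow> pt) \<Rightarrow> (pt \<Rightarrow> pt) \<Rightarrow> pt \<Rightarrow> pt" where
  "lie_bracket X Y x = directional_deriv X Y x - directional_deriv Y X x"

definition affine_connection :: "((pt \<Rightarrow> pt) \<Rightarrow> (pt \<Rightarrow> pt) \<Rightarrow> pt \<Rightarrow> pt) \<Rightarrow> bool" where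
  "affine_connection D \<longleftrightarrow>
     (\<forall>X Y. vector_field X \<longrightarrow> vector_field Y \<longrightarrow> vector_field (D X Y)) \<and>
     (\<forall>X X' Y. vector_field X \<longrightarrow> vector_field X' \<longrightarrow> vector_field Y \<longrightarrow>
        (\<forall>x\<in>spacetime. D (\<lambda>y. X y + X' y) Y x = D X Y x + D X' Y x)) \<and>
     (\<forall>X Y Y'. vector_field X \<longrightarrow> vector_field Y \<longrightarrow> vector_field Y' \<longrightarrow>
        (\<forall>x\<in>spacetime. D X (\<lambda>y. Y y + Y' y) x = D X Y x + D X Y' x)) \<and>
     (\<forall>f X Y. smooth_on UNIV f \<longrightarrow> vector_field X \<longrightarrow> vector_field Y \<longrightarrow>
        (\<forall>x\<in>spacetime. D (\<lambda>y. f y *\<^sub>R X y) Y x = f x *\<^sub>R D X Y x)) \<and>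
     (\<forall>f X Y. smooth_on UNIV f \<longrightarrow> vector_field X \<longrightarrow> vector_field Y \<longrightarrow>
        (\<forall>x\<in>spacetime. D X (\<lambda>y. f y *\<^sub>R Y y) x
           = directional_deriv X f x *\<^sub>R Y x + f x *\<^sub>R D X Y x))"

definition is_levi_civita ::
  "(real \<Rightarrow> real) \<Rightarrow> ((pt \<Rightarrow> pt) \<Rightarrow> (pt \<Rightarrow> pt) \<Rightarrow> pt \<Rightarrow> pt) \<Rightarrow> bool" where
  "is_levi_civita a D \<longleftrightarrow> affine_connection D \<and>
     (\<forall>X Y. vector_field X \<longrightarrow> vector_field Y \<longrightarrow>
        (\<forall>x\<in>spacetime. D X Y x - D Y X x = lie_bracket X Y x)) \<and>
     (\<forall>X Y Z. vector_field X \<longrightarrow> vector_field Y \<longrightarrow> vector_field Z \<longrightarrow>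
        (\<forall>x\<in>spacetime. directional_deriv X (\<lambda>y. flrw_metric a y (Y y) (Z y)) x
           = flrw_metric a x (D X Y x) (Z x) + flrw_metric a x (Y x) (D X Z x)))"

text \<open>By the fundamental theorem of semi-Riemannian geometry the values of the chosen operator
  on the spacetime are uniquely determined; the choice only concerns the extension.\<close>

definition nabla :: "(real \<Rightarrow> real) \<Rightarrow> (pt \<Rightarrow> pt) \<Rightarrow> (pt \<Rightarrow> pt) \<Rightarrow> pt \<Rightarrow> pt" where
  "nabla a = (SOME D. is_levi_civita a D)"

text \<open>Orthogonal projection of a fixed vector to all tangent spaces.  It extends a tangent vector
  \<open>v\<close> at \<open>x\<close> to a vector field, and serves to evaluate expressions that are tensorial in \<open>v\<close>.\<close>

definition tangent_extension :: "pt \<Rightarrow> pt \<Rightarrow> pt" where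
  "tangent_extension v = (\<lambda>x. (fst v, snd v - (snd v \<bullet> snd x) *\<^sub>R snd x))"


subsection \<open>Curvature\<close>

definition curvature_operator ::
  "(real \<Rightarrow> real) \<Rightarrow> (pt \<Rightarrow> pt) \<Rightarrow> (pt \<Rightarrow> pt) \<Rightarrow> (pt \<Rightarrow> pt) \<Rightarrow> pt \<Rightarrow> pt" where
  "curvature_operator a X Y Z x =
     nabla a X (nabla a Y Z) x - nabla a Y (nabla a X Z) x - nabla a (lie_bracket X Y) Z x"

definition riemann :: "(real \<Rightarrow> real) \<Rightarrow> pt \<Rightarrow> pt \<Rightarrow> pt \<Rightarrow> pt \<Rightarrow> pt" where
  "riemann a x u v w =
     curvature_operator a (tangent_extension u) (tangent_extension v) (tangent_extension w) x"

definition orthonormal_basis :: "(real \<Rightarrow> real) \<Rightarrow> pt \<Rightarrow> pt set \<Rightarrow> bool" where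
  "orthonormal_basis a x B \<longleftrightarrow> finite B \<and> span B = tangent_space x \<and>
     (\<forall>e\<in>B. \<bar>flrw_metric a x e e\<bar> = 1) \<and>
     (\<forall>e\<in>B. \<forall>e'\<in>B. e \<noteq> e' \<longrightarrow> flrw_metric a x e e' = 0)"

text \<open>The trace of a bilinear form with respect to the Lorentzian metric; the factors
  \<open>flrw_metric a x e e\<close> are the signs of the basis vectors, and the result does not depend on
  the basis.\<close>

definition metric_trace :: "(real \<Rightarrow> real) \<Rightarrow> pt \<Rightarrow> (pt \<Rightarrow> pt \<Rightarrow> real) \<Rightarrow> real" where
  "metric_trace a x \<beta> =
     (\<Sum>e\<in>(SOME B. orthonormal_basis a x B). flrw_metric a x e e * \<beta> e e)"

definition ricci :: "(real \<Rightarrow> real) \<Rightarrow> pt \<Rightarrow> pt \<Rightarrow> pt \<Rightarrow> real" where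
  "ricci a x v w = metric_trace a x (\<lambda>e e'. flrw_metric a x (riemann a x e v w) e')"

definition scalar_curvature :: "(real \<Rightarrow> real) \<Rightarrow> pt \<Rightarrow> real" where
  "scalar_curvature a x = metric_trace a x (ricci a x)"

definition Ein :: "(real \<Rightarrow> real) \<Rightarrow> pt \<Rightarrow> pt \<Rightarrow> pt \<Rightarrow> real" where
  "Ein a x v w = ricci a x v w - scalar_curvature a x * flrw_metric a x v w / 2"

definition future_causal :: "(real \<Rightarrow> real) \<Rightarrow> pt \<Rightarrow> pt \<Rightarrow> bool" where
  "future_causal a x v \<longleftrightarrow> v \<in> tangent_space x \<and> v \<noteq> 0 \<and>
     flrw_metric a x v v \<le> 0 \<and> flrw_metric a x v d_t < 0"

definition dominant_energy_condition :: "(real \<Rightarrow> real) \<Rightarrow> bool" where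
  "dominant_energy_condition a \<longleftrightarrow>
     (\<forall>x\<in>spacetime. \<forall>v w. future_causal a x v \<longrightarrow> future_causal a x w \<longrightarrow> 0 \<le> Ein a x v w)"


subsection \<open>Parametrised tori\<close>

text \<open>Tori in the spacetime are given by immersions of the plane with period \<open>2\<pi>\<close> in both
  variables.\<close>

type_synonym surf = "real \<times> real \<Rightarrow> pt"

definition periodic :: "surf \<Rightarrow> bool" where
  "periodic F \<longleftrightarrow> (\<forall>u v. F (u + 2 * pi, v) = F (u, v) \<and> F (u, v + 2 * pi) = F (u, v))"

definition coord_dir :: "2 \<Rightarrow> real \<times> real" where
  "coord_dir i = (if i = 1 then (1, 0) else (0, 1))"

definition partial_deriv :: "surf \<Rightarrow> 2 \<Rightarrow> surf" where
  "partial_deriv F i = (\<lambda>\<theta>. frechet_derivative F (at \<theta>) (coord_dir i))"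

text \<open>Covariant derivative, in the \<open>i\<close>-th coordinate direction, of a tangent field \<open>V\<close> of the
  spacetime along \<open>F\<close>.  With \<open>E\<^sub>b\<close> the vector field \<open>tangent_extension b\<close> one has
  \<open>V = \<Sum>\<^sub>b (V \<bullet> b) (E\<^sub>b \<circ> F)\<close>, and the Leibniz rule for the pulled-back connection gives the
  formula below.\<close>

definition covariant_deriv_along :: "(real \<Rightarrow> real) \<Rightarrow> surf \<Rightarrow> 2 \<Rightarrow> surf \<Rightarrow> surf" where
  "covariant_deriv_along a F i V \<theta> =
     (\<Sum>b\<in>Basis. (partial_deriv V i \<theta> \<bullet> b) *\<^sub>R tangent_extension b (F \<theta>)
        + (V \<theta> \<bullet> b) *\<^sub>R
            nabla a (tangent_extension (partial_deriv F i \<theta>)) (tangent_extension b) (F \<theta>))"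

definition induced_metric :: "(real \<Rightarrow> real) \<Rightarrow> surf \<Rightarrow> real \<times> real \<Rightarrow> real^2^2" where
  "induced_metric a F \<theta> =
     (\<chi> i j. flrw_metric a (F \<theta>) (partial_deriv F i \<theta>) (partial_deriv F j \<theta>))"

definition induced_trace ::
  "(real \<Rightarrow> real) \<Rightarrow> surf \<Rightarrow> real \<times> real \<Rightarrow> (2 \<Rightarrow> 2 \<Rightarrow> 'b::real_vector) \<Rightarrow> 'b" where
  "induced_trace a F \<theta> \<beta> =
     (\<Sum>i\<in>UNIV. \<Sum>j\<in>UNIV. (matrix_inv (induced_metric a F \<theta>) $ i $ j) *\<^sub>R \<beta> i j)"

definition normal_part :: "(real \<Rightarrow> real) \<Rightarrow> surf \<Rightarrow> real \<times> real \<Rightarrow> pt \<Rightarrow> pt" where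
  "normal_part a F \<theta> w =
     w - induced_trace a F \<theta>
           (\<lambda>i j. flrw_metric a (F \<theta>) w (partial_deriv F i \<theta>) *\<^sub>R partial_deriv F j \<theta>)"

definition second_fundamental_form ::
  "(real \<Rightarrow> real) \<Rightarrow> surf \<Rightarrow> real \<times> real \<Rightarrow> 2 \<Rightarrow> 2 \<Rightarrow> pt" where
  "second_fundamental_form a F \<theta> i j =
     - normal_part a F \<theta> (covariant_deriv_along a F i (partial_deriv F j) \<theta>)"

definition mean_curvature_vector :: "(real \<Rightarrow> real) \<Rightarrow> surf \<Rightarrow> real \<times> real \<Rightarrow> pt" where
  "mean_curvature_vector a F \<theta> = induced_trace a F \<theta> (second_fundamental_form a F \<theta>)"

definition mean_curvature_sq :: "(real \<Rightarrow> real) \<Rightarrow> surf \<Rightarrow> real \<times> real \<Rightarrow> real" where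
  "mean_curvature_sq a F \<theta> =
     flrw_metric a (F \<theta>) (mean_curvature_vector a F \<theta>) (mean_curvature_vector a F \<theta>)"

definition surface_integral :: "(real \<Rightarrow> real) \<Rightarrow> surf \<Rightarrow> (real \<times> real \<Rightarrow> real) \<Rightarrow> real" where
  "surface_integral a F f =
     integral (cbox (0, 0) (2 * pi, 2 * pi)) (\<lambda>\<theta>. f \<theta> * sqrt (det (induced_metric a F \<theta>)))"

definition area :: "(real \<Rightarrow> real) \<Rightarrow> surf \<Rightarrow> real" where
  "area a F = surface_integral a F (\<lambda>_. 1)"

definition willmore_energy :: "(real \<Rightarrow> real) \<Rightarrow> surf \<Rightarrow> real" where
  "willmore_energy a F = surface_integral a F (mean_curvature_sq a F)"


subsection \<open>Variations and the area-constrained Willmore condition\<close>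

definition smooth_variation :: "surf \<Rightarrow> (real \<Rightarrow> surf) \<Rightarrow> bool" where
  "smooth_variation F \<Phi> \<longleftrightarrow> \<Phi> 0 = F \<and>
     (\<exists>\<epsilon>>0. smooth_on ({-\<epsilon><..<\<epsilon>} \<times> UNIV) (\<lambda>(s, \<theta>). \<Phi> s \<theta>) \<and>
        (\<forall>s\<in>{-\<epsilon><..<\<epsilon>}. periodic (\<Phi> s) \<and> range (\<Phi> s) \<subseteq> spacetime))"

definition initial_velocity :: "(real \<Rightarrow> surf) \<Rightarrow> surf" where
  "initial_velocity \<Phi> = (\<lambda>\<theta>. vector_derivative (\<lambda>s. \<Phi> s \<theta>) (at 0))"

definition normal_variation :: "(real \<Rightarrow> real) \<Rightarrow> surf \<Rightarrow> (real \<Rightarrow> surf) \<Rightarrow> bool" where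
  "normal_variation a F \<Phi> \<longleftrightarrow> smooth_variation F \<Phi> \<and>
     (\<forall>\<theta> i. flrw_metric a (F \<theta>) (initial_velocity \<Phi> \<theta>) (partial_deriv F i \<theta>) = 0)"

definition fully_area_constrained_Willmore :: "(real \<Rightarrow> real) \<Rightarrow> surf \<Rightarrow> bool" where
  "fully_area_constrained_Willmore a F \<longleftrightarrow>
     (\<forall>\<Phi>. normal_variation a F \<Phi> \<longrightarrow> (\<forall>\<^sub>F s in nhds 0. area a (\<Phi> s) = area a F) \<longrightarrow>
        ((\<lambda>s. willmore_energy a (\<Phi> s)) has_real_derivative 0) (at 0))"

definition common_lagrange_multiplier :: "(real \<Rightarrow> real) \<Rightarrow> surf \<Rightarrow> real \<Rightarrow> bool" where
  "common_lagrange_multiplier a F \<Lambda> \<longleftrightarrow>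
     (\<forall>\<Phi>. normal_variation a F \<Phi> \<longrightarrow>
        (\<exists>A'. ((\<lambda>s. area a (\<Phi> s)) has_real_derivative A') (at 0) \<and>
              ((\<lambda>s. willmore_energy a (\<Phi> s)) has_real_derivative \<Lambda> * A') (at 0)))"


subsection \<open>Clifford tori in a time slice\<close>

text \<open>A point \<open>(t, p)\<close> of the slice \<open>t = t\<^sub>0\<close> corresponds to the point \<open>a(t\<^sub>0) p\<close> of the sphere
  of radius \<open>a(t\<^sub>0)\<close>.\<close>

definition clifford_torus :: "real \<Rightarrow> real \<Rightarrow> surf" where
  "clifford_torus t0 \<alpha> = (\<lambda>(u, v). (t0, of_real (cos \<alpha>) * cis u, of_real (sin \<alpha>) * cis v))"

lemma image_clifford_torus:
  assumes "0 < \<alpha>" "\<alpha> < pi / 2" "0 < a t0"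
  shows "(\<lambda>x. a t0 *\<^sub>R snd x) ` range (clifford_torus t0 \<alpha>) =
    {z. norm z = a t0 \<and> norm (fst z) = a t0 * cos \<alpha> \<and> norm (snd z) = a t0 * sin \<alpha>}"
    (is "?L = ?R")
proof (intro subset_antisym subsetI)
  have cs: "cos \<alpha> > 0" "sin \<alpha> > 0"
    using assms by (auto intro!: cos_gt_zero sin_gt_zero)
  fix z assume "z \<in> ?L"
  then obtain u v where z: "z = a t0 *\<^sub>R (of_real (cos \<alpha>) * cis u, of_real (sin \<alpha>) * cis v)"
    unfolding clifford_torus_def by fastforce
  have "norm (of_real (cos \<alpha>) * cis u, of_real (sin \<alpha>) * cis v) = 1"
    using cs by (simp add: norm_Pair norm_mult)
  then have "norm z = a t0"
    using assms(3) by (simp only: z norm_scaleR)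
  then show "z \<in> ?R"
    using cs assms(3) by (simp add: z norm_mult)
next
  fix z assume z: "z \<in> ?R"
  obtain z1 z2 where z12: "z = (z1, z2)" by (cases z)
  have "z1 = of_real (norm z1) * cis (Arg z1)" "z2 = of_real (norm z2) * cis (Arg z2)"
    by (metis rcis_cmod_Arg rcis_def)+
  then have "z = a t0 *\<^sub>R snd (clifford_torus t0 \<alpha> (Arg z1, Arg z2))"
    using z by (simp add: z12 clifford_torus_def scaleR_conv_of_real mult.assoc)
  then show "z \<in> ?L" by blast
qed

lemma clifford_torus_eq_iff:
  assumes "0 < \<alpha>" "\<alpha> < pi / 2"
  shows "clifford_torus t0 \<alpha> (u, v) = clifford_torus t0 \<alpha> (u', v') \<longleftrightarrow>
    (\<exists>(m::int) (n::int). u' = u + 2 * pi * m \<and> v' = v + 2 * pi * n)"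
proof -
  have cs: "cos \<alpha> > 0" "sin \<alpha> > 0"
    using assms by (auto intro!: cos_gt_zero sin_gt_zero)
  have eq: "cis x = cis y \<longleftrightarrow> (\<exists>n :: int. y = x + 2 * pi * n)" for x y
    using sin_cos_eq_iff[of y x] by (auto simp: complex_eq_iff mult.assoc)
  show ?thesis using cs by (simp add: clifford_torus_def eq)
qed

text \<open>A unit normal of the surface within a time slice: the vector is required to be tangent to
  the slice, i.e. to have no \<open>d_t\<close> component.\<close>

definition unit_normal_in_slice :: "(real \<Rightarrow> real) \<Rightarrow> surf \<Rightarrow> surf \<Rightarrow> bool" where
  "unit_normal_in_slice a F \<nu> \<longleftrightarrow> smooth_on UNIV \<nu> \<and>
     (\<forall>\<theta>. \<nu> \<theta> \<in> tangent_space (F \<theta>) \<and> fst (\<nu> \<theta>) = 0 \<and>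
        flrw_metric a (F \<theta>) (\<nu> \<theta>) (\<nu> \<theta>) = 1 \<and>
        (\<forall>i. flrw_metric a (F \<theta>) (\<nu> \<theta>) (partial_deriv F i \<theta>) = 0))"

text \<open>\<open>slice_K\<close> is the second fundamental form of the time slice through \<open>x\<close> (the field \<open>d_t\<close> is
  constant in \<open>\<real> \<times> \<complex>\<^sup>2\<close>), and \<open>slice_P\<close> is its trace over the surface.\<close>

definition slice_K :: "(real \<Rightarrow> real) \<Rightarrow> pt \<Rightarrow> pt \<Rightarrow> pt \<Rightarrow> real" where
  "slice_K a x v w = flrw_metric a x (nabla a (tangent_extension v) (\<lambda>_. d_t) x) w"

definition slice_P :: "(real \<Rightarrow> real) \<Rightarrow> surf \<Rightarrow> real \<times> real \<Rightarrow> real" where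
  "slice_P a F \<theta> = induced_trace a F \<theta>
     (\<lambda>i j. slice_K a (F \<theta>) (partial_deriv F i \<theta>) (partial_deriv F j \<theta>))"

text \<open>Second fundamental form of the surface within its time slice.  The Levi-Civita connection
  of the slice is the tangential part of the one of the spacetime, so pairing with a vector
  tangent to the slice gives the same value.\<close>

definition slice_B :: "(real \<Rightarrow> real) \<Rightarrow> surf \<Rightarrow> surf \<Rightarrow> real \<times> real \<Rightarrow> 2 \<Rightarrow> 2 \<Rightarrow> real" where
  "slice_B a F \<nu> \<theta> i j =
     flrw_metric a (F \<theta>) (covariant_deriv_along a F i \<nu> \<theta>) (partial_deriv F j \<theta>)"

definition trace_free_B ::
  "(real \<Rightarrow> real) \<Rightarrow> surf \<Rightarrow> surf \<Rightarrow> real \<times> real \<Rightarrow> 2 \<Rightarrow> 2 \<Rightarrow> real" where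
  "trace_free_B a F \<nu> \<theta> i j = slice_B a F \<nu> \<theta> i j
     - induced_trace a F \<theta> (slice_B a F \<nu> \<theta>) / 2 * (induced_metric a F \<theta> $ i $ j)"

definition induced_norm_sq ::
  "(real \<Rightarrow> real) \<Rightarrow> surf \<Rightarrow> real \<times> real \<Rightarrow> (2 \<Rightarrow> 2 \<Rightarrow> real) \<Rightarrow> real" where
  "induced_norm_sq a F \<theta> \<beta> =
     induced_trace a F \<theta> (\<lambda>i k. induced_trace a F \<theta> (\<lambda>j l. \<beta> i j * \<beta> k l))"

end

theory Submission
  imports Defs
begin

text \<open>The Levi-Civita connection is the flat derivative of \<open>\<real> \<times> \<complex>\<^sup>2\<close>, made tangent to the sphere,
  plus Christoffel terms in \<open>h = a'/a\<close>, so curvature and \<open>\<parallel>H\<parallel>\<^sup>2\<close> become explicit functions of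
  \<open>a\<close> and of the \<open>2\<close>-jet of the surface.  On \<open>T\<^bsub>\<pi>/4\<^esub>\<close> the trace \<open>E\<close> of the covariant second
  derivatives is \<open>2 h \<partial>\<^sub>t\<close>; hence only the time component of \<open>E\<close> contributes to the first
  variation of \<open>\<parallel>H\<parallel>\<^sup>2 = g(E, E) - \<parallel>E\<^sup>\<top>\<parallel>\<^sup>2\<close>.  Subtracting exact divergences, which integrate to zero
  over the torus for every parameter value, one finds that both first variations are multiples of
  the integral of the time component of the velocity, with quotient \<open>- 4 a''/a\<close>.
  For \<open>\<alpha> \<noteq> \<pi>/4\<close> a family of homogeneous tori of constant area, moving in time, yields
  \<open>4 (a a'' - a'\<^sup>2) = 4 + (cos \<alpha> sin \<alpha>)\<^sup>-\<^sup>2 > 8\<close>, whereas the dominant energy condition, applied to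
  a null vector, gives \<open>a a'' - a'\<^sup>2 \<le> 1\<close>.\<close>

section \<open>Calculus of \<open>C\<^sup>k\<close> maps\<close>

text \<open>The parameter derivative of the Willmore density contains second surface derivatives of
  an arbitrary velocity. Integrating them by parts would mean exchanging parameter and surface
  derivatives. Instead the divergences are formed from the moving surfaces and added before
  differentiating: the integral is unchanged near the initial parameter, and the derivative of the
  corrected density vanishes point by point. Accordingly the two mixed second derivatives of a
  surface are carried as separate arguments, and only their sum enters the trace. A second obstacle
  is that \<open>nabla\<close> is a choice which its axioms determine only at points of the
  spacetime. Iterating it in the curvature is possible because tangential derivatives depend only on
  values there. The quotient arises as follows. If X is the integral of the time component of the
  velocity, the area changes by \<open>a a' X\<close> and the energy by \<open>- 4 a' a'' X\<close>:
  the part of the energy variation coming from \<open>h'\<close> and the part coming from the area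
  element combine so that the terms in \<open>a'^3\<close> cancel.\<close>

lemma frechet_derivative_eq:
  "(f has_derivative f') (at x) \<Longrightarrow> frechet_derivative f (at x) = f'"
  by (rule frechet_derivative_at[symmetric])

lemma Ck_on_imp_continuous_on: "Ck_on k S f \<Longrightarrow> continuous_on S f"
  by (cases k)
    (auto intro!: continuous_at_imp_continuous_on differentiable_imp_continuous_within)

lemma Ck_on_Suc_imp_Ck_on: "Ck_on (Suc k) S f \<Longrightarrow> Ck_on k S f"
proof (induction k arbitrary: f)
  case 0
  then show ?case using Ck_on_imp_continuous_on by (metis Ck_on.simps(1))
next
  case (Suc k)
  then show ?case by (metis Ck_on.simps(2))
qed

lemma Ck_on_Suc_has_derivative:
  "Ck_on (Suc k) S f \<Longrightarrow> x \<in> S \<Longrightarrow> (f has_derivative frechet_derivative f (at x)) (at x)"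
  using frechet_derivative_works by auto

lemma Ck_on_frechet_derivative:
  "Ck_on (Suc k) S f \<Longrightarrow> Ck_on k S (\<lambda>x. frechet_derivative f (at x) v)"
  by simp

lemma Ck_on_subset: "Ck_on k S f \<Longrightarrow> T \<subseteq> S \<Longrightarrow> Ck_on k T f"
  by (induction k arbitrary: f) (auto intro: continuous_on_subset)

text \<open>Openness lets agreement of the functions pass to their Frechet derivatives, where the
  recursion in \<open>k\<close> needs it again.\<close>

lemma Ck_on_cong:
  "Ck_on k S f \<Longrightarrow> open S \<Longrightarrow> (\<And>x. x \<in> S \<Longrightarrow> f x = g x) \<Longrightarrow> Ck_on k S g"
proof (induction k arbitrary: f g)
  case 0
  then show ?case using continuous_on_cong[of S S f g] by simp
next
  case (Suc k)
  have d: "(g has_derivative frechet_derivative f (at x)) (at x)" if "x \<in> S" for x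
    by (rule has_derivative_transform_within_open[OF Ck_on_Suc_has_derivative[OF Suc.prems(1) that]
          Suc.prems(2) that Suc.prems(3)])
  have "Ck_on k S (\<lambda>x. frechet_derivative g (at x) v)" for v
  proof (rule Suc.IH[of "\<lambda>x. frechet_derivative f (at x) v"])
    show "frechet_derivative f (at x) v = frechet_derivative g (at x) v" if "x \<in> S" for x
      using frechet_derivative_eq[OF d[OF that]] by simp
  qed (use Suc.prems in simp_all)
  then show ?case using d by (auto simp: differentiable_def)
qed

text \<open>The recursion for \<open>Ck_on\<close> speaks of \<open>frechet_derivative\<close>, a
  choice; here a derivative computed by hand may stand in for it. The inductive closure rules below
  rest on this.\<close>

lemma Ck_on_SucI:
  assumes "open S" "\<And>x. x \<in> S \<Longrightarrow> (f has_derivative f' x) (at x)"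
    and "\<And>v. Ck_on k S (\<lambda>x. f' x v)"
  shows "Ck_on (Suc k) S f"
proof -
  have "Ck_on k S (\<lambda>x. frechet_derivative f (at x) v)" for v
    using frechet_derivative_eq[OF assms(2)] by (intro Ck_on_cong[OF assms(3)[of v] assms(1)]) simp
  then show ?thesis using assms(2) by (auto simp: differentiable_def)
qed

named_theorems Ck_intros

lemma Ck_on_const [Ck_intros]: "Ck_on k S (\<lambda>x. c)"
  by (induction k arbitrary: c) auto

lemma Ck_on_bounded_linear:
  assumes "bounded_linear L" "open S" "Ck_on k S f"
  shows "Ck_on k S (\<lambda>x. L (f x))"
  using assms(3)
proof (induction k arbitrary: f)
  case 0
  then show ?case using assms(1) by (simp add: bounded_linear.continuous_on)
next
  case (Suc k)
  show ?case
    by (rule Ck_on_SucI[OF assms(2)])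
      (rule bounded_linear.has_derivative[OF assms(1)] Ck_on_Suc_has_derivative Suc
        Ck_on_frechet_derivative | assumption)+
qed

lemma Ck_on_ident [Ck_intros]: "open S \<Longrightarrow> Ck_on k S (\<lambda>x. x)"
proof (cases k)
  case (Suc n)
  assume "open S"
  then show ?thesis unfolding Suc
    by (rule Ck_on_SucI[where f' = "\<lambda>x v. v"]) (auto intro: Ck_on_const has_derivative_ident)
qed auto

lemma Ck_on_add [Ck_intros]:
  assumes "open S" "Ck_on k S f" "Ck_on k S g"
  shows "Ck_on k S (\<lambda>x. f x + g x)"
  using assms(2,3)
proof (induction k arbitrary: f g)
  case 0
  then show ?case by (auto intro: continuous_on_add)
next
  case (Suc k)
  show ?case
    by (rule Ck_on_SucI[OF assms(1)])
      (rule has_derivative_add Ck_on_Suc_has_derivative Suc Ck_on_frechet_derivative | assumption)+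
qed

text \<open>The product rule gives two terms of the same bilinear form, each with one factor
  differentiated, so the induction closes. Scalar multiples, products and inner products are
  instances.\<close>

lemma Ck_on_bilinear:
  assumes B: "bounded_bilinear B" and "open S" "Ck_on k S f" "Ck_on k S g"
  shows "Ck_on k S (\<lambda>x. B (f x) (g x))"
  using assms(3,4)
proof (induction k arbitrary: f g)
  case 0
  then show ?case using B by (auto intro: bounded_bilinear.continuous_on)
next
  case (Suc k)
  show ?case
    by (rule Ck_on_SucI[OF assms(2)])
      (rule bounded_bilinear.FDERIV[OF B] Ck_on_Suc_has_derivative Ck_on_add[OF assms(2)]
        Suc Ck_on_frechet_derivative Ck_on_Suc_imp_Ck_on | assumption)+
qed

lemmas Ck_on_scaleR [Ck_intros] = Ck_on_bilinear[OF bounded_bilinear_scaleR]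
lemmas Ck_on_mult [Ck_intros] = Ck_on_bilinear[OF bounded_bilinear_mult]
lemmas Ck_on_inner [Ck_intros] = Ck_on_bilinear[OF bounded_bilinear_inner]
lemmas Ck_on_fst [Ck_intros] = Ck_on_bounded_linear[OF bounded_linear_fst]
lemmas Ck_on_snd [Ck_intros] = Ck_on_bounded_linear[OF bounded_linear_snd]
lemmas Ck_on_minus [Ck_intros] = Ck_on_bounded_linear[OF bounded_linear_minus[OF bounded_linear_ident]]
lemmas Ck_on_of_real [Ck_intros] = Ck_on_bounded_linear[OF bounded_linear_of_real]

lemma Ck_on_diff [Ck_intros]:
  "open S \<Longrightarrow> Ck_on k S f \<Longrightarrow> Ck_on k S g \<Longrightarrow> Ck_on k S (\<lambda>x. f x - g x)"
  using Ck_on_add[of S k f "\<lambda>x. - g x"] Ck_on_minus[of S k g] by simp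

lemma Ck_on_power2 [Ck_intros]:
  fixes f :: "'a::real_normed_vector \<Rightarrow> 'b::real_normed_algebra_1"
  shows "open S \<Longrightarrow> Ck_on k S f \<Longrightarrow> Ck_on k S (\<lambda>x. (f x)\<^sup>2)"
  by (simp add: power2_eq_square Ck_on_mult)

lemma Ck_on_sum [Ck_intros]:
  "open S \<Longrightarrow> (\<And>i. i \<in> I \<Longrightarrow> Ck_on k S (f i)) \<Longrightarrow> Ck_on k S (\<lambda>x. \<Sum>i\<in>I. f i x)"
  by (induction I rule: infinite_finite_induct) (simp_all add: Ck_on_const Ck_on_add)

lemma Ck_on_Pair [Ck_intros]:
  assumes "open S" "Ck_on k S f" "Ck_on k S g"
  shows "Ck_on k S (\<lambda>x. (f x, g x))"
proof -
  have "bounded_linear (\<lambda>y. (y, 0))" "bounded_linear (\<lambda>y. (0, y))"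
    by (auto intro!: bounded_linear_intros)
  then have "Ck_on k S (\<lambda>x. (f x, 0) + (0, g x))"
    by (intro Ck_on_add Ck_on_bounded_linear[of "\<lambda>y. (y, 0)"] Ck_on_bounded_linear[of "\<lambda>y. (0, y)"] assms)
  then show ?thesis by simp
qed

text \<open>\<open>Ck_on\<close> controls derivatives in fixed directions. A basis expansion reduces
  a direction that moves with the point to finitely many fixed ones.\<close>

lemma frechet_derivative_Basis_sum:
  fixes f :: "'a::euclidean_space \<Rightarrow> 'b::real_normed_vector"
  assumes "f differentiable at x"
  shows "frechet_derivative f (at x) v
    = (\<Sum>b\<in>Basis. (v \<bullet> b) *\<^sub>R frechet_derivative f (at x) b)"
proof -
  have "linear (frechet_derivative f (at x))"
    using assms linear_frechet_derivative by blast
  then have "frechet_derivative f (at x) (\<Sum>b\<in>Basis. (v \<bullet> b) *\<^sub>R b)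
    = (\<Sum>b\<in>Basis. (v \<bullet> b) *\<^sub>R frechet_derivative f (at x) b)"
    by (simp add: linear_sum linear_scale)
  then show ?thesis by (simp add: euclidean_representation)
qed

lemma Ck_on_frechet_derivative_apply:
  fixes f :: "'a::euclidean_space \<Rightarrow> 'b::real_normed_vector"
  assumes "open S" "Ck_on (Suc k) S f" "Ck_on k S g"
  shows "Ck_on k S (\<lambda>x. frechet_derivative f (at x) (g x))"
proof (rule Ck_on_cong[OF _ assms(1)])
  show "Ck_on k S (\<lambda>x. \<Sum>b\<in>Basis. (g x \<bullet> b) *\<^sub>R frechet_derivative f (at x) b)"
    using assms by (intro Ck_intros Ck_on_frechet_derivative)
  show "(\<Sum>b\<in>Basis. (g x \<bullet> b) *\<^sub>R frechet_derivative f (at x) b)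
      = frechet_derivative f (at x) (g x)" if "x \<in> S" for x
    using differentiableI[OF Ck_on_Suc_has_derivative[OF assms(2) that]]
    by (rule frechet_derivative_Basis_sum[symmetric])
qed

text \<open>After the chain rule and a basis expansion, the derivative is a sum of coefficients
  times directional derivatives of \<open>g\<close>, again composed with the same \<open>f\<close>.
  Hence the induction keeps \<open>f\<close> and generalises \<open>g\<close>.\<close>

lemma Ck_on_compose:
  fixes g :: "'b::euclidean_space \<Rightarrow> 'c::real_normed_vector"
  assumes "open S" "open T" "Ck_on k S f" "Ck_on k T g" "\<And>x. x \<in> S \<Longrightarrow> f x \<in> T"
  shows "Ck_on k S (\<lambda>x. g (f x))"
  using assms(3,4)
proof (induction k arbitrary: g)
  case 0
  then show ?case using assms(5)
    by (auto intro: continuous_on_compose2)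
next
  case (Suc k)
  show ?case
  proof (rule Ck_on_SucI[OF assms(1)])
    show "((\<lambda>x. g (f x)) has_derivative
        (\<lambda>v. frechet_derivative g (at (f x)) (frechet_derivative f (at x) v))) (at x)"
      if "x \<in> S" for x
      using has_derivative_compose[OF Ck_on_Suc_has_derivative[OF Suc.prems(1) that]]
        Ck_on_Suc_has_derivative[OF Suc.prems(2) assms(5)[OF that]] by blast
    show "Ck_on k S (\<lambda>x. frechet_derivative g (at (f x)) (frechet_derivative f (at x) v))" for v
    proof (rule Ck_on_cong[OF _ assms(1)])
      show "Ck_on k S (\<lambda>x. \<Sum>b\<in>Basis. (frechet_derivative f (at x) v \<bullet> b) *\<^sub>R
          frechet_derivative g (at (f x)) b)"
        using Suc.prems by (intro Ck_intros Suc.IH assms(1) Ck_on_frechet_derivative Ck_on_Suc_imp_Ck_on[of k S f])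
      show "(\<Sum>b\<in>Basis. (frechet_derivative f (at x) v \<bullet> b) *\<^sub>R frechet_derivative g (at (f x)) b)
          = frechet_derivative g (at (f x)) (frechet_derivative f (at x) v)" if "x \<in> S" for x
      proof -
        have "g differentiable at (f x)"
          using Ck_on_Suc_has_derivative[OF Suc.prems(2) assms(5)[OF that]]
          by (rule differentiableI)
        then show ?thesis by (rule frechet_derivative_Basis_sum[symmetric])
      qed
    qed
  qed
qed

text \<open>The derivative is a polynomial in the function itself, so the induction hypothesis
  supplies its regularity. The same device serves \<open>sqrt\<close> (through
  \<open>inverse\<close>) and \<open>cis\<close>.\<close>

lemma Ck_on_inverse_real: "Ck_on k (- {0}) (inverse :: real \<Rightarrow> real)"
proof (induction k)
  case 0
  then show ?case by (auto intro!: continuous_intros)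
next
  case (Suc k)
  show ?case
  proof (rule Ck_on_SucI)
    show "(inverse has_derivative (\<lambda>v. - (inverse x * v * inverse x))) (at x)"
      if "x \<in> - {0}" for x :: real
      using that by (intro has_derivative_inverse') simp
    show "Ck_on k (- {0}) (\<lambda>x. - (inverse x * v * inverse x))" for v :: real
      by (intro Ck_intros Suc) auto
  qed auto
qed

lemma Ck_on_inverse [Ck_intros]:
  fixes f :: "'a::real_normed_vector \<Rightarrow> real"
  shows "open S \<Longrightarrow> Ck_on k S f \<Longrightarrow> (\<And>x. x \<in> S \<Longrightarrow> f x \<noteq> 0) \<Longrightarrow> Ck_on k S (\<lambda>x. inverse (f x))"
  by (rule Ck_on_compose[OF _ _ _ Ck_on_inverse_real]) auto

lemma Ck_on_divide [Ck_intros]: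
  fixes f :: "'a::real_normed_vector \<Rightarrow> real"
  shows "open S \<Longrightarrow> Ck_on k S f \<Longrightarrow> Ck_on k S g \<Longrightarrow> (\<And>x. x \<in> S \<Longrightarrow> g x \<noteq> 0) \<Longrightarrow>
    Ck_on k S (\<lambda>x. f x / g x)"
  unfolding divide_inverse by (intro Ck_intros)

lemma Ck_on_sqrt_real: "Ck_on k {0<..} sqrt"
proof (induction k)
  case 0
  then show ?case by (auto intro!: continuous_intros)
next
  case (Suc k)
  show ?case
  proof (rule Ck_on_SucI)
    show "(sqrt has_derivative (*) (inverse (sqrt x) / 2)) (at x)" if "x \<in> {0<..}" for x
      using DERIV_real_sqrt[of x, unfolded has_field_derivative_def] that by auto
    show "Ck_on k {0<..} (\<lambda>x. inverse (sqrt x) / 2 * v)" for v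
      by (intro Ck_intros Suc) auto
  qed simp
qed

lemma Ck_on_sqrt [Ck_intros]:
  "open S \<Longrightarrow> Ck_on k S f \<Longrightarrow> (\<And>x. x \<in> S \<Longrightarrow> 0 < f x) \<Longrightarrow> Ck_on k S (\<lambda>x. sqrt (f x))"
  by (rule Ck_on_compose[OF _ open_greaterThan _ Ck_on_sqrt_real]) simp_all

lemma Ck_on_cis: "Ck_on k UNIV cis"
proof -
  have d: "(cis has_derivative (\<lambda>v. v *\<^sub>R (\<i> * cis x))) (at x)" for x
    using has_derivative_cis[OF has_derivative_ident[of "at x"]] by simp
  show ?thesis
  proof (induction k)
    case 0
    then show ?case by (auto intro!: continuous_intros)
  next
    case (Suc k)
    show ?case
      by (rule Ck_on_SucI[OF _ d]) (intro Ck_intros Suc open_UNIV)+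
  qed
qed

lemma Ck_on_cis_compose [Ck_intros]:
  "open S \<Longrightarrow> Ck_on k S f \<Longrightarrow> Ck_on k S (\<lambda>x. cis (f x))"
  by (rule Ck_on_compose[OF _ open_UNIV _ Ck_on_cis]) simp_all

section \<open>Smooth maps and derivatives of real functions\<close>

lemma smooth_on_imp_Ck_on: "smooth_on S f \<Longrightarrow> Ck_on k S f"
  by (simp add: smooth_on_def)

lemma smooth_onI: "(\<And>k. Ck_on k S f) \<Longrightarrow> smooth_on S f"
  by (simp add: smooth_on_def)

lemma smooth_on_has_derivative:
  "smooth_on S f \<Longrightarrow> x \<in> S \<Longrightarrow> (f has_derivative frechet_derivative f (at x)) (at x)"
  by (rule Ck_on_Suc_has_derivative[OF smooth_on_imp_Ck_on])

lemma smooth_on_frechet_derivative: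
  "smooth_on S f \<Longrightarrow> smooth_on S (\<lambda>x. frechet_derivative f (at x) v)"
  by (rule smooth_onI, rule Ck_on_frechet_derivative, erule smooth_on_imp_Ck_on)

lemma smooth_on_real_has_derivative:
  assumes "smooth_on UNIV (f :: real \<Rightarrow> real)"
  shows "(f has_real_derivative deriv f x) (at x)"
proof -
  have "f differentiable at x"
    using smooth_on_has_derivative[OF assms] by (auto simp: differentiable_def)
  then obtain D where "(f has_real_derivative D) (at x)"
    using real_differentiableE by blast
  then show ?thesis using DERIV_imp_deriv by blast
qed

lemma smooth_on_deriv:
  assumes "smooth_on UNIV (f :: real \<Rightarrow> real)" shows "smooth_on UNIV (deriv f)"
proof -
  have "frechet_derivative f (at x) 1 = deriv f x" for x
    using frechet_derivative_eq[OF smooth_on_real_has_derivative[OF assms, unfolded has_field_derivative_def]]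
    by simp
  then show ?thesis using smooth_on_frechet_derivative[OF assms, of 1] by simp
qed

section \<open>The Levi-Civita connection\<close>

lemma flrw_metric_commute: "flrw_metric a x v w = flrw_metric a x w v"
  by (simp add: flrw_metric_def inner_commute)

lemma flrw_metric_add_left: "flrw_metric a x (u + v) w = flrw_metric a x u w + flrw_metric a x v w"
  by (simp add: flrw_metric_def inner_add_left algebra_simps)

lemma flrw_metric_diff_left: "flrw_metric a x (u - v) w = flrw_metric a x u w - flrw_metric a x v w"
  by (simp add: flrw_metric_def inner_diff_left algebra_simps)

lemma flrw_metric_scaleR_left: "flrw_metric a x (c *\<^sub>R v) w = c * flrw_metric a x v w"
  by (simp add: flrw_metric_def algebra_simps)

lemma flrw_metric_minus_left: "flrw_metric a x (- v) w = - flrw_metric a x v w"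
  by (simp add: flrw_metric_def)

lemma flrw_metric_zero_left: "flrw_metric a x 0 w = 0"
  by (simp add: flrw_metric_def)

lemma flrw_metric_sum_left:
  "flrw_metric a x (\<Sum>i\<in>I. f i) w = (\<Sum>i\<in>I. flrw_metric a x (f i) w)"
  by (induction I rule: infinite_finite_induct)
    (simp_all add: flrw_metric_add_left flrw_metric_zero_left)

lemmas flrw_metric_left = flrw_metric_add_left flrw_metric_diff_left flrw_metric_scaleR_left
  flrw_metric_minus_left flrw_metric_zero_left flrw_metric_sum_left

lemma flrw_metric_right:
  "flrw_metric a x w (u + v) = flrw_metric a x w u + flrw_metric a x w v"
  "flrw_metric a x w (u - v) = flrw_metric a x w u - flrw_metric a x w v"
  "flrw_metric a x w (c *\<^sub>R v) = c * flrw_metric a x w v"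
  "flrw_metric a x w (- v) = - flrw_metric a x w v"
  "flrw_metric a x w 0 = 0"
  "flrw_metric a x w (\<Sum>i\<in>I. f i) = (\<Sum>i\<in>I. flrw_metric a x w (f i))"
  by (simp_all only: flrw_metric_commute[of a x w] flrw_metric_left)

lemma tangent_space_closed:
  "v \<in> tangent_space x \<Longrightarrow> w \<in> tangent_space x \<Longrightarrow> v + w \<in> tangent_space x"
  "v \<in> tangent_space x \<Longrightarrow> w \<in> tangent_space x \<Longrightarrow> v - w \<in> tangent_space x"
  "v \<in> tangent_space x \<Longrightarrow> c *\<^sub>R v \<in> tangent_space x"
  by (simp_all add: tangent_space_def inner_left_distrib inner_diff_left)

lemma spacetime_inner_self: "x \<in> spacetime \<Longrightarrow> snd x \<bullet> snd x = 1"
  by (simp add: spacetime_def norm_eq_1)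

lemma tangent_extension_tangent:
  "x \<in> spacetime \<Longrightarrow> tangent_extension v x \<in> tangent_space x"
  by (simp add: tangent_extension_def tangent_space_def spacetime_inner_self inner_diff_left)

lemma tangent_extension_at: "v \<in> tangent_space x \<Longrightarrow> tangent_extension v x = v"
  by (simp add: tangent_extension_def tangent_space_def prod_eq_iff)

lemma vector_field_tangent_extension: "vector_field (tangent_extension v)"
  unfolding vector_field_def
  by (intro conjI ballI smooth_onI)
    (auto simp: tangent_extension_tangent, auto simp: tangent_extension_def intro!: Ck_intros)

text \<open>Two functions agreeing on the spacetime agree along the curve
  \<open>s \<mapsto> (t + s v\<^sub>0, (p + s v) / \<parallel>p + s v\<parallel>)\<close>, whose velocity at \<open>s = 0\<close> is \<open>v\<close>.\<close>

lemma tangential_derivative_unique: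
  fixes f g :: "pt \<Rightarrow> 'b::real_normed_vector"
  assumes x: "x \<in> spacetime" and v: "v \<in> tangent_space x"
    and f: "(f has_derivative f') (at x)" and g: "(g has_derivative g') (at x)"
    and eq: "\<And>y. y \<in> spacetime \<Longrightarrow> f y = g y"
  shows "f' v = g' v"
proof -
  define c where "c = snd v \<bullet> snd v"
  define \<gamma> where "\<gamma> s = (fst x + s * fst v, inverse (sqrt (1 + s\<^sup>2 * c)) *\<^sub>R (snd x + s *\<^sub>R snd v))" for s
  have c: "0 \<le> c" by (simp add: c_def)
  have pos: "0 < 1 + s\<^sup>2 * c" for s
    using mult_nonneg_nonneg[OF zero_le_power2[of s] c] by linarith
  have on: "\<gamma> s \<in> spacetime" for s
  proof -
    have "(norm (snd x + s *\<^sub>R snd v))\<^sup>2 = 1 + s\<^sup>2 * c"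
      using v spacetime_inner_self[OF x]
      by (simp only: power2_norm_eq_inner)
        (simp add: c_def tangent_space_def inner_add_left inner_add_right inner_commute power2_eq_square)
    then have "norm (snd x + s *\<^sub>R snd v) = sqrt (1 + s\<^sup>2 * c)"
      by (metis norm_ge_zero real_sqrt_unique)
    then show ?thesis using pos[of s] by (simp add: spacetime_def \<gamma>_def)
  qed
  \<comment> \<open>The normalising factor depends on \<open>s\<close> only through
    \<open>s^2\<close>, so it leaves the velocity at \<open>s = 0\<close> unchanged.\<close>
  have d1: "((\<lambda>s. inverse (sqrt (1 + s\<^sup>2 * c))) has_real_derivative 0) (at 0)"
    by (auto intro!: derivative_eq_intros)
  have d2: "((\<lambda>s. snd x + s *\<^sub>R snd v) has_vector_derivative snd v) (at 0)"
    by (auto intro!: derivative_eq_intros)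
  have "((\<lambda>s. inverse (sqrt (1 + s\<^sup>2 * c)) *\<^sub>R (snd x + s *\<^sub>R snd v)) has_vector_derivative snd v) (at 0)"
    using has_vector_derivative_scaleR[OF d1 d2] by simp
  moreover have "((\<lambda>s. fst x + s * fst v) has_vector_derivative fst v) (at 0)"
    by (auto intro!: derivative_eq_intros)
  ultimately have "(\<gamma> has_vector_derivative (fst v, snd v)) (at 0)"
    unfolding \<gamma>_def by (intro has_vector_derivative_Pair)
  then have dg: "(\<gamma> has_derivative (\<lambda>s. s *\<^sub>R v)) (at 0)"
    by (simp add: has_vector_derivative_def)
  have g0: "\<gamma> 0 = x" by (simp add: \<gamma>_def)
  have "((\<lambda>s. f (\<gamma> s)) has_derivative (\<lambda>s. f' (s *\<^sub>R v))) (at 0)"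
    by (rule has_derivative_compose[OF dg]) (simp add: g0 f)
  moreover have "((\<lambda>s. g (\<gamma> s)) has_derivative (\<lambda>s. g' (s *\<^sub>R v))) (at 0)"
    by (rule has_derivative_compose[OF dg]) (simp add: g0 g)
  ultimately have "(\<lambda>s. f' (s *\<^sub>R v)) = (\<lambda>s. g' (s *\<^sub>R v))"
    using eq[OF on] by (simp add: has_derivative_unique)
  from fun_cong[OF this, of 1] show ?thesis by simp
qed

lemma directional_deriv_eq:
  "(f has_derivative f') (at x) \<Longrightarrow> directional_deriv X f x = f' (X x)"
  by (simp add: directional_deriv_def frechet_derivative_eq)

lemma vector_field_has_derivative:
  "vector_field X \<Longrightarrow> (X has_derivative frechet_derivative X (at x)) (at x)"
  using smooth_on_has_derivative[of UNIV X x] by (simp add: vector_field_def)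

lemma vector_field_tangent: "vector_field X \<Longrightarrow> x \<in> spacetime \<Longrightarrow> X x \<in> tangent_space x"
  by (simp add: vector_field_def)

text \<open>The Christoffel terms of \<open>- dt^2 + a^2 |dz|^2\<close> on the flat surroundings:
  \<open>a a'\<close> in the time component, \<open>h = a'/a\<close> for a time and a space
  argument. The shape of the sphere enters separately, through the normal correction in
  \<open>flrw_connection\<close>.\<close>

definition christoffel :: "(real \<Rightarrow> real) \<Rightarrow> pt \<Rightarrow> pt \<Rightarrow> pt \<Rightarrow> pt" where
  "christoffel a x v w =
     (a (fst x) * deriv a (fst x) * (snd v \<bullet> snd w),
      (deriv a (fst x) / a (fst x)) *\<^sub>R (fst v *\<^sub>R snd w + fst w *\<^sub>R snd v))"

text \<open>The last summand removes the component of the flat derivative normal to the sphere.\<close>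

definition flrw_connection :: "(real \<Rightarrow> real) \<Rightarrow> (pt \<Rightarrow> pt) \<Rightarrow> (pt \<Rightarrow> pt) \<Rightarrow> pt \<Rightarrow> pt" where
  "flrw_connection a X Y x = directional_deriv X Y x + christoffel a x (X x) (Y x)
     + (0, (snd (X x) \<bullet> snd (Y x)) *\<^sub>R snd x)"

lemma christoffel_commute: "christoffel a x v w = christoffel a x w v"
  by (simp add: christoffel_def inner_commute add.commute)

lemma christoffel_linear_left:
  "christoffel a x (u + v) w = christoffel a x u w + christoffel a x v w"
  "christoffel a x (c *\<^sub>R v) w = c *\<^sub>R christoffel a x v w"
  "christoffel a x 0 w = 0"
  by (simp_all add: christoffel_def prod_eq_iff inner_add_left algebra_simps)

lemma christoffel_linear_right:
  "christoffel a x w (u + v) = christoffel a x w u + christoffel a x w v"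
  "christoffel a x w (c *\<^sub>R v) = c *\<^sub>R christoffel a x w v"
  "christoffel a x w 0 = 0"
  by (simp_all only: christoffel_commute[of a x w] christoffel_linear_left)

locale flrw =
  fixes a :: "real \<Rightarrow> real"
  assumes smooth: "smooth_on UNIV a" and pos: "\<And>t. 0 < a t"
begin

lemma nonzero [simp]: "a t \<noteq> 0"
  using pos[of t] by simp

lemma has_derivative_a: "(a has_real_derivative deriv a t) (at t)"
  by (rule smooth_on_real_has_derivative[OF smooth])

lemma Ck_on_a [Ck_intros]: "open S \<Longrightarrow> Ck_on k S f \<Longrightarrow> Ck_on k S (\<lambda>x. a (f x))"
  by (rule Ck_on_compose[OF _ open_UNIV _ smooth_on_imp_Ck_on[OF smooth]]) simp_all

lemma Ck_on_deriv_a [Ck_intros]: "open S \<Longrightarrow> Ck_on k S f \<Longrightarrow> Ck_on k S (\<lambda>x. deriv a (f x))"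
  by (rule Ck_on_compose[OF _ open_UNIV _ smooth_on_imp_Ck_on[OF smooth_on_deriv[OF smooth]]]) simp_all

lemma vector_field_flrw_connection:
  assumes X: "vector_field X" and Y: "vector_field Y"
  shows "vector_field (flrw_connection a X Y)"
  unfolding vector_field_def
proof (intro conjI ballI smooth_onI)
  fix k
  have "Ck_on k UNIV X" "Ck_on k UNIV Y" "Ck_on (Suc k) UNIV Y"
    using X Y smooth_on_imp_Ck_on unfolding vector_field_def by blast+
  then show "Ck_on k UNIV (flrw_connection a X Y)"
    unfolding flrw_connection_def directional_deriv_def christoffel_def
    by (intro Ck_intros Ck_on_frechet_derivative_apply open_UNIV) (simp_all del: Ck_on.simps)
next
  fix x assume x: "x \<in> spacetime"
  let ?Y' = "frechet_derivative Y (at x)"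
  \<comment> \<open>This product is zero only on the spacetime, so its derivative is known to vanish
    only in the tangent direction \<open>X x\<close>. The normal component of the flat derivative is
    therefore minus the inner product of \<open>X\<close> and \<open>Y\<close>, which the last
    summand of the connection cancels.\<close>
  have "((\<lambda>y. snd (Y y) \<bullet> snd y) has_derivative
      (\<lambda>v. snd (Y x) \<bullet> snd v + snd (?Y' v) \<bullet> snd x)) (at x)"
    by (rule has_derivative_inner) (auto intro!: derivative_eq_intros vector_field_has_derivative Y)
  from tangential_derivative_unique[OF x vector_field_tangent[OF X x] this has_derivative_const[of 0]]
  have "snd (Y x) \<bullet> snd (X x) + snd (?Y' (X x)) \<bullet> snd x = 0"
    using vector_field_tangent[OF Y] by (simp add: tangent_space_def)
  then show "flrw_connection a X Y x \<in> tangent_space x"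
    using vector_field_tangent[OF X x] vector_field_tangent[OF Y x] spacetime_inner_self[OF x]
    by (simp add: tangent_space_def flrw_connection_def directional_deriv_def christoffel_def
        inner_add_left inner_add_right inner_commute)
qed

lemma flrw_metric_christoffel:
  "flrw_metric a x (christoffel a x v w) u = a (fst x) * deriv a (fst x) *
     (fst v * (snd w \<bullet> snd u) + fst w * (snd v \<bullet> snd u) - (snd v \<bullet> snd w) * fst u)"
proof -
  have "(a (fst x))\<^sup>2 * (deriv a (fst x) / a (fst x) * c) = a (fst x) * deriv a (fst x) * c" for c
    by (simp add: power2_eq_square)
  then show ?thesis
    by (simp add: flrw_metric_def christoffel_def inner_add_left right_diff_distrib
        del: times_divide_eq_left times_divide_eq_right)
qed

lemma flrw_metric_flrw_connection:
  assumes "x \<in> spacetime" "u \<in> tangent_space x"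
  shows "flrw_metric a x (flrw_connection a X Y x) u = flrw_metric a x (directional_deriv X Y x) u
    + a (fst x) * deriv a (fst x) * (fst (X x) * (snd (Y x) \<bullet> snd u)
        + fst (Y x) * (snd (X x) \<bullet> snd u) - (snd (X x) \<bullet> snd (Y x)) * fst u)"
  using assms
  by (simp add: flrw_connection_def flrw_metric_left flrw_metric_christoffel)
    (simp add: flrw_metric_def tangent_space_def inner_commute)

lemma metric_compatible_flrw_connection:
  assumes X: "vector_field X" and Y: "vector_field Y" and Z: "vector_field Z" and x: "x \<in> spacetime"
  shows "directional_deriv X (\<lambda>y. flrw_metric a y (Y y) (Z y)) x
    = flrw_metric a x (flrw_connection a X Y x) (Z x) + flrw_metric a x (Y x) (flrw_connection a X Z x)"
proof -
  let ?Y' = "frechet_derivative Y (at x)" and ?Z' = "frechet_derivative Z (at x)"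
  let ?t = "fst x"
  have da: "((\<lambda>y::pt. a (fst y)) has_derivative (\<lambda>v. deriv a ?t * fst v)) (at x)"
    using has_derivative_a[of ?t, unfolded has_field_derivative_def]
    by (rule has_derivative_compose[of fst fst, rotated]) (auto intro: has_derivative_fst)
  have "((\<lambda>y. flrw_metric a y (Y y) (Z y)) has_derivative (\<lambda>v.
      - (fst (Y x) * fst (?Z' v) + fst (?Y' v) * fst (Z x))
      + ((a ?t)\<^sup>2 * (snd (Y x) \<bullet> snd (?Z' v) + snd (?Y' v) \<bullet> snd (Z x))
      + (2 * (deriv a ?t * fst v) * a ?t) * (snd (Y x) \<bullet> snd (Z x))))) (at x)"
    unfolding flrw_metric_def
    by (intro has_derivative_add has_derivative_minus has_derivative_mult has_derivative_inner
        has_derivative_fst has_derivative_snd vector_field_has_derivative Y Z)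
      (auto intro!: derivative_eq_intros da)
  from directional_deriv_eq[OF this, of X]
  have E: "directional_deriv X (\<lambda>y. flrw_metric a y (Y y) (Z y)) x =
      - (fst (Y x) * fst (?Z' (X x)) + fst (?Y' (X x)) * fst (Z x))
      + ((a ?t)\<^sup>2 * (snd (Y x) \<bullet> snd (?Z' (X x)) + snd (?Y' (X x)) \<bullet> snd (Z x))
      + (2 * (deriv a ?t * fst (X x)) * a ?t) * (snd (Y x) \<bullet> snd (Z x)))" .
  show ?thesis
    unfolding E flrw_metric_flrw_connection[OF x vector_field_tangent[OF Z x]]
      flrw_metric_commute[of a x "Y x"] flrw_metric_flrw_connection[OF x vector_field_tangent[OF Y x]]
    by (simp add: flrw_metric_def directional_deriv_def inner_commute power2_eq_square algebra_simps)
qed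

lemma affine_connection_flrw_connection: "affine_connection (flrw_connection a)"
  unfolding affine_connection_def
proof (intro conjI allI impI ballI)
  fix X Y assume "vector_field X" "vector_field Y"
  then show "vector_field (flrw_connection a X Y)" by (rule vector_field_flrw_connection)
next
  fix X X' Y x assume "vector_field X" "vector_field X'" "vector_field Y"
  then have "linear (frechet_derivative Y (at x))"
    using vector_field_has_derivative has_derivative_linear by blast
  then show "flrw_connection a (\<lambda>y. X y + X' y) Y x = flrw_connection a X Y x + flrw_connection a X' Y x"
    by (simp add: flrw_connection_def directional_deriv_def christoffel_linear_left linear_add
        inner_add_left scaleR_left_distrib prod_eq_iff)
next
  fix X Y Y' x assume "vector_field X" "vector_field Y" "vector_field Y'"
  then have "directional_deriv X (\<lambda>y. Y y + Y' y) x = directional_deriv X Y x + directional_deriv X Y' x"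
    by (subst directional_deriv_eq[OF has_derivative_add[OF vector_field_has_derivative vector_field_has_derivative]])
      (simp_all add: directional_deriv_def)
  then show "flrw_connection a X (\<lambda>y. Y y + Y' y) x = flrw_connection a X Y x + flrw_connection a X Y' x"
    by (simp add: flrw_connection_def christoffel_linear_right inner_add_right scaleR_left_distrib prod_eq_iff)
next
  fix f :: "pt \<Rightarrow> real" and X Y x assume "vector_field X" "vector_field Y"
  then have "linear (frechet_derivative Y (at x))"
    using vector_field_has_derivative has_derivative_linear by blast
  then show "flrw_connection a (\<lambda>y. f y *\<^sub>R X y) Y x = f x *\<^sub>R flrw_connection a X Y x"
    by (simp add: flrw_connection_def directional_deriv_def christoffel_linear_left linear_scale
        scaleR_right_distrib prod_eq_iff)
next
  fix f :: "pt \<Rightarrow> real" and X Y x assume f: "smooth_on UNIV f" and Y: "vector_field Y"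
  have "directional_deriv X (\<lambda>y. f y *\<^sub>R Y y) x
      = f x *\<^sub>R directional_deriv X Y x + directional_deriv X f x *\<^sub>R Y x"
    using directional_deriv_eq[OF has_derivative_scaleR[OF smooth_on_has_derivative[OF f UNIV_I]
        vector_field_has_derivative[OF Y]]]
    by (simp add: directional_deriv_def)
  then show "flrw_connection a X (\<lambda>y. f y *\<^sub>R Y y) x
      = directional_deriv X f x *\<^sub>R Y x + f x *\<^sub>R flrw_connection a X Y x"
    by (simp add: flrw_connection_def christoffel_linear_right scaleR_right_distrib scaleR_Pair)
qed

lemma is_levi_civita_flrw_connection: "is_levi_civita a (flrw_connection a)"
  unfolding is_levi_civita_def
proof (intro conjI allI impI ballI)
  show "affine_connection (flrw_connection a)" by (rule affine_connection_flrw_connection)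
  show "flrw_connection a X Y x - flrw_connection a Y X x = lie_bracket X Y x" for X Y x
    by (simp add: flrw_connection_def lie_bracket_def christoffel_commute[of a x "Y x"] inner_commute)
qed (rule metric_compatible_flrw_connection)

section \<open>Uniqueness of the Levi-Civita connection\<close>

lemma flrw_metric_nondegenerate:
  assumes x: "x \<in> spacetime" and u: "u \<in> tangent_space x"
    and orth: "\<And>w. w \<in> tangent_space x \<Longrightarrow> flrw_metric a x u w = 0"
  shows "u = 0"
proof -
  have "(fst u, 0) \<in> tangent_space x" "(0, snd u) \<in> tangent_space x"
    using u by (simp_all add: tangent_space_def)
  from this[THEN orth] show ?thesis
    by (simp add: flrw_metric_def prod_eq_iff)
qed

text \<open>The difference of two Levi-Civita connections, paired with the metric, is symmetric in the
  first two and antisymmetric in the last two arguments, hence zero.\<close>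

lemma is_levi_civita_unique:
  assumes D: "is_levi_civita a D" and D': "is_levi_civita a D'"
    and X: "vector_field X" and Y: "vector_field Y" and x: "x \<in> spacetime"
  shows "D X Y x = D' X Y x"
proof -
  define b where "b X Y Z = flrw_metric a x (D X Y x - D' X Y x) (Z x)" for X Y Z
  have sym: "b X Y Z = b Y X Z" if "vector_field X" "vector_field Y" for X Y Z
  proof -
    have "D X Y x - D Y X x = D' X Y x - D' Y X x"
      using D D' that x unfolding is_levi_civita_def by simp
    then have "D X Y x - D' X Y x = D Y X x - D' Y X x" by (simp add: algebra_simps)
    then show ?thesis by (simp add: b_def)
  qed
  have anti: "b X Y Z = - b X Z Y" if "vector_field X" "vector_field Y" "vector_field Z" for X Y Z
  proof -
    have "directional_deriv X (\<lambda>y. flrw_metric a y (Y y) (Z y)) x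
        = flrw_metric a x (D X Y x) (Z x) + flrw_metric a x (Y x) (D X Z x)"
      using D that x unfolding is_levi_civita_def by blast
    moreover have "directional_deriv X (\<lambda>y. flrw_metric a y (Y y) (Z y)) x
        = flrw_metric a x (D' X Y x) (Z x) + flrw_metric a x (Y x) (D' X Z x)"
      using D' that x unfolding is_levi_civita_def by blast
    ultimately show ?thesis
      unfolding b_def flrw_metric_diff_left
      by (simp add: flrw_metric_commute[of a x "Y x"])
  qed
  \<comment> \<open>Alternating the two symmetries three times each returns to the original order of
    arguments with the opposite sign.\<close>
  have zero: "b X Y Z = 0" if "vector_field X" "vector_field Y" "vector_field Z" for X Y Z
    using sym[of X Y Z] anti[of Y X Z] sym[of Y Z X] anti[of Z Y X] sym[of Z X Y] anti[of X Z Y] that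
    by simp
  have "vector_field (D X Y)" "vector_field (D' X Y)"
    using D D' X Y unfolding is_levi_civita_def affine_connection_def by auto
  then have "D X Y x - D' X Y x \<in> tangent_space x"
    using x by (intro tangent_space_closed vector_field_tangent)
  moreover have "flrw_metric a x (D X Y x - D' X Y x) w = 0" if "w \<in> tangent_space x" for w
    using zero[OF X Y vector_field_tangent_extension[of w]] tangent_extension_at[OF that]
    by (simp add: b_def)
  ultimately have "D X Y x - D' X Y x = 0"
    by (rule flrw_metric_nondegenerate[OF x])
  then show ?thesis by simp
qed

lemma is_levi_civita_nabla: "is_levi_civita a (nabla a)"
proof -
  have "is_levi_civita a (SOME D. is_levi_civita a D)"
    by (rule someI_ex[of "is_levi_civita a"]) (rule exI, rule is_levi_civita_flrw_connection)
  then show ?thesis by (simp only: nabla_def)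
qed

text \<open>Off the spacetime the chosen operator may differ from \<open>flrw_connection\<close>; a
  derivative of \<open>nabla a X Y\<close> therefore has to go through
  \<open>tangential_derivative_unique\<close>.\<close>

lemma nabla_eq:
  "vector_field X \<Longrightarrow> vector_field Y \<Longrightarrow> x \<in> spacetime \<Longrightarrow> nabla a X Y x = flrw_connection a X Y x"
  by (rule is_levi_civita_unique[OF is_levi_civita_nabla is_levi_civita_flrw_connection])

lemma vector_field_nabla: "vector_field X \<Longrightarrow> vector_field Y \<Longrightarrow> vector_field (nabla a X Y)"
  using is_levi_civita_nabla by (simp add: is_levi_civita_def affine_connection_def)

end

section \<open>Curvature\<close>

lemma has_derivative_tangent_extension:
  "(tangent_extension w has_derivative
     (\<lambda>u. (0, - ((snd w \<bullet> snd u) *\<^sub>R snd x) - (snd w \<bullet> snd x) *\<^sub>R snd u))) (at x)"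
  unfolding tangent_extension_def
  by (rule has_derivative_eq_rhs, (rule derivative_intros)+) (auto simp: fun_eq_iff)

lemma inner_tangent_extension:
  "snd (tangent_extension v x) \<bullet> z = snd v \<bullet> z - (snd v \<bullet> snd x) * (snd x \<bullet> z)"
  by (simp add: tangent_extension_def inner_diff_left)

lemma fst_tangent_extension [simp]: "fst (tangent_extension v x) = fst v"
  by (simp add: tangent_extension_def)

text \<open>Stated at every point, because the bracket has to be recognised as a vector field before
  \<open>nabla_eq\<close> applies to it. Where \<open>u\<close> and \<open>v\<close> are tangent it
  vanishes, which removes the third term of the curvature.\<close>

lemma lie_bracket_tangent_extension:
  "lie_bracket (tangent_extension u) (tangent_extension v) x =
    (0, (snd u \<bullet> snd x) *\<^sub>R snd v - (snd v \<bullet> snd x) *\<^sub>R snd u)"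
  (is "?L = _")
proof -
  \<comment> \<open>Testing a vector identity against an arbitrary \<open>z\<close> turns it into
    real arithmetic; the same trick recurs in the curvature computations below.\<close>
  have "snd ?L \<bullet> z = ((snd u \<bullet> snd x) *\<^sub>R snd v - (snd v \<bullet> snd x) *\<^sub>R snd u) \<bullet> z" for z
    by (simp add: lie_bracket_def directional_deriv_eq[OF has_derivative_tangent_extension]
        inner_diff_left inner_add_left inner_tangent_extension inner_commute[of _ "snd (tangent_extension _ _)"]
        inner_commute[of "snd x"] inner_commute[of "snd v" "snd u"] algebra_simps)
  then have "snd ?L = (snd u \<bullet> snd x) *\<^sub>R snd v - (snd v \<bullet> snd x) *\<^sub>R snd u"
    using vector_eq_rdot by blast
  moreover have "fst ?L = 0"
    by (simp add: lie_bracket_def directional_deriv_eq[OF has_derivative_tangent_extension])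
  ultimately show ?thesis by (simp add: prod_eq_iff)
qed

context flrw begin

text \<open>\<open>v\<close> and \<open>w\<close> are not assumed tangent at \<open>x\<close>: the
  formula is differentiated next, and fixed vectors do not stay tangent at neighbouring
  points.\<close>

lemma nabla_tangent_extension:
  assumes x: "x \<in> spacetime"
  shows "nabla a (tangent_extension v) (tangent_extension w) x =
    (a (fst x) * deriv a (fst x) * (snd v \<bullet> snd w - (snd v \<bullet> snd x) * (snd w \<bullet> snd x)),
     (deriv a (fst x) / a (fst x)) *\<^sub>R (fst v *\<^sub>R snd (tangent_extension w x)
         + fst w *\<^sub>R snd (tangent_extension v x))
       - (snd w \<bullet> snd x) *\<^sub>R snd (tangent_extension v x))" (is "?L = (?a, ?b)")
proof -
  have L: "?L = flrw_connection a (tangent_extension v) (tangent_extension w) x"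
    by (rule nabla_eq[OF vector_field_tangent_extension vector_field_tangent_extension x])
  have "fst ?L = ?a"
    unfolding L
    by (simp add: flrw_connection_def christoffel_def inner_tangent_extension
        directional_deriv_eq[OF has_derivative_tangent_extension])
      (simp add: tangent_extension_def inner_diff_right inner_commute spacetime_inner_self[OF x])
  moreover have "snd ?L \<bullet> z = ?b \<bullet> z" for z
    unfolding L
    by (simp add: flrw_connection_def christoffel_def inner_tangent_extension inner_diff_left inner_add_left
        directional_deriv_eq[OF has_derivative_tangent_extension])
      (simp add: tangent_extension_def inner_diff_left inner_diff_right inner_commute spacetime_inner_self[OF x] algebra_simps)
  then have "snd ?L = ?b" using vector_eq_rdot by blast
  ultimately show ?thesis by (simp add: prod_eq_iff)
qed

lemma second_nabla_tangent_extension: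
  assumes x: "x \<in> spacetime" and u: "u \<in> tangent_space x" and v: "v \<in> tangent_space x"
    and w: "w \<in> tangent_space x"
  shows "nabla a (tangent_extension u) (nabla a (tangent_extension v) (tangent_extension w)) x =
    (fst u * ((deriv a (fst x))\<^sup>2 + a (fst x) * deriv (deriv a) (fst x)) * (snd v \<bullet> snd w)
       + (deriv a (fst x))\<^sup>2 * (fst v * (snd u \<bullet> snd w) + fst w * (snd u \<bullet> snd v)),
     (deriv (deriv a) (fst x) / a (fst x) * fst u) *\<^sub>R (fst v *\<^sub>R snd w + fst w *\<^sub>R snd v)
       + ((deriv a (fst x))\<^sup>2 * (snd v \<bullet> snd w)) *\<^sub>R snd u - (snd u \<bullet> snd w) *\<^sub>R snd v)"
    (is "?L = (?a, ?b)")
proof -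
  let ?U = "tangent_extension u" and ?N = "nabla a (tangent_extension v) (tangent_extension w)"
  let ?t = "fst x"
  define N where "N y = (a (fst y) * deriv a (fst y) * (snd v \<bullet> snd w - (snd v \<bullet> snd y) * (snd w \<bullet> snd y)),
     (deriv a (fst y) / a (fst y)) *\<^sub>R (fst v *\<^sub>R snd (tangent_extension w y)
         + fst w *\<^sub>R snd (tangent_extension v y))
       - (snd w \<bullet> snd y) *\<^sub>R snd (tangent_extension v y))" for y :: pt
  have vf: "vector_field ?N" by (intro vector_field_nabla vector_field_tangent_extension)
  have dfst: "((\<lambda>y::pt. fst y) has_derivative fst) (at x)"
    by (auto intro!: derivative_eq_intros)
  have da: "((\<lambda>y::pt. a (fst y)) has_derivative (\<lambda>u. deriv a ?t * fst u)) (at x)"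
    by (rule has_derivative_compose[OF dfst has_derivative_a[unfolded has_field_derivative_def]])
  have da': "((\<lambda>y::pt. deriv a (fst y)) has_derivative (\<lambda>u. deriv (deriv a) ?t * fst u)) (at x)"
    by (rule has_derivative_compose[OF dfst
          smooth_on_real_has_derivative[OF smooth_on_deriv[OF smooth], unfolded has_field_derivative_def]])
  have tang: "snd u \<bullet> snd x = 0" "snd v \<bullet> snd x = 0" "snd w \<bullet> snd x = 0"
    "snd x \<bullet> snd u = 0" "snd x \<bullet> snd v = 0" "snd x \<bullet> snd w = 0"
    using u v w by (simp_all add: tangent_space_def inner_commute)
  let ?h' = "(deriv (deriv a) ?t * a ?t - deriv a ?t * deriv a ?t) / (a ?t * a ?t)"
  let ?N' = "(\<lambda>u. (fst u * (deriv a ?t * deriv a ?t + a ?t * deriv (deriv a) ?t) * (snd v \<bullet> snd w),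
      (fst u * ?h') *\<^sub>R (fst v *\<^sub>R snd w + fst w *\<^sub>R snd v)
      - (deriv a ?t / a ?t * (fst v * (snd w \<bullet> snd u) + fst w * (snd v \<bullet> snd u))) *\<^sub>R snd x
      - (snd w \<bullet> snd u) *\<^sub>R snd v))"
  have dh: "((\<lambda>y::pt. deriv a (fst y) / a (fst y)) has_derivative (\<lambda>u. fst u * ?h')) (at x)"
    by (rule has_derivative_eq_rhs, rule has_derivative_divide'[OF da' da]) (auto simp: fun_eq_iff field_simps)
  have 1: "((\<lambda>y::pt. a (fst y) * deriv a (fst y) * (snd v \<bullet> snd w - (snd v \<bullet> snd y) * (snd w \<bullet> snd y)))
    has_derivative (\<lambda>u. fst u * (deriv a ?t * deriv a ?t + a ?t * deriv (deriv a) ?t) * (snd v \<bullet> snd w))) (at x)"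
    by (rule has_derivative_eq_rhs, (rule derivative_intros da da')+)
      (auto simp: fun_eq_iff tang algebra_simps)
  have 2: "((\<lambda>y. (deriv a (fst y) / a (fst y)) *\<^sub>R (fst v *\<^sub>R snd (tangent_extension w y)
         + fst w *\<^sub>R snd (tangent_extension v y))
       - (snd w \<bullet> snd y) *\<^sub>R snd (tangent_extension v y)) has_derivative
    (\<lambda>u. (fst u * ?h') *\<^sub>R (fst v *\<^sub>R snd w + fst w *\<^sub>R snd v)
      - (deriv a ?t / a ?t * (fst v * (snd w \<bullet> snd u) + fst w * (snd v \<bullet> snd u))) *\<^sub>R snd x
      - (snd w \<bullet> snd u) *\<^sub>R snd v)) (at x)"
  proof -
    have ext: "((\<lambda>y. snd (tangent_extension w y)) has_derivative
        (\<lambda>u. snd (0 :: real, - ((snd w \<bullet> snd u) *\<^sub>R snd x) - (snd w \<bullet> snd x) *\<^sub>R snd u))) (at x)" for w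
      by (intro derivative_intros has_derivative_tangent_extension)
    define h h' where "h = deriv a ?t / a ?t" and "h' = ?h'"
    show ?thesis
      by (rule has_derivative_eq_rhs, (rule dh ext derivative_intros)+)
        (simp add: fun_eq_iff tang tangent_extension_at v w h_def[symmetric] h'_def[symmetric]
          del: times_divide_eq_left times_divide_eq_right, simp add: algebra_simps)
  qed
  have dN: "(N has_derivative ?N') (at x)"
    unfolding N_def by (rule has_derivative_Pair[OF 1 2])
  \<comment> \<open>\<open>N\<close> is an explicit smooth function agreeing with \<open>?N\<close>
    on the spacetime only; as \<open>u\<close> is tangent, this suffices for equal derivatives along
    \<open>u\<close>.\<close>
  have "frechet_derivative ?N (at x) u = ?N' u"
    by (rule tangential_derivative_unique[OF x u vector_field_has_derivative[OF vf] dN])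
      (simp add: nabla_tangent_extension N_def)
  then have D: "directional_deriv ?U ?N x = ?N' u"
    by (simp add: directional_deriv_def tangent_extension_at[OF u])
  have Nx: "?N x = (a ?t * deriv a ?t * (snd v \<bullet> snd w), (deriv a ?t / a ?t) *\<^sub>R (fst v *\<^sub>R snd w + fst w *\<^sub>R snd v))"
    by (simp add: nabla_tangent_extension[OF x] tangent_extension_at v w tang)
  have L: "?L = ?N' u + christoffel a x u (?N x) + (0, (snd u \<bullet> snd (?N x)) *\<^sub>R snd x)"
    by (simp only: nabla_eq[OF vector_field_tangent_extension vf x] flrw_connection_def D tangent_extension_at[OF u])
  have "fst ?L = ?a"
    unfolding L Nx by (simp add: christoffel_def inner_add_right power2_eq_square field_simps)
  moreover have "snd ?L \<bullet> z = ?b \<bullet> z" for z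
    unfolding L Nx
    by (simp add: christoffel_def inner_diff_left inner_add_left inner_add_right power2_eq_square
        inner_commute[of "snd w" "snd u"] inner_commute[of "snd v" "snd u"] field_simps)
  then have "snd ?L = ?b" using vector_eq_rdot by blast
  ultimately show ?thesis by (simp add: prod_eq_iff)
qed

text \<open>Antisymmetrise the second covariant derivative in \<open>u\<close> and \<open>v\<close>.
  Of the spatial factor \<open>1 + a'^2\<close>, the summand 1 is the curvature of the unit sphere
  and \<open>a'^2\<close> is due to the expansion; in the time component the terms in
  \<open>a'^2\<close> are symmetric and cancel.\<close>

lemma riemann_eq:
  assumes x: "x \<in> spacetime" and u: "u \<in> tangent_space x" and v: "v \<in> tangent_space x"
    and w: "w \<in> tangent_space x"
  shows "riemann a x u v w =
    (a (fst x) * deriv (deriv a) (fst x) * (fst u * (snd v \<bullet> snd w) - fst v * (snd u \<bullet> snd w)),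
     (1 + (deriv a (fst x))\<^sup>2) *\<^sub>R ((snd v \<bullet> snd w) *\<^sub>R snd u - (snd u \<bullet> snd w) *\<^sub>R snd v)
       + (deriv (deriv a) (fst x) / a (fst x) * fst w) *\<^sub>R (fst u *\<^sub>R snd v - fst v *\<^sub>R snd u))"
    (is "?L = (?a, ?b)")
proof -
  let ?br = "lie_bracket (tangent_extension u) (tangent_extension v)"
  have vf: "vector_field ?br"
    unfolding vector_field_def
  proof (intro conjI ballI smooth_onI)
    show "Ck_on k UNIV ?br" for k
      unfolding lie_bracket_tangent_extension[abs_def] by (intro Ck_intros open_UNIV)
    show "?br y \<in> tangent_space y" for y
      by (simp add: lie_bracket_tangent_extension tangent_space_def inner_diff_left)
  qed
  have br: "?br x = 0"
    using u v by (simp add: lie_bracket_tangent_extension tangent_space_def zero_prod_def)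
  have "linear (frechet_derivative (tangent_extension w) (at x))"
    using vector_field_has_derivative[OF vector_field_tangent_extension] has_derivative_linear by blast
  then have 0: "nabla a ?br (tangent_extension w) x = 0"
    by (simp add: nabla_eq[OF vf vector_field_tangent_extension x] flrw_connection_def directional_deriv_def
        br christoffel_linear_left linear_0 zero_prod_def[symmetric])
  have "fst ?L = ?a"
    by (simp add: riemann_def curvature_operator_def second_nabla_tangent_extension x u v w 0
        inner_commute[of "snd v" "snd u"] algebra_simps)
  moreover have "snd ?L \<bullet> z = ?b \<bullet> z" for z
    by (simp add: riemann_def curvature_operator_def second_nabla_tangent_extension x u v w 0
        inner_diff_left inner_add_left inner_commute[of "snd v" "snd u"] algebra_simps)
  then have "snd ?L = ?b" using vector_eq_rdot by blast
  ultimately show ?thesis by (simp add: prod_eq_iff)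
qed




text \<open>The basis in \<open>metric_trace\<close> is chosen abstractly, so traces cannot be
  computed in a concrete frame. Expanding suitable vectors in it yields the sums that the traces
  consist of.\<close>

lemma orthonormal_expansion:
  assumes B: "orthonormal_basis a x B" and v: "v \<in> tangent_space x"
  shows "v = (\<Sum>e\<in>B. (flrw_metric a x e e * flrw_metric a x v e) *\<^sub>R e)"
proof -
  have fin: "finite B" and "v \<in> span B"
    using B v by (auto simp: orthonormal_basis_def)
  then obtain c where c: "v = (\<Sum>e\<in>B. c e *\<^sub>R e)"
    by (auto simp: span_finite)
  have "flrw_metric a x e e * flrw_metric a x v e = c e" if e: "e \<in> B" for e
  proof -
    have "flrw_metric a x v e = (\<Sum>e'\<in>B. c e' * flrw_metric a x e' e)"
      by (simp add: c flrw_metric_left)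
    also have "\<dots> = (\<Sum>e'\<in>B. if e' = e then c e * flrw_metric a x e e else 0)"
      using B e by (intro sum.cong) (auto simp: orthonormal_basis_def)
    also have "\<dots> = c e * flrw_metric a x e e"
      using fin e by simp
    finally have "flrw_metric a x e e * flrw_metric a x v e = c e * \<bar>flrw_metric a x e e\<bar>\<^sup>2"
      by (simp add: power2_eq_square)
    also have "\<bar>flrw_metric a x e e\<bar> = 1" using B e by (simp add: orthonormal_basis_def)
    finally show ?thesis by simp
  qed
  then show ?thesis by (subst c) (intro sum.cong, simp_all)
qed

context
  fixes x B
  assumes x: "x \<in> spacetime" and B: "orthonormal_basis a x B"
begin

text \<open>Expand \<open>d_t\<close>, whose product with \<open>e\<close> is
  \<open>- fst e\<close>, and read off the time and the space components.\<close>

lemma basis_sum_time: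
  shows "(\<Sum>e\<in>B. flrw_metric a x e e * (fst e * fst e)) = - 1"
    and "(\<Sum>e\<in>B. flrw_metric a x e e * (fst e * (snd e \<bullet> z))) = 0"
proof -
  have "d_t \<in> tangent_space x" by (simp add: d_t_def tangent_space_def)
  note E = orthonormal_expansion[OF B this]
  have g: "flrw_metric a x d_t e = - fst e" for e
    by (simp add: flrw_metric_def d_t_def)
  have "1 = fst (\<Sum>e\<in>B. (flrw_metric a x e e * flrw_metric a x d_t e) *\<^sub>R e)"
    using E by (simp add: d_t_def)
  then show "(\<Sum>e\<in>B. flrw_metric a x e e * (fst e * fst e)) = - 1"
    by (simp add: g fst_sum sum_negf mult.assoc)
  have "0 = snd (\<Sum>e\<in>B. (flrw_metric a x e e * flrw_metric a x d_t e) *\<^sub>R e) \<bullet> z"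
    using E by (simp add: d_t_def)
  then show "(\<Sum>e\<in>B. flrw_metric a x e e * (fst e * (snd e \<bullet> z))) = 0"
    by (simp add: g snd_sum sum_negf inner_sum_left mult.assoc)
qed

text \<open>Expand the projection of \<open>y\<close> to the tangent space of the sphere and pair
  the result with \<open>z\<close>.\<close>

lemma basis_sum_space:
  "(\<Sum>e\<in>B. flrw_metric a x e e * ((snd e \<bullet> y) * (snd e \<bullet> z)))
    = (y \<bullet> z - (y \<bullet> snd x) * (z \<bullet> snd x)) / (a (fst x))\<^sup>2"
proof -
  define v :: pt where "v = (0, y - (y \<bullet> snd x) *\<^sub>R snd x)"
  have "v \<in> tangent_space x"
    by (simp add: v_def tangent_space_def inner_diff_left spacetime_inner_self[OF x])
  note E = orthonormal_expansion[OF B this]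
  have g: "flrw_metric a x v e = (a (fst x))\<^sup>2 * (snd e \<bullet> y)" if "e \<in> B" for e
  proof -
    have "e \<in> tangent_space x" using B that span_superset by (auto simp: orthonormal_basis_def)
    then show ?thesis
      by (simp add: flrw_metric_def v_def inner_diff_right tangent_space_def inner_commute[of _ "snd e"])
  qed
  have "snd v \<bullet> z = (\<Sum>e\<in>B. flrw_metric a x e e * flrw_metric a x v e * (snd e \<bullet> z))"
    by (subst E) (simp add: snd_sum inner_sum_left)
  also have "\<dots> = (a (fst x))\<^sup>2 * (\<Sum>e\<in>B. flrw_metric a x e e * ((snd e \<bullet> y) * (snd e \<bullet> z)))"
    unfolding sum_distrib_left by (intro sum.cong) (simp_all add: g mult_ac)
  finally show ?thesis
    by (simp add: v_def inner_diff_left inner_commute[of "snd x" z] field_simps)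
qed

text \<open>Sum the previous identity over the standard basis of the complex plane squared: four
  dimensions, less one for the normal direction \<open>snd x\<close>.\<close>

lemma basis_sum_norm: "(\<Sum>e\<in>B. flrw_metric a x e e * (snd e \<bullet> snd e)) = 3 / (a (fst x))\<^sup>2"
proof -
  have "(\<Sum>e\<in>B. flrw_metric a x e e * (snd e \<bullet> snd e))
      = (\<Sum>e\<in>B. \<Sum>b\<in>Basis. flrw_metric a x e e * ((snd e \<bullet> b) * (snd e \<bullet> b)))"
    by (subst euclidean_inner) (simp add: sum_distrib_left)
  also have "\<dots> = (\<Sum>b\<in>Basis. (b \<bullet> b - (b \<bullet> snd x) * (b \<bullet> snd x)) / (a (fst x))\<^sup>2)"
    by (subst sum.swap) (simp only: basis_sum_space)
  also have "\<dots> = ((\<Sum>b\<in>(Basis :: (complex \<times> complex) set). b \<bullet> b)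
      - (\<Sum>b\<in>Basis. (snd x \<bullet> b) * (snd x \<bullet> b))) / (a (fst x))\<^sup>2"
    by (simp add: sum_subtractf sum_divide_distrib[symmetric] inner_commute)
  also have "(\<Sum>b\<in>(Basis :: (complex \<times> complex) set). b \<bullet> b) = 4"
    by (simp add: inner_Basis)
  also have "(\<Sum>b\<in>Basis. (snd x \<bullet> b) * (snd x \<bullet> b)) = snd x \<bullet> snd x"
    by (rule euclidean_inner[symmetric])
  finally show ?thesis by (simp add: spacetime_inner_self[OF x])
qed

lemmas basis_sums = basis_sum_time basis_sum_space basis_sum_norm

end

text \<open>This makes the choice in \<open>metric_trace\<close> meaningful. The witness is
  \<open>d_t\<close> together with a Euclidean orthonormal basis of the tangent space of the sphere,
  divided by \<open>a\<close>.\<close>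

lemma orthonormal_basis_exists:
  assumes "x \<in> spacetime"
  shows "\<exists>B. orthonormal_basis a x B"
proof -
  let ?S = "{w. w \<bullet> snd x = 0}"
  have "subspace ?S" by (simp add: subspace_def inner_add_left)
  then obtain C where C: "C \<subseteq> ?S" "pairwise orthogonal C" "\<And>c. c \<in> C \<Longrightarrow> norm c = 1"
      "independent C" "span C = ?S"
    by (metis orthonormal_basis_subspace)
  let ?f = "\<lambda>c. (0 :: real, c /\<^sub>R a (fst x))"
  define B where "B = insert d_t (?f ` C)"
  have fC: "finite C" using C(4) independent_imp_finite by blast
  have cc: "c \<bullet> c = 1" if "c \<in> C" for c using C(3)[OF that] by (simp add: norm_eq_1)
  have lin: "linear ?f" by (intro linearI) (simp_all add: scaleR_add_right)
  have "tangent_space x = span B"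
  proof (intro set_eqI iffI)
    fix v assume v: "v \<in> tangent_space x"
    have "a (fst x) *\<^sub>R snd v \<in> span C" using v C(5) by (simp add: tangent_space_def)
    then have "?f (a (fst x) *\<^sub>R snd v) \<in> span (?f ` C)"
      using span_linear_image[OF lin] by blast
    then have "(0, snd v) \<in> span B"
      using span_mono[of "?f ` C" B] by (auto simp: B_def)
    moreover have "fst v *\<^sub>R d_t \<in> span B" by (simp add: B_def span_base span_scale)
    ultimately have "fst v *\<^sub>R d_t + (0, snd v) \<in> span B" by (rule span_add[rotated])
    then show "v \<in> span B" by (simp add: d_t_def)
  next
    fix v assume v: "v \<in> span B"
    have "snd (?f c) \<bullet> snd x = 0" if "c \<in> C" for c
      using C(1) that by (auto simp del: scaleR_Pair)
    then have "?f ` C \<subseteq> tangent_space x" unfolding tangent_space_def by blast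
    moreover have "d_t \<in> tangent_space x" by (simp add: d_t_def tangent_space_def)
    ultimately have "B \<subseteq> tangent_space x" by (simp add: B_def)
    moreover have "subspace (tangent_space x)"
      by (simp add: subspace_def tangent_space_def inner_add_left)
    ultimately show "v \<in> tangent_space x" using v span_minimal by blast
  qed
  moreover have gf: "flrw_metric a x (?f c) (?f c') = c \<bullet> c'" for c c'
    by (simp add: flrw_metric_def power2_eq_square field_simps)
  have gt: "flrw_metric a x d_t d_t = - 1" "flrw_metric a x d_t (?f c) = 0" "flrw_metric a x (?f c) d_t = 0" for c
    by (simp_all add: flrw_metric_def d_t_def)
  have "\<bar>flrw_metric a x e e\<bar> = 1" if "e \<in> B" for e
  proof -
    from that consider "e = d_t" | c where "c \<in> C" "e = ?f c" unfolding B_def by blast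
    then show ?thesis by cases (simp_all only: gf gt cc abs_minus_cancel abs_one)
  qed
  moreover have "flrw_metric a x e e' = 0" if e: "e \<in> B" "e' \<in> B" "e \<noteq> e'" for e e'
  proof -
    from e consider "e = d_t" "e' \<in> ?f ` C" | "e' = d_t" "e \<in> ?f ` C"
      | c c' where "c \<in> C" "c' \<in> C" "c \<noteq> c'" "e = ?f c" "e' = ?f c'" unfolding B_def by blast
    then show ?thesis
    proof cases
      case 3
      then show ?thesis
        using C(2) gf[of c c'] unfolding pairwise_def orthogonal_def by metis
    qed (auto simp only: gt)
  qed
  ultimately have "orthonormal_basis a x B"
    using fC by (simp add: orthonormal_basis_def B_def)
  then show ?thesis ..
qed

section \<open>Ricci, scalar and Einstein curvature, and the energy condition\<close>

lemma ricci_eq: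
  assumes x: "x \<in> spacetime" and v: "v \<in> tangent_space x" and w: "w \<in> tangent_space x"
  shows "ricci a x v w = (a (fst x) * deriv (deriv a) (fst x) + 2 * (1 + (deriv a (fst x))\<^sup>2)) * (snd v \<bullet> snd w)
    - 3 * deriv (deriv a) (fst x) / a (fst x) * (fst v * fst w)"
proof -
  define B where "B = (SOME B. orthonormal_basis a x B)"
  have B: "orthonormal_basis a x B"
    unfolding B_def by (rule someI_ex[OF orthonormal_basis_exists[OF x]])
  let ?s = "\<lambda>e. flrw_metric a x e e" and ?a = "a (fst x)" and ?a'' = "deriv (deriv a) (fst x)"
    and ?k = "1 + (deriv a (fst x))\<^sup>2"
  \<comment> \<open>The integrand is sorted into coefficients times the quadratic expressions in
    \<open>e\<close> whose signed sums are given by \<open>basis_sums\<close>.\<close>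
  have R: "flrw_metric a x (riemann a x e v w) e =
        (- ?a * ?a'' * (snd v \<bullet> snd w)) * (fst e * fst e) + (?a * ?a'' * fst v) * (fst e * (snd e \<bullet> snd w))
        + (?a * ?a'' * fst w) * (fst e * (snd e \<bullet> snd v))
        + (?a\<^sup>2 * ?k * (snd v \<bullet> snd w) - ?a * ?a'' * fst w * fst v) * (snd e \<bullet> snd e)
        + (- ?a\<^sup>2 * ?k) * ((snd e \<bullet> snd w) * (snd e \<bullet> snd v))" if "e \<in> B" for e
  proof -
    have e: "e \<in> tangent_space x"
      using B that span_superset by (auto simp: orthonormal_basis_def)
    have "?a\<^sup>2 * (?a'' / ?a * c) = ?a * ?a'' * c" for c by (simp add: power2_eq_square)
    note this[of "fst w", simp]
    show ?thesis
      by (simp add: riemann_eq[OF x e v w] flrw_metric_def inner_add_left inner_diff_left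
          inner_commute[of "snd v" "snd e"] inner_commute[of "snd w" "snd e"]
          right_diff_distrib distrib_left del: times_divide_eq_left times_divide_eq_right)
        (simp add: power2_eq_square field_simps)
  qed
  have "ricci a x v w = (\<Sum>e\<in>B. ?s e * flrw_metric a x (riemann a x e v w) e)"
    by (simp add: ricci_def metric_trace_def B_def)
  also have "\<dots> = (\<Sum>e\<in>B. (- ?a * ?a'' * (snd v \<bullet> snd w)) * (?s e * (fst e * fst e))
        + (?a * ?a'' * fst v) * (?s e * (fst e * (snd e \<bullet> snd w)))
        + (?a * ?a'' * fst w) * (?s e * (fst e * (snd e \<bullet> snd v)))
        + (?a\<^sup>2 * ?k * (snd v \<bullet> snd w) - ?a * ?a'' * fst w * fst v) * (?s e * (snd e \<bullet> snd e))
        + (- ?a\<^sup>2 * ?k) * (?s e * ((snd e \<bullet> snd w) * (snd e \<bullet> snd v))))"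
    by (intro sum.cong refl) (simp only: R, simp only: algebra_simps)
  also have "\<dots> = (- ?a * ?a'' * (snd v \<bullet> snd w)) * (- 1)
        + (?a\<^sup>2 * ?k * (snd v \<bullet> snd w) - ?a * ?a'' * fst w * fst v) * (3 / ?a\<^sup>2)
        + (- ?a\<^sup>2 * ?k) * ((snd w \<bullet> snd v - (snd w \<bullet> snd x) * (snd v \<bullet> snd x)) / ?a\<^sup>2)"
    by (simp only: sum.distrib sum_distrib_left[symmetric] basis_sums[OF x B] mult_zero_right add_0_left add_0_right)
  also have "\<dots> = (?a * ?a'' + 2 * ?k) * (snd v \<bullet> snd w) - 3 * ?a'' / ?a * (fst v * fst w)"
    using v w by (simp add: tangent_space_def inner_commute[of "snd w"] power2_eq_square field_simps)
  finally show ?thesis .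
qed

lemma scalar_curvature_eq:
  assumes x: "x \<in> spacetime"
  shows "scalar_curvature a x = 6 * deriv (deriv a) (fst x) / a (fst x)
    + 6 * (1 + (deriv a (fst x))\<^sup>2) / (a (fst x))\<^sup>2"
proof -
  define B where "B = (SOME B. orthonormal_basis a x B)"
  have B: "orthonormal_basis a x B"
    unfolding B_def by (rule someI_ex[OF orthonormal_basis_exists[OF x]])
  let ?s = "\<lambda>e. flrw_metric a x e e" and ?a = "a (fst x)" and ?a'' = "deriv (deriv a) (fst x)"
    and ?k = "1 + (deriv a (fst x))\<^sup>2"
  have "scalar_curvature a x = (\<Sum>e\<in>B. ?s e * ricci a x e e)"
    by (simp add: scalar_curvature_def metric_trace_def B_def)
  also have "\<dots> = (\<Sum>e\<in>B. (?a * ?a'' + 2 * ?k) * (?s e * (snd e \<bullet> snd e))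
      - (3 * ?a'' / ?a) * (?s e * (fst e * fst e)))"
  proof (intro sum.cong refl)
    fix e assume "e \<in> B"
    then have e: "e \<in> tangent_space x"
      using B span_superset by (auto simp: orthonormal_basis_def)
    show "?s e * ricci a x e e = (?a * ?a'' + 2 * ?k) * (?s e * (snd e \<bullet> snd e))
      - (3 * ?a'' / ?a) * (?s e * (fst e * fst e))"
      by (simp only: ricci_eq[OF x e e]) (simp add: algebra_simps)
  qed
  also have "\<dots> = (?a * ?a'' + 2 * ?k) * (3 / ?a\<^sup>2) - (3 * ?a'' / ?a) * (- 1)"
    by (simp only: sum_subtractf sum_distrib_left[symmetric] basis_sums[OF x B])
  finally show ?thesis by (simp add: power2_eq_square field_simps)
qed

lemma Ein_eq:
  assumes "x \<in> spacetime" "v \<in> tangent_space x" "w \<in> tangent_space x"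
  shows "Ein a x v w = 3 * (1 + (deriv a (fst x))\<^sup>2) / (a (fst x))\<^sup>2 * (fst v * fst w)
    - (2 * a (fst x) * deriv (deriv a) (fst x) + (1 + (deriv a (fst x))\<^sup>2)) * (snd v \<bullet> snd w)"
  using assms
  by (simp add: Ein_def ricci_eq scalar_curvature_eq flrw_metric_def power2_eq_square field_simps)

lemma dominant_energy_condition_bound:
  assumes "dominant_energy_condition a"
  shows "deriv (deriv a) t / a t \<le> (1 + (deriv a t)\<^sup>2) / (a t)\<^sup>2"
proof -
  \<comment> \<open>With \<open>r = 1/a\<close>, \<open>v\<close> is \<open>d_t\<close> plus a unit
    vector tangent to the slice. It is null, so the scalar curvature term of \<open>Ein\<close>
    drops out. The point on the sphere is arbitrary by homogeneity.\<close>
  define r where "r = inverse (a t)"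
  define x v :: pt where "x = (t, 1, 0)" and "v = (1, 0, of_real r)"
  have x: "x \<in> spacetime" by (simp add: x_def spacetime_def norm_Pair)
  have v: "v \<in> tangent_space x" by (simp add: x_def v_def tangent_space_def)
  have vv: "snd v \<bullet> snd v = r * r"
    by (simp add: v_def inner_complex_def)
  have ar: "(a t)\<^sup>2 * (r * r) = 1" by (simp add: r_def power2_eq_square field_simps)
  have "flrw_metric a x v v = 0" using ar by (simp add: flrw_metric_def vv) (simp add: v_def x_def)
  then have "future_causal a x v"
    using v by (simp add: future_causal_def) (simp add: flrw_metric_def v_def d_t_def zero_prod_def)
  then have "0 \<le> Ein a x v v"
    using assms x unfolding dominant_energy_condition_def by blast
  also have "\<dots> = 2 * ((1 + (deriv a t)\<^sup>2) / (a t)\<^sup>2 - deriv (deriv a) t / a t)"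
    by (simp add: Ein_eq[OF x v v] vv) (simp add: x_def v_def r_def power2_eq_square field_simps)
  finally show ?thesis
    by (metis diff_ge_0_iff_ge mult_le_cancel_left_pos mult_zero_right zero_less_numeral)
qed

end

section \<open>Surfaces\<close>

text \<open>\<open>matrix_inv\<close> is a choice of a two-sided inverse. Such an inverse is unique,
  hence equal to the adjugate divided by the determinant.\<close>

lemma matrix_inv_2:
  fixes A :: "real^2^2"
  assumes "det A \<noteq> 0"
  shows "matrix_inv A $ 1 $ 1 = A $ 2 $ 2 / det A" "matrix_inv A $ 1 $ 2 = - A $ 1 $ 2 / det A"
    "matrix_inv A $ 2 $ 1 = - A $ 2 $ 1 / det A" "matrix_inv A $ 2 $ 2 = A $ 1 $ 1 / det A"
proof -
  define d where "d = det A"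
  have d: "A $ 1 $ 1 * A $ 2 $ 2 = d + A $ 1 $ 2 * A $ 2 $ 1"
    by (simp add: d_def det_2)
  define B :: "real^2^2" where "B = vector [vector [A $ 2 $ 2 / det A, - A $ 1 $ 2 / det A],
      vector [- A $ 2 $ 1 / det A, A $ 1 $ 1 / det A]]"
  have "A ** B = mat 1"
    using assms by (simp add: vec_eq_iff forall_2 B_def matrix_matrix_mult_def sum_2 mat_def
        d_def[symmetric]) (simp add: field_simps d)
  moreover from this have "B ** A = mat 1" by (simp add: matrix_left_right_inverse)
  ultimately have "A ** matrix_inv A = mat 1" and B: "B ** A = mat 1"
    unfolding matrix_inv_def by (metis (mono_tags, lifting) someI_ex)+
  then have "matrix_inv A = B"
    by (metis matrix_mul_assoc matrix_mul_lid matrix_mul_rid)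
  then show "matrix_inv A $ 1 $ 1 = A $ 2 $ 2 / det A" "matrix_inv A $ 1 $ 2 = - A $ 1 $ 2 / det A"
    "matrix_inv A $ 2 $ 1 = - A $ 2 $ 1 / det A" "matrix_inv A $ 2 $ 2 = A $ 1 $ 1 / det A"
    by (simp_all add: B_def)
qed

text \<open>The squared area element as a function of the two tangent vectors. In this Lorentzian
  metric it can be negative; positivity means that they span a spacelike plane.\<close>

definition gram :: "(real \<Rightarrow> real) \<Rightarrow> pt \<Rightarrow> pt \<Rightarrow> pt \<Rightarrow> real" where
  "gram a x v w = flrw_metric a x v v * flrw_metric a x w w - (flrw_metric a x v w)\<^sup>2"

lemma det_induced_metric:
  "det (induced_metric a F \<theta>) = gram a (F \<theta>) (partial_deriv F 1 \<theta>) (partial_deriv F 2 \<theta>)"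
  by (simp add: det_2 induced_metric_def gram_def power2_eq_square
      flrw_metric_commute[of a _ "partial_deriv F 2 \<theta>" "partial_deriv F 1 \<theta>"])

lemma induced_trace_eq:
  fixes \<beta> :: "2 \<Rightarrow> 2 \<Rightarrow> 'b::real_vector"
  assumes "gram a (F \<theta>) (partial_deriv F 1 \<theta>) (partial_deriv F 2 \<theta>) \<noteq> 0"
  shows "induced_trace a F \<theta> \<beta> =
    (flrw_metric a (F \<theta>) (partial_deriv F 2 \<theta>) (partial_deriv F 2 \<theta>) *\<^sub>R \<beta> 1 1
     - flrw_metric a (F \<theta>) (partial_deriv F 1 \<theta>) (partial_deriv F 2 \<theta>) *\<^sub>R (\<beta> 1 2 + \<beta> 2 1)
     + flrw_metric a (F \<theta>) (partial_deriv F 1 \<theta>) (partial_deriv F 1 \<theta>) *\<^sub>R \<beta> 2 2)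
    /\<^sub>R gram a (F \<theta>) (partial_deriv F 1 \<theta>) (partial_deriv F 2 \<theta>)"
proof -
  have "det (induced_metric a F \<theta>) \<noteq> 0" using assms by (simp add: det_induced_metric)
  note inv = matrix_inv_2[OF this]
  show ?thesis
    unfolding induced_trace_def sum_2 inv det_induced_metric
    by (simp add: induced_metric_def flrw_metric_commute[of a _ "partial_deriv F 2 \<theta>" "partial_deriv F 1 \<theta>"]
        divide_inverse scaleR_right_distrib scaleR_right_diff_distrib mult.commute)
qed

text \<open>The following functions of the \<open>2\<close>-jet \<open>(F, \<partial>\<^sub>i F, \<partial>\<^sub>i \<partial>\<^sub>j F)\<close> of a surface \<open>F\<close> are the
  covariant derivative of \<open>\<partial>\<^sub>j F\<close> in direction \<open>i\<close>, its trace, the squared length of the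
  tangential part of a vector, and \<open>\<parallel>H\<parallel>\<^sup>2\<close>.\<close>

definition jet_hessian :: "(real \<Rightarrow> real) \<Rightarrow> pt \<Rightarrow> pt \<Rightarrow> pt \<Rightarrow> pt \<Rightarrow> pt" where
  "jet_hessian a x v w vw = tangent_extension vw x + christoffel a x v w"

definition jet_trace :: "(real \<Rightarrow> real) \<Rightarrow> pt \<Rightarrow> pt \<Rightarrow> pt \<Rightarrow> pt \<Rightarrow> pt \<Rightarrow> pt \<Rightarrow> pt \<Rightarrow> pt" where
  "jet_trace a x v w vv vw wv ww =
     (flrw_metric a x w w *\<^sub>R jet_hessian a x v v vv
      - flrw_metric a x v w *\<^sub>R (jet_hessian a x v w vw + jet_hessian a x w v wv)
      + flrw_metric a x v v *\<^sub>R jet_hessian a x w w ww) /\<^sub>R gram a x v w"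

definition tangential_norm_sq :: "(real \<Rightarrow> real) \<Rightarrow> pt \<Rightarrow> pt \<Rightarrow> pt \<Rightarrow> pt \<Rightarrow> real" where
  "tangential_norm_sq a x v w e =
     (flrw_metric a x w w * (flrw_metric a x e v)\<^sup>2
      - 2 * flrw_metric a x v w * flrw_metric a x e v * flrw_metric a x e w
      + flrw_metric a x v v * (flrw_metric a x e w)\<^sup>2) / gram a x v w"

definition jet_curvature_sq :: "(real \<Rightarrow> real) \<Rightarrow> pt \<Rightarrow> pt \<Rightarrow> pt \<Rightarrow> pt \<Rightarrow> pt \<Rightarrow> pt \<Rightarrow> pt \<Rightarrow> real" where
  "jet_curvature_sq a x v w vv vw wv ww =
     flrw_metric a x (jet_trace a x v w vv vw wv ww) (jet_trace a x v w vv vw wv ww)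
     - tangential_norm_sq a x v w (jet_trace a x v w vv vw wv ww)"

lemma sum_Basis_linear:
  fixes L :: "'a::euclidean_space \<Rightarrow> 'b::real_vector"
  assumes "linear L"
  shows "(\<Sum>b\<in>Basis. (w \<bullet> b) *\<^sub>R L b) = L w"
proof -
  have "L (\<Sum>b\<in>Basis. (w \<bullet> b) *\<^sub>R b) = (\<Sum>b\<in>Basis. (w \<bullet> b) *\<^sub>R L b)"
    by (simp add: linear_sum[OF assms] linear_scale[OF assms])
  then show ?thesis by (simp add: euclidean_representation)
qed

lemma inner_tangent_extension_right:
  "z \<bullet> snd (tangent_extension v x) = z \<bullet> snd v - (snd v \<bullet> snd x) * (z \<bullet> snd x)"
  by (simp add: tangent_extension_def inner_diff_right)

lemma linear_tangent_extension: "linear (\<lambda>v. tangent_extension v x)"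
  by (rule linearI) (simp_all add: tangent_extension_def prod_eq_iff inner_add_left algebra_simps)

context flrw begin

text \<open>The connection term is linear in the basis vector \<open>b\<close>, so the sum over
  \<open>b\<close> collapses to its value at \<open>V\<close>; there the normal correction vanishes
  because \<open>V\<close> is tangent.\<close>

lemma covariant_deriv_along_eq:
  assumes F: "F \<theta> \<in> spacetime" and V: "V \<theta> \<in> tangent_space (F \<theta>)"
    and Fi: "partial_deriv F i \<theta> \<in> tangent_space (F \<theta>)"
  shows "covariant_deriv_along a F i V \<theta>
    = tangent_extension (partial_deriv V i \<theta>) (F \<theta>) + christoffel a (F \<theta>) (partial_deriv F i \<theta>) (V \<theta>)"
proof -
  let ?x = "F \<theta>" and ?v = "partial_deriv F i \<theta>"
  define L where "L b = christoffel a ?x ?v (tangent_extension b ?x)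
      - (snd b \<bullet> snd ?x) *\<^sub>R (0, snd ?v)" for b
  have "nabla a (tangent_extension ?v) (tangent_extension b) ?x = L b" for b
    using Fi
    by (simp add: nabla_tangent_extension[OF F] tangent_extension_at[OF Fi] L_def christoffel_def
        inner_tangent_extension_right tangent_space_def)
  moreover have "linear L"
    by (rule linearI)
      (simp_all add: L_def linear_add[OF linear_tangent_extension] linear_scale[OF linear_tangent_extension]
        christoffel_linear_right inner_add_left algebra_simps del: scaleR_Pair)
  ultimately have "covariant_deriv_along a F i V \<theta> = tangent_extension (partial_deriv V i \<theta>) ?x + L (V \<theta>)"
    unfolding covariant_deriv_along_def sum.distrib
    by (simp only: sum_Basis_linear[OF linear_tangent_extension] sum_Basis_linear[of L])
  then show ?thesis
    using V by (simp add: L_def tangent_extension_at[OF V] tangent_space_def zero_prod_def)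
qed

text \<open>Pythagoras: the subtracted part \<open>T\<close> lies in the span of the coordinate
  vectors, and \<open>e - T\<close> is orthogonal to both of them, hence to
  \<open>T\<close>.\<close>

lemma normal_part_eq:
  assumes "gram a (F \<theta>) (partial_deriv F 1 \<theta>) (partial_deriv F 2 \<theta>) \<noteq> 0"
  shows "flrw_metric a (F \<theta>) (normal_part a F \<theta> e) (normal_part a F \<theta> e)
    = flrw_metric a (F \<theta>) e e - tangential_norm_sq a (F \<theta>) (partial_deriv F 1 \<theta>) (partial_deriv F 2 \<theta>) e"
proof -
  let ?g = "flrw_metric a (F \<theta>)" and ?v = "partial_deriv F 1 \<theta>" and ?w = "partial_deriv F 2 \<theta>"
  let ?G = "gram a (F \<theta>) ?v ?w"
  define T where "T = (?g ?w ?w *\<^sub>R (?g e ?v *\<^sub>R ?v) - ?g ?v ?w *\<^sub>R (?g e ?v *\<^sub>R ?w + ?g e ?w *\<^sub>R ?v)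
      + ?g ?v ?v *\<^sub>R (?g e ?w *\<^sub>R ?w)) /\<^sub>R ?G"
  have n: "normal_part a F \<theta> e = e - T"
    by (simp add: normal_part_def induced_trace_eq[of a F \<theta>, OF assms] T_def)
  have "?g T ?v = (?g e ?v * ?G) / ?G"
    by (simp add: T_def flrw_metric_left flrw_metric_commute[of a "F \<theta>" ?w ?v] gram_def divide_inverse
        power2_eq_square algebra_simps)
  moreover have "?g T ?w = (?g e ?w * ?G) / ?G"
    by (simp add: T_def flrw_metric_left gram_def divide_inverse
        power2_eq_square algebra_simps)
  ultimately have "?g (e - T) ?v = 0" "?g (e - T) ?w = 0"
    using assms by (simp_all add: flrw_metric_left)
  then have "?g (e - T) T = 0"
    by (simp only: T_def flrw_metric_right mult_zero_right add_0_left diff_0_right)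
  then have "?g (e - T) (e - T) = ?g e e - ?g e T"
    by (simp add: flrw_metric_right flrw_metric_left flrw_metric_commute[of a "F \<theta>" T e])
  also have "?g e T = tangential_norm_sq a (F \<theta>) ?v ?w e"
    by (simp add: T_def flrw_metric_right tangential_norm_sq_def divide_inverse power2_eq_square algebra_simps)
  finally show ?thesis by (simp add: n)
qed

lemma partial_deriv_tangent:
  assumes "range F \<subseteq> spacetime" and F: "F differentiable at \<theta>"
  shows "partial_deriv F i \<theta> \<in> tangent_space (F \<theta>)"
proof -
  let ?F' = "frechet_derivative F (at \<theta>)"
  have "(F has_derivative ?F') (at \<theta>)" using F frechet_derivative_works by blast
  then have "((\<lambda>y. snd (F y) \<bullet> snd (F y)) has_derivative
      (\<lambda>v. snd (F \<theta>) \<bullet> snd (?F' v) + snd (?F' v) \<bullet> snd (F \<theta>))) (at \<theta>)"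
    by (intro has_derivative_inner has_derivative_snd)
  moreover have "F y \<in> spacetime" for y using assms(1) by blast
  then have "((\<lambda>y. snd (F y) \<bullet> snd (F y)) has_derivative (\<lambda>v. 0)) (at \<theta>)"
    by (simp add: spacetime_inner_self)
  ultimately have "(\<lambda>v. snd (F \<theta>) \<bullet> snd (?F' v) + snd (?F' v) \<bullet> snd (F \<theta>)) = (\<lambda>v. 0)"
    by (rule has_derivative_unique)
  from fun_cong[OF this, of "coord_dir i"] show ?thesis
    by (simp add: partial_deriv_def tangent_space_def inner_commute)
qed

text \<open>The normal projection is linear and so commutes with the trace: it is applied once, to
  the trace of the full covariant derivatives. The sign in the second fundamental form disappears on
  squaring.\<close>

lemma mean_curvature_sq_eq:
  assumes F: "range F \<subseteq> spacetime" and d: "F differentiable at \<theta>"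
    and G: "gram a (F \<theta>) (partial_deriv F 1 \<theta>) (partial_deriv F 2 \<theta>) \<noteq> 0"
  shows "mean_curvature_sq a F \<theta> = jet_curvature_sq a (F \<theta>) (partial_deriv F 1 \<theta>) (partial_deriv F 2 \<theta>)
     (partial_deriv (partial_deriv F 1) 1 \<theta>) (partial_deriv (partial_deriv F 2) 1 \<theta>)
     (partial_deriv (partial_deriv F 1) 2 \<theta>) (partial_deriv (partial_deriv F 2) 2 \<theta>)"
proof -
  let ?C = "\<lambda>i j. covariant_deriv_along a F i (partial_deriv F j) \<theta>"
  have C: "?C i j = jet_hessian a (F \<theta>) (partial_deriv F i \<theta>) (partial_deriv F j \<theta>)
      (partial_deriv (partial_deriv F j) i \<theta>)" for i j
    using F d by (subst covariant_deriv_along_eq)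
      (auto simp: jet_hessian_def intro!: partial_deriv_tangent)
  have neg: "normal_part a F \<theta> (u + v) = normal_part a F \<theta> u + normal_part a F \<theta> v"
    "normal_part a F \<theta> (u - v) = normal_part a F \<theta> u - normal_part a F \<theta> v"
    "normal_part a F \<theta> (c *\<^sub>R v) = c *\<^sub>R normal_part a F \<theta> v" for u v c
    by (simp_all only: normal_part_def induced_trace_eq[OF G] flrw_metric_left)
      (simp_all add: algebra_simps)
  have "mean_curvature_vector a F \<theta> = - normal_part a F \<theta> (induced_trace a F \<theta> ?C)"
    unfolding mean_curvature_vector_def induced_trace_eq[OF G] second_fundamental_form_def neg
    by (simp add: algebra_simps)
  then have "mean_curvature_sq a F \<theta> = flrw_metric a (F \<theta>) (normal_part a F \<theta> (induced_trace a F \<theta> ?C))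
      (normal_part a F \<theta> (induced_trace a F \<theta> ?C))"
    by (simp add: mean_curvature_sq_def flrw_metric_left flrw_metric_right)
  also have "induced_trace a F \<theta> ?C = jet_trace a (F \<theta>) (partial_deriv F 1 \<theta>) (partial_deriv F 2 \<theta>)
     (partial_deriv (partial_deriv F 1) 1 \<theta>) (partial_deriv (partial_deriv F 2) 1 \<theta>)
     (partial_deriv (partial_deriv F 1) 2 \<theta>) (partial_deriv (partial_deriv F 2) 2 \<theta>)"
    by (simp only: induced_trace_eq[OF G] C jet_trace_def)
  finally show ?thesis unfolding normal_part_eq[OF G] jet_curvature_sq_def .
qed

section \<open>Regularity of the jet functions\<close>

lemma Ck_on_flrw_metric [Ck_intros]:
  "open S \<Longrightarrow> Ck_on k S x \<Longrightarrow> Ck_on k S v \<Longrightarrow> Ck_on k S w \<Longrightarrow> Ck_on k S (\<lambda>z. flrw_metric a (x z) (v z) (w z))"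
  unfolding flrw_metric_def by (intro Ck_intros)

lemma Ck_on_gram [Ck_intros]:
  "open S \<Longrightarrow> Ck_on k S x \<Longrightarrow> Ck_on k S v \<Longrightarrow> Ck_on k S w \<Longrightarrow> Ck_on k S (\<lambda>z. gram a (x z) (v z) (w z))"
  unfolding gram_def by (intro Ck_intros)

lemma Ck_on_christoffel [Ck_intros]:
  "open S \<Longrightarrow> Ck_on k S x \<Longrightarrow> Ck_on k S v \<Longrightarrow> Ck_on k S w \<Longrightarrow> Ck_on k S (\<lambda>z. christoffel a (x z) (v z) (w z))"
  unfolding christoffel_def by (intro Ck_intros) simp_all

lemma Ck_on_jet_hessian [Ck_intros]:
  "open S \<Longrightarrow> Ck_on k S x \<Longrightarrow> Ck_on k S v \<Longrightarrow> Ck_on k S w \<Longrightarrow> Ck_on k S u \<Longrightarrow>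
    Ck_on k S (\<lambda>z. jet_hessian a (x z) (v z) (w z) (u z))"
  unfolding jet_hessian_def tangent_extension_def by (intro Ck_intros)

lemma Ck_on_jet_trace [Ck_intros]:
  assumes "open S" "Ck_on k S x" "Ck_on k S v" "Ck_on k S w" "Ck_on k S vv" "Ck_on k S vw" "Ck_on k S wv"
    "Ck_on k S ww" and G: "\<And>z. z \<in> S \<Longrightarrow> gram a (x z) (v z) (w z) \<noteq> 0"
  shows "Ck_on k S (\<lambda>z. jet_trace a (x z) (v z) (w z) (vv z) (vw z) (wv z) (ww z))"
  unfolding jet_trace_def by (intro Ck_intros assms)

lemma Ck_on_jet_curvature_sq [Ck_intros]:
  assumes "open S" "Ck_on k S x" "Ck_on k S v" "Ck_on k S w" "Ck_on k S vv" "Ck_on k S vw" "Ck_on k S wv"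
    "Ck_on k S ww" and G: "\<And>z. z \<in> S \<Longrightarrow> gram a (x z) (v z) (w z) \<noteq> 0"
  shows "Ck_on k S (\<lambda>z. jet_curvature_sq a (x z) (v z) (w z) (vv z) (vw z) (wv z) (ww z))"
  unfolding jet_curvature_sq_def tangential_norm_sq_def by (intro Ck_intros assms)

end

section \<open>Integrals over the torus\<close>

lemma has_derivative_slice:
  assumes "(f has_derivative f') (at (s, \<theta>))"
  shows "((\<lambda>s. f (s, \<theta>)) has_vector_derivative f' (1, 0)) (at s)"
    and "((\<lambda>\<theta>. f (s, \<theta>)) has_derivative (\<lambda>v. f' (0, v))) (at \<theta>)"
proof -
  have "((\<lambda>s. f (s, \<theta>)) has_derivative (\<lambda>h. f' (h, 0))) (at s)"
    by (rule has_derivative_compose[of "\<lambda>s. (s, \<theta>)" "\<lambda>h. (h, 0)", OF _ assms])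
      (auto intro!: derivative_eq_intros)
  moreover have "(\<lambda>h. f' (h, 0)) = (\<lambda>h. h *\<^sub>R f' (1, 0))"
  proof
    show "f' (h, 0) = h *\<^sub>R f' (1, 0)" for h
      using linear_scale[OF has_derivative_linear[OF assms], of h "(1, 0)"] by simp
  qed
  ultimately show "((\<lambda>s. f (s, \<theta>)) has_vector_derivative f' (1, 0)) (at s)"
    by (simp only: has_vector_derivative_def)
  show "((\<lambda>\<theta>. f (s, \<theta>)) has_derivative (\<lambda>v. f' (0, v))) (at \<theta>)"
    by (rule has_derivative_compose[of "\<lambda>\<theta>. (s, \<theta>)" "\<lambda>v. (0, v)", OF _ assms])
      (auto intro!: derivative_eq_intros)
qed

lemma Ck_on_slice:
  fixes f :: "'a::euclidean_space \<times> 'b::euclidean_space \<Rightarrow> 'c::real_normed_vector"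
  assumes "open S" "Ck_on k (S \<times> UNIV) f" "s \<in> S"
  shows "Ck_on k UNIV (\<lambda>\<theta>. f (s, \<theta>))"
  by (rule Ck_on_compose[OF open_UNIV open_Times[OF assms(1) open_UNIV] _ assms(2)])
    (auto intro!: Ck_intros simp: assms(3))

text \<open>By compactness one parameter interval works for the whole torus. This is what allows
  differentiation under the integral for densities that are smooth only on an open set.\<close>

lemma eventually_slice_subset:
  assumes "open U" "{s0} \<times> K \<subseteq> U" "compact K"
  shows "\<exists>e>0. ball s0 e \<times> K \<subseteq> U"
proof -
  obtain X where "s0 \<in> X" "open X" "X \<times> K \<subseteq> U"
    using Elementary_Topology.tube_lemma[OF assms(3,1,2)] by blast
  then show ?thesis
    by (meson Sigma_mono open_contains_ball order_refl order_trans)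
qed

lemma has_derivative_integral_parameter:
  fixes w :: "real \<times> 'a::euclidean_space \<Rightarrow> real"
  assumes U: "open U" and w: "Ck_on (Suc 0) U w" and sub: "{s0} \<times> cbox p q \<subseteq> U"
  shows "((\<lambda>s. integral (cbox p q) (\<lambda>\<theta>. w (s, \<theta>))) has_real_derivative
    integral (cbox p q) (\<lambda>\<theta>. frechet_derivative w (at (s0, \<theta>)) (1, 0))) (at s0)"
proof -
  obtain e where e: "0 < e" "ball s0 e \<times> cbox p q \<subseteq> U"
    using eventually_slice_subset[OF U sub compact_cbox] by blast
  have "((\<lambda>s. integral (cbox p q) (\<lambda>\<theta>. w (s, \<theta>))) has_real_derivative
    integral (cbox p q) (\<lambda>\<theta>. frechet_derivative w (at (s0, \<theta>)) (1, 0))) (at s0 within ball s0 e)"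
  proof (rule leibniz_rule_field_derivative)
    fix s \<theta> assume "s \<in> ball s0 e" "\<theta> \<in> cbox p q"
    then have "(s, \<theta>) \<in> U" using e by blast
    from has_derivative_slice(1)[OF Ck_on_Suc_has_derivative[OF w this]]
    show "((\<lambda>s. w (s, \<theta>)) has_real_derivative frechet_derivative w (at (s, \<theta>)) (1, 0)) (at s within ball s0 e)"
      by (simp add: has_real_derivative_iff_has_vector_derivative has_vector_derivative_at_within)
  next
    fix s assume s: "s \<in> ball s0 e"
    have "continuous_on (cbox p q) (\<lambda>\<theta>. w (s, \<theta>))"
      by (rule continuous_on_compose2[OF Ck_on_imp_continuous_on[OF w]])
        (use s e in \<open>auto intro!: continuous_intros\<close>)
    then show "(\<lambda>\<theta>. w (s, \<theta>)) integrable_on cbox p q" by (rule integrable_continuous)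
  next
    have "continuous_on U (\<lambda>z. frechet_derivative w (at z) (1, 0))"
      using w by simp
    then show "continuous_on (ball s0 e \<times> cbox p q) (\<lambda>(s, \<theta>). frechet_derivative w (at (s, \<theta>)) (1, 0))"
      by (simp add: split_beta' continuous_on_subset[OF _ e(2)])
  qed (use e in auto)
  then show ?thesis using e by (simp add: at_within_open[of s0 "ball s0 e"])
qed

section \<open>Doubly periodic functions and integrals of exact derivatives\<close>

abbreviation torus_domain :: "(real \<times> real) set" where
  "torus_domain \<equiv> cbox (0, 0) (2 * pi, 2 * pi)"

definition doubly_periodic :: "(real \<times> real \<Rightarrow> 'b) \<Rightarrow> bool" where
  "doubly_periodic f \<longleftrightarrow> (\<forall>u v. f (u + 2 * pi, v) = f (u, v) \<and> f (u, v + 2 * pi) = f (u, v))"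

lemma doubly_periodic_shift:
  "doubly_periodic f \<longleftrightarrow> (\<forall>\<theta>. f (\<theta> + (2 * pi, 0)) = f \<theta> \<and> f (\<theta> + (0, 2 * pi)) = f \<theta>)"
  by (simp add: doubly_periodic_def)

lemma frechet_derivative_shift:
  fixes f :: "'a::real_normed_vector \<Rightarrow> 'b::real_normed_vector"
  assumes per: "\<And>x. f (x + c) = f x" and f: "\<And>x. f differentiable at x"
  shows "frechet_derivative f (at (x + c)) = frechet_derivative f (at x)"
proof -
  have "(f has_derivative frechet_derivative f (at (x + c))) (at (x + c))"
    using f frechet_derivative_works by blast
  moreover have "((\<lambda>y. y + c) has_derivative (\<lambda>h. h)) (at x)"
    by (auto intro!: derivative_eq_intros)
  ultimately have "((\<lambda>y. f (y + c)) has_derivative frechet_derivative f (at (x + c))) (at x)"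
    using has_derivative_compose by blast
  then show ?thesis unfolding per by (rule frechet_derivative_eq[symmetric])
qed

lemma doubly_periodic_frechet_derivative:
  assumes "doubly_periodic f" "\<And>x. f differentiable at x"
  shows "doubly_periodic (\<lambda>\<theta>. frechet_derivative f (at \<theta>) v)"
  using assms frechet_derivative_shift[of f "(2 * pi, 0)"] frechet_derivative_shift[of f "(0, 2 * pi)"]
  unfolding doubly_periodic_shift by metis

lemma integral_partial_derivative_zero:
  fixes h :: "real \<times> real \<Rightarrow> real"
  assumes h: "Ck_on (Suc 0) UNIV h" and per: "doubly_periodic h"
  shows "integral torus_domain (\<lambda>\<theta>. frechet_derivative h (at \<theta>) (coord_dir i)) = 0"
proof -
  have d: "(h has_derivative frechet_derivative h (at \<theta>)) (at \<theta>)" for \<theta>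
    by (rule Ck_on_Suc_has_derivative[OF h UNIV_I])
  have cont: "continuous_on S (\<lambda>\<theta>. frechet_derivative h (at \<theta>) v)" for v S
    by (rule continuous_on_subset[OF Ck_on_imp_continuous_on[OF Ck_on_frechet_derivative[OF h]] subset_UNIV])
  have per0: "h (2 * pi, v) = h (0, v)" "h (u, 2 * pi) = h (u, 0)" for u v
    using per by (metis doubly_periodic_def add_0)+
  consider "i = 1" | "i = 2" using exhaust_2 by blast
  then show ?thesis
  proof cases
    case 1
    have "((\<lambda>u. frechet_derivative h (at (u, v)) (1, 0)) has_integral h (2 * pi, v) - h (0, v)) {0..2 * pi}" for v
      by (rule fundamental_theorem_of_calculus)
        (auto intro: has_vector_derivative_at_within has_derivative_slice(1)[OF d])
    then have 0: "integral (cbox 0 (2 * pi)) (\<lambda>u. frechet_derivative h (at (u, v)) (1, 0)) = 0" for v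
      by (simp add: per0 integral_unique)
    have "integral torus_domain (\<lambda>\<theta>. frechet_derivative h (at \<theta>) (1, 0))
        = integral (cbox 0 (2 * pi)) (\<lambda>u. integral (cbox 0 (2 * pi)) (\<lambda>v. frechet_derivative h (at (u, v)) (1, 0)))"
      by (rule integral_prod_continuous[OF cont])
    \<comment> \<open>The first variable has to be integrated first in order to apply the
      fundamental theorem of calculus, so the order is exchanged.\<close>
    also have "\<dots> = integral (cbox 0 (2 * pi)) (\<lambda>v. integral (cbox 0 (2 * pi)) (\<lambda>u. frechet_derivative h (at (u, v)) (1, 0)))"
      by (rule integral_swap_continuous) (simp add: split_beta' cont)
    finally show ?thesis by (simp only: 0 1 coord_dir_def) simp
  next
    case 2
    have "((\<lambda>v. h (u, v)) has_vector_derivative frechet_derivative h (at (u, v)) (0, 1)) (at v)" for u v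
    proof -
      have "(\<lambda>k. frechet_derivative h (at (u, v)) (0, k)) = (\<lambda>k. k *\<^sub>R frechet_derivative h (at (u, v)) (0, 1))"
      proof
        show "frechet_derivative h (at (u, v)) (0, k) = k *\<^sub>R frechet_derivative h (at (u, v)) (0, 1)" for k
          using linear_scale[OF has_derivative_linear[OF d], of "(u, v)" k "(0, 1)"] by simp
      qed
      then show ?thesis
        using has_derivative_slice(2)[OF d, of u v] by (simp only: has_vector_derivative_def)
    qed
    then have "((\<lambda>v. frechet_derivative h (at (u, v)) (0, 1)) has_integral h (u, 2 * pi) - h (u, 0)) {0..2 * pi}" for u
      by (intro fundamental_theorem_of_calculus) (auto intro: has_vector_derivative_at_within)
    then have 0: "integral (cbox 0 (2 * pi)) (\<lambda>v. frechet_derivative h (at (u, v)) (0, 1)) = 0" for u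
      by (simp add: per0 integral_unique)
    have "integral torus_domain (\<lambda>\<theta>. frechet_derivative h (at \<theta>) (0, 1))
        = integral (cbox 0 (2 * pi)) (\<lambda>u. integral (cbox 0 (2 * pi)) (\<lambda>v. frechet_derivative h (at (u, v)) (0, 1)))"
      by (rule integral_prod_continuous[OF cont])
    then show ?thesis by (simp only: 0 2 coord_dir_def) simp
  qed
qed

section \<open>Families of tori\<close>

text \<open>A surface derivative taken as a directional derivative of the whole family, so that its
  joint smoothness in parameter and surface variables is inherited.\<close>

definition spatial_deriv :: "(real \<times> real \<times> real \<Rightarrow> 'b::real_normed_vector) \<Rightarrow> 2 \<Rightarrow> real \<times> real \<times> real \<Rightarrow> 'b" where
  "spatial_deriv f i z = frechet_derivative f (at z) (0, coord_dir i)"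

lemma frechet_derivative_slice:
  "f differentiable at (s, \<theta>) \<Longrightarrow>
    frechet_derivative (\<lambda>\<theta>. f (s, \<theta>)) (at \<theta>) (coord_dir i) = spatial_deriv f i (s, \<theta>)"
  using frechet_derivative_eq[OF has_derivative_slice(2), of f "frechet_derivative f (at (s, \<theta>))" s \<theta>]
  by (simp add: spatial_deriv_def frechet_derivative_works[symmetric])

locale torus_family = flrw +
  fixes \<epsilon> :: real and \<Psi> :: "real \<times> real \<times> real \<Rightarrow> pt"
  assumes eps: "0 < \<epsilon>"
    and smooth_family: "smooth_on ({-\<epsilon><..<\<epsilon>} \<times> UNIV) \<Psi>"
    and periodic_family: "\<And>s. s \<in> {-\<epsilon><..<\<epsilon>} \<Longrightarrow> doubly_periodic (\<lambda>\<theta>. \<Psi> (s, \<theta>))"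
    and spacetime_family: "\<And>s \<theta>. s \<in> {-\<epsilon><..<\<epsilon>} \<Longrightarrow> \<Psi> (s, \<theta>) \<in> spacetime"
begin

definition slab :: "(real \<times> real \<times> real) set" where
  "slab = {-\<epsilon><..<\<epsilon>} \<times> UNIV"

lemma slab_iff: "(s, \<theta>) \<in> slab \<longleftrightarrow> s \<in> {-\<epsilon><..<\<epsilon>}"
  by (simp add: slab_def)

lemma open_slab [simp]: "open slab"
  by (simp add: slab_def open_Times)

abbreviation D1 where "D1 i \<equiv> spatial_deriv \<Psi> i"
abbreviation D2 where "D2 i j \<equiv> spatial_deriv (spatial_deriv \<Psi> j) i"

lemma Ck_on_family: "Ck_on k slab \<Psi>" "Ck_on k slab (D1 i)" "Ck_on k slab (D2 i j)"
proof -
  show \<Psi>: "Ck_on k slab \<Psi>" for k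
    using smooth_family by (simp add: slab_def smooth_on_imp_Ck_on)
  show D1: "Ck_on k slab (D1 i)" for k i
    using Ck_on_frechet_derivative[OF \<Psi>[of "Suc k"]] by (simp add: spatial_deriv_def[abs_def])
  show "Ck_on k slab (D2 i j)"
    using Ck_on_frechet_derivative[OF D1[of "Suc k" j]] by (simp add: spatial_deriv_def[abs_def])
qed

lemma differentiable_family:
  assumes "z \<in> slab"
  shows "\<Psi> differentiable at z" "D1 i differentiable at z" "D2 i j differentiable at z"
  using Ck_on_family[of "Suc 0"] assms by simp_all

lemma partial_deriv_family:
  assumes s: "s \<in> {-\<epsilon><..<\<epsilon>}"
  shows "partial_deriv (\<lambda>\<theta>. \<Psi> (s, \<theta>)) i = (\<lambda>\<theta>. D1 i (s, \<theta>))"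
    and "partial_deriv (\<lambda>\<theta>. D1 j (s, \<theta>)) i = (\<lambda>\<theta>. D2 i j (s, \<theta>))"
  using s by (simp_all add: partial_deriv_def frechet_derivative_slice differentiable_family slab_iff)

text \<open>A variation need not remain spacelike on its whole parameter interval. Both densities,
  with their square root and division by the Gram determinant, are smooth on this open set.\<close>

definition nondegenerate :: "(real \<times> real \<times> real) set" where
  "nondegenerate = {z \<in> slab. 0 < gram a (\<Psi> z) (D1 1 z) (D1 2 z)}"

definition area_density :: "real \<times> real \<times> real \<Rightarrow> real" where
  "area_density z = sqrt (gram a (\<Psi> z) (D1 1 z) (D1 2 z))"

definition willmore_density :: "real \<times> real \<times> real \<Rightarrow> real" where
  "willmore_density z = jet_curvature_sq a (\<Psi> z) (D1 1 z) (D1 2 z) (D2 1 1 z) (D2 1 2 z) (D2 2 1 z) (D2 2 2 z)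
     * area_density z"

lemma open_nondegenerate: "open nondegenerate"
proof -
  have "continuous_on slab (\<lambda>z. gram a (\<Psi> z) (D1 1 z) (D1 2 z))"
    by (rule Ck_on_imp_continuous_on[of 0]) (intro Ck_intros Ck_on_family open_slab)
  then have "open (slab \<inter> (\<lambda>z. gram a (\<Psi> z) (D1 1 z) (D1 2 z)) -` {0<..})"
    by (intro continuous_open_preimage) simp_all
  also have "slab \<inter> (\<lambda>z. gram a (\<Psi> z) (D1 1 z) (D1 2 z)) -` {0<..} = nondegenerate"
    by (auto simp: nondegenerate_def)
  finally show ?thesis .
qed

lemma Ck_on_nondegenerate:
  "Ck_on k nondegenerate \<Psi>" "Ck_on k nondegenerate (D1 i)" "Ck_on k nondegenerate (D2 i j)"
proof -
  have sub: "nondegenerate \<subseteq> slab" by (auto simp: nondegenerate_def)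
  show "Ck_on k nondegenerate \<Psi>" "Ck_on k nondegenerate (D1 i)" "Ck_on k nondegenerate (D2 i j)"
    by (rule Ck_on_subset[OF Ck_on_family(1) sub] Ck_on_subset[OF Ck_on_family(2) sub]
        Ck_on_subset[OF Ck_on_family(3) sub])+
qed

lemma Ck_on_densities: "Ck_on k nondegenerate area_density" "Ck_on k nondegenerate willmore_density"
proof -
  show A: "Ck_on k nondegenerate area_density"
    unfolding area_density_def[abs_def]
    by (intro Ck_intros Ck_on_nondegenerate open_nondegenerate) (simp add: nondegenerate_def)
  show "Ck_on k nondegenerate willmore_density"
    unfolding willmore_density_def[abs_def]
    by (intro Ck_intros A Ck_on_nondegenerate open_nondegenerate) (simp add: nondegenerate_def)
qed

lemma area_family:
  assumes "s \<in> {-\<epsilon><..<\<epsilon>}"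
  shows "area a (\<lambda>\<theta>. \<Psi> (s, \<theta>)) = integral torus_domain (\<lambda>\<theta>. area_density (s, \<theta>))"
  by (simp add: area_def surface_integral_def det_induced_metric partial_deriv_family[OF assms] area_density_def)

lemma willmore_energy_family:
  assumes sub: "{s} \<times> torus_domain \<subseteq> nondegenerate"
  shows "willmore_energy a (\<lambda>\<theta>. \<Psi> (s, \<theta>)) = integral torus_domain (\<lambda>\<theta>. willmore_density (s, \<theta>))"
  unfolding willmore_energy_def surface_integral_def
proof (rule integral_cong)
  fix \<theta> assume \<theta>: "\<theta> \<in> torus_domain"
  then have z: "(s, \<theta>) \<in> nondegenerate" using sub by blast
  then have s: "s \<in> {-\<epsilon><..<\<epsilon>}" and G: "0 < gram a (\<Psi> (s, \<theta>)) (D1 1 (s, \<theta>)) (D1 2 (s, \<theta>))"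
    by (auto simp: nondegenerate_def slab_iff)
  have d: "(\<lambda>\<theta>. \<Psi> (s, \<theta>)) differentiable at \<theta>"
    using has_derivative_slice(2)[of \<Psi> "frechet_derivative \<Psi> (at (s, \<theta>))" s \<theta>]
      differentiable_family(1)[of "(s, \<theta>)"] s frechet_derivative_works[of \<Psi>]
    by (auto simp: slab_iff differentiable_def)
  have "mean_curvature_sq a (\<lambda>\<theta>. \<Psi> (s, \<theta>)) \<theta> = jet_curvature_sq a (\<Psi> (s, \<theta>)) (D1 1 (s, \<theta>)) (D1 2 (s, \<theta>))
      (D2 1 1 (s, \<theta>)) (D2 1 2 (s, \<theta>)) (D2 2 1 (s, \<theta>)) (D2 2 2 (s, \<theta>))"
    using spacetime_family[OF s] d G
    by (subst mean_curvature_sq_eq) (auto simp: partial_deriv_family[OF s])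
  then show "mean_curvature_sq a (\<lambda>\<theta>. \<Psi> (s, \<theta>)) \<theta> * sqrt (det (induced_metric a (\<lambda>\<theta>. \<Psi> (s, \<theta>)) \<theta>))
      = willmore_density (s, \<theta>)"
    by (simp add: willmore_density_def area_density_def det_induced_metric partial_deriv_family[OF s])
qed

end

section \<open>Pointwise first variation\<close>

lemma has_vector_derivative_fst:
  "(f has_vector_derivative f') F \<Longrightarrow> ((\<lambda>s. fst (f s)) has_vector_derivative fst f') F"
  by (rule bounded_linear.has_vector_derivative[OF bounded_linear_fst])

lemma has_vector_derivative_snd:
  "(f has_vector_derivative f') F \<Longrightarrow> ((\<lambda>s. snd (f s)) has_vector_derivative snd f') F"
  by (rule bounded_linear.has_vector_derivative[OF bounded_linear_snd])

lemma has_real_derivative_inner: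
  assumes "(f has_vector_derivative f') (at s)" "(g has_vector_derivative g') (at s)"
  shows "((\<lambda>s. f s \<bullet> g s) has_real_derivative f s \<bullet> g' + f' \<bullet> g s) (at s)"
  unfolding has_real_derivative_iff_has_vector_derivative
  by (rule bounded_bilinear.has_vector_derivative[OF bounded_bilinear_inner assms])

lemma has_real_derivative_fst:
  fixes f :: "real \<Rightarrow> real \<times> 'b::real_normed_vector"
  shows "(f has_vector_derivative f') (at s) \<Longrightarrow> ((\<lambda>s. fst (f s)) has_real_derivative fst f') (at s)"
  by (simp add: has_real_derivative_iff_has_vector_derivative has_vector_derivative_fst)

context flrw begin

lemma has_real_derivative_flrw_metric:
  assumes x: "(x has_vector_derivative x') (at s)" and v: "(v has_vector_derivative v') (at s)"
    and w: "(w has_vector_derivative w') (at s)"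
  shows "((\<lambda>s. flrw_metric a (x s) (v s) (w s)) has_real_derivative
    (a (fst (x s)))\<^sup>2 * (snd (v s) \<bullet> snd w' + snd v' \<bullet> snd (w s))
    + 2 * a (fst (x s)) * deriv a (fst (x s)) * fst x' * (snd (v s) \<bullet> snd (w s))
    - (fst (v s) * fst w' + fst v' * fst (w s))) (at s)"
proof -
  have da: "((\<lambda>s. a (fst (x s))) has_real_derivative deriv a (fst (x s)) * fst x') (at s)"
    by (rule DERIV_chain2[OF has_derivative_a has_real_derivative_fst[OF x]])
  show ?thesis
    unfolding flrw_metric_def
    by (rule DERIV_cong, (rule DERIV_add DERIV_minus DERIV_mult DERIV_power da has_real_derivative_fst
        has_real_derivative_inner has_vector_derivative_snd v w)+) (simp add: algebra_simps)
qed

text \<open>In the time component the Christoffel term \<open>a a'\<close> times the spatial product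
  is \<open>h\<close> times the metric plus \<open>h\<close> times the product of the time
  components. The metric has trace 2, giving \<open>2 h\<close>; the rest depends on time components
  only.\<close>

lemma fst_jet_trace:
  assumes "gram a x v w \<noteq> 0"
  shows "fst (jet_trace a x v w vv vw wv ww) = 2 * (deriv a (fst x) / a (fst x)) +
    (flrw_metric a x w w * (fst vv + deriv a (fst x) / a (fst x) * (fst v * fst v))
     - flrw_metric a x v w * (fst vw + fst wv + 2 * (deriv a (fst x) / a (fst x)) * (fst v * fst w))
     + flrw_metric a x v v * (fst ww + deriv a (fst x) / a (fst x) * (fst w * fst w))) / gram a x v w"
proof -
  define h where "h = deriv a (fst x) / a (fst x)"
  have C: "fst (jet_hessian a x u y z) = fst z + h * (flrw_metric a x u y + fst u * fst y)" for u y z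
    by (simp add: jet_hessian_def christoffel_def flrw_metric_def h_def power2_eq_square)
  let ?N = "flrw_metric a x w w * (fst vv + h * (fst v * fst v))
     - flrw_metric a x v w * (fst vw + fst wv + 2 * h * (fst v * fst w))
     + flrw_metric a x v v * (fst ww + h * (fst w * fst w))"
  have "fst (jet_trace a x v w vv vw wv ww) = (2 * h * gram a x v w + ?N) / gram a x v w"
    by (simp add: jet_trace_def C divide_inverse_commute)
      (simp add: gram_def flrw_metric_commute[of a x w v] power2_eq_square algebra_simps)
  then show ?thesis using assms by (simp add: h_def[symmetric] add_divide_distrib)
qed

text \<open>At a surface in a time slice with mean curvature vector \<open>2 h \<partial>\<^sub>t\<close> up to sign, the
  spatial part of the trace of the second derivatives and the tangential part enter
  \<open>\<parallel>H\<parallel>\<^sup>2\<close> quadratically, so that only the time component of the trace contributes.\<close>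

lemma density_derivatives:
  fixes x v w vv vw wv ww :: "real \<Rightarrow> pt"
  defines "t \<equiv> fst (x 0)"
  defines "h \<equiv> deriv a t / a t"
  defines "G \<equiv> \<lambda>s. gram a (x s) (v s) (w s)"
    and "E \<equiv> \<lambda>s. jet_trace a (x s) (v s) (w s) (vv s) (vw s) (wv s) (ww s)"
  assumes x: "(x has_vector_derivative x') (at 0)" and v: "(v has_vector_derivative v') (at 0)"
    and w: "(w has_vector_derivative w') (at 0)" and vv: "(vv has_vector_derivative vv') (at 0)"
    and vw: "(vw has_vector_derivative vw') (at 0)" and wv: "(wv has_vector_derivative wv') (at 0)"
    and ww: "(ww has_vector_derivative ww') (at 0)"
    and E: "(E has_vector_derivative E') (at 0)"
    and time: "fst (v 0) = 0" "fst (w 0) = 0" "fst (vv 0) = 0" "fst (vw 0) = 0" "fst (wv 0) = 0" "fst (ww 0) = 0"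
    and orth: "snd (v 0) \<bullet> snd (v 0) = 1 / 2" "snd (w 0) \<bullet> snd (w 0) = 1 / 2" "snd (v 0) \<bullet> snd (w 0) = 0"
    and E0: "snd (E 0) = 0"
  defines "dA \<equiv> a t * deriv a t * fst x' + (a t)\<^sup>2 * (snd (v 0) \<bullet> snd v' + snd (w 0) \<bullet> snd w')"
  shows "((\<lambda>s. sqrt (G s)) has_real_derivative dA) (at 0)"
    and "((\<lambda>s. jet_curvature_sq a (x s) (v s) (w s) (vv s) (vw s) (wv s) (ww s) * sqrt (G s))
      has_real_derivative - 4 * h * ((deriv (deriv a) t * a t - (deriv a t)\<^sup>2) * fst x' + (fst vv' + fst ww'))
        - 4 * h\<^sup>2 * dA) (at 0)"
proof -
  define g11 g12 g22 where "g11 = (\<lambda>s. flrw_metric a (x s) (v s) (v s))"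
    and "g12 = (\<lambda>s. flrw_metric a (x s) (v s) (w s))" and "g22 = (\<lambda>s. flrw_metric a (x s) (w s) (w s))"
  define d11 d22 where "d11 = 2 * (a t)\<^sup>2 * (snd (v 0) \<bullet> snd v') + a t * deriv a t * fst x'"
    and "d22 = 2 * (a t)\<^sup>2 * (snd (w 0) \<bullet> snd w') + a t * deriv a t * fst x'"
  have g0: "g11 0 = (a t)\<^sup>2 / 2" "g22 0 = (a t)\<^sup>2 / 2" "g12 0 = 0"
    by (simp_all add: g11_def g12_def g22_def flrw_metric_def time orth t_def)
  have g11: "(g11 has_real_derivative d11) (at 0)"
    unfolding g11_def
    by (rule DERIV_cong[OF has_real_derivative_flrw_metric[OF x v v]])
      (simp add: d11_def time orth t_def inner_commute)
  have g22: "(g22 has_real_derivative d22) (at 0)"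
    unfolding g22_def
    by (rule DERIV_cong[OF has_real_derivative_flrw_metric[OF x w w]])
      (simp add: d22_def time orth t_def inner_commute)
  \<comment> \<open>The value of \<open>d12\<close> is left open: wherever it appears in the
    derivatives below, it is multiplied by a quantity that vanishes at 0.\<close>
  obtain d12 where g12: "(g12 has_real_derivative d12) (at 0)"
    unfolding g12_def using has_real_derivative_flrw_metric[OF x v w] by blast
  have G_eq: "G = (\<lambda>s. g11 s * g22 s - (g12 s)\<^sup>2)"
    by (simp add: G_def gram_def g11_def g12_def g22_def)
  have G0: "G 0 = ((a t)\<^sup>2 / 2)\<^sup>2" by (simp add: G_eq g0 power2_eq_square)
  have sqrtG0: "sqrt (G 0) = (a t)\<^sup>2 / 2" by (simp add: G0 real_sqrt_abs)
  have Gpos: "0 < G 0" by (simp add: G0)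
  have G: "(G has_real_derivative (a t)\<^sup>2 / 2 * (d11 + d22)) (at 0)"
    unfolding G_eq
    by (rule DERIV_cong, (rule DERIV_diff DERIV_mult DERIV_power g11 g12 g22)+) (simp add: g0 algebra_simps)
  have "((\<lambda>s. sqrt (G s)) has_real_derivative inverse (sqrt (G 0)) / 2 * ((a t)\<^sup>2 / 2 * (d11 + d22))) (at 0)"
    by (rule DERIV_chain2[OF DERIV_real_sqrt[OF Gpos] G])
  then show A: "((\<lambda>s. sqrt (G s)) has_real_derivative dA) (at 0)"
    by (rule DERIV_cong) (simp add: sqrtG0 dA_def d11_def d22_def field_simps)
  have "(G \<longlongrightarrow> G 0) (nhds 0)"
    using DERIV_isCont[OF G] by (simp add: isCont_def tendsto_at_iff_tendsto_nhds)
  then have ev: "\<forall>\<^sub>F s in nhds 0. G s \<noteq> 0"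
    using Gpos by (intro tendsto_imp_eventually_ne) auto
  define H where "H s = deriv a (fst (x s)) / a (fst (x s))" for s
  have H: "(H has_real_derivative (deriv (deriv a) t * a t - (deriv a t)\<^sup>2) / (a t)\<^sup>2 * fst x') (at 0)"
  proof -
    have da: "((\<lambda>s. a (fst (x s))) has_real_derivative deriv a t * fst x') (at 0)"
      unfolding t_def by (rule DERIV_chain2[OF has_derivative_a has_real_derivative_fst[OF x]])
    have da': "((\<lambda>s. deriv a (fst (x s))) has_real_derivative deriv (deriv a) t * fst x') (at 0)"
      unfolding t_def
      by (rule DERIV_chain2[OF smooth_on_real_has_derivative[OF smooth_on_deriv[OF smooth]]
            has_real_derivative_fst[OF x]])
    have "(H has_real_derivative ((deriv (deriv a) t * fst x') * a t - deriv a t * (deriv a t * fst x')) / (a t * a t)) (at 0)"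
      unfolding H_def[abs_def] by (rule DERIV_cong[OF DERIV_divide[OF da' da]]) (simp_all add: t_def)
    then show ?thesis
      by (rule DERIV_cong) (simp add: power2_eq_square field_simps)
  qed
  define N where "N s = g22 s * (fst (vv s) + H s * (fst (v s) * fst (v s)))
     - g12 s * (fst (vw s) + fst (wv s) + 2 * H s * (fst (v s) * fst (w s)))
     + g11 s * (fst (ww s) + H s * (fst (w s) * fst (w s)))" for s
  \<comment> \<open>Since the numerator vanishes at 0, differentiating \<open>N / G\<close> leaves
    only \<open>N' / G\<close>.\<close>
  have N0: "N 0 = 0" by (simp add: N_def time)
  have N: "(N has_real_derivative (a t)\<^sup>2 / 2 * (fst vv' + fst ww')) (at 0)"
    unfolding N_def[abs_def]
    by (rule DERIV_cong, (rule DERIV_add DERIV_diff DERIV_mult DERIV_const g11 g12 g22 H has_real_derivative_fst vv vw wv ww v w)+)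
      (simp add: g0 time algebra_simps)
  have 1: "((\<lambda>s. 2 * H s + N s / G s) has_real_derivative
      2 * ((deriv (deriv a) t * a t - (deriv a t)\<^sup>2) / (a t)\<^sup>2 * fst x') + 2 / (a t)\<^sup>2 * (fst vv' + fst ww')) (at 0)"
    by (rule DERIV_cong, (rule DERIV_add DERIV_cmult DERIV_divide H N G)+)
      (use Gpos in \<open>simp_all add: N0 G0 power2_eq_square field_simps\<close>)
  \<comment> \<open>The formula divides by \<open>G\<close>, which is nonzero near 0. It computes
    the derivative of \<open>fst (E s)\<close>, which is then compared with
    \<open>fst E'\<close>.\<close>
  have 2: "\<forall>\<^sub>F s in nhds 0. fst (E s) = 2 * H s + N s / G s"
    using ev
  proof eventually_elim
    case (elim s)
    then show ?case
      by (simp add: E_def fst_jet_trace G_def H_def N_def g11_def g12_def g22_def)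
  qed
  have "((\<lambda>s. fst (E s)) has_real_derivative
      2 * ((deriv (deriv a) t * a t - (deriv a t)\<^sup>2) / (a t)\<^sup>2 * fst x') + 2 / (a t)\<^sup>2 * (fst vv' + fst ww')) (at 0)"
    by (rule DERIV_cong_ev[OF refl 2 refl, THEN iffD2, OF 1])
  note DERIV_unique[OF has_real_derivative_fst[OF E] this]
  also have "2 * ((deriv (deriv a) t * a t - (deriv a t)\<^sup>2) / (a t)\<^sup>2 * fst x') + 2 / (a t)\<^sup>2 * (fst vv' + fst ww')
      = 2 / (a t)\<^sup>2 * ((deriv (deriv a) t * a t - (deriv a t)\<^sup>2) * fst x' + (fst vv' + fst ww'))"
    by (simp add: field_simps)
  finally have fE': "fst E' = 2 / (a t)\<^sup>2 * ((deriv (deriv a) t * a t - (deriv a t)\<^sup>2) * fst x' + (fst vv' + fst ww'))" .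
  have fE0: "fst (E 0) = 2 * h"
    using eventually_nhds_x_imp_x[OF ev]
    by (simp add: E_def fst_jet_trace G_def time h_def t_def)
  define X Y where "X s = flrw_metric a (x s) (E s) (v s)" and "Y s = flrw_metric a (x s) (E s) (w s)" for s
  have XY0: "X 0 = 0" "Y 0 = 0" by (simp_all add: X_def Y_def flrw_metric_def time E0)
  obtain X' where X: "(X has_real_derivative X') (at 0)"
    unfolding X_def[abs_def] using has_real_derivative_flrw_metric[OF x E v] by blast
  obtain Y' where Y: "(Y has_real_derivative Y') (at 0)"
    unfolding Y_def[abs_def] using has_real_derivative_flrw_metric[OF x E w] by blast
  define Q where "Q s = (g22 s * (X s)\<^sup>2 - 2 * g12 s * X s * Y s + g11 s * (Y s)\<^sup>2) / G s" for s
  have Q: "(Q has_real_derivative 0) (at 0)"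
    unfolding Q_def[abs_def]
    by (rule DERIV_cong, (rule DERIV_add DERIV_diff DERIV_mult DERIV_power DERIV_const DERIV_divide g11 g12 g22 X Y G)+)
      (use Gpos in \<open>simp_all add: XY0\<close>)
  \<comment> \<open>As \<open>snd (E 0) = 0\<close>, the spatial part and the variation of
    \<open>a\<close> contribute nothing; the derivative of \<open>- (fst E)^2\<close> with
    \<open>fst (E 0) = 2 h\<close> remains.\<close>
  have EE: "((\<lambda>s. flrw_metric a (x s) (E s) (E s)) has_real_derivative - 4 * h * fst E') (at 0)"
    by (rule DERIV_cong[OF has_real_derivative_flrw_metric[OF x E E]]) (simp add: E0 fE0)
  have J_eq: "jet_curvature_sq a (x s) (v s) (w s) (vv s) (vw s) (wv s) (ww s)
      = flrw_metric a (x s) (E s) (E s) - Q s" for s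
    by (simp add: jet_curvature_sq_def tangential_norm_sq_def E_def Q_def X_def Y_def G_def g11_def g12_def g22_def)
  have J: "((\<lambda>s. (flrw_metric a (x s) (E s) (E s) - Q s) * sqrt (G s)) has_real_derivative
      (- 4 * h * fst E' - 0) * sqrt (G 0) + dA * (flrw_metric a (x 0) (E 0) (E 0) - Q 0)) (at 0)"
    by (intro DERIV_mult DERIV_diff EE Q A)
  have EE0: "flrw_metric a (x 0) (E 0) (E 0) - Q 0 = - 4 * h\<^sup>2"
    by (simp add: Q_def XY0 flrw_metric_def E0 fE0 power2_eq_square)
  show "((\<lambda>s. jet_curvature_sq a (x s) (v s) (w s) (vv s) (vw s) (wv s) (ww s) * sqrt (G s))
      has_real_derivative - 4 * h * ((deriv (deriv a) t * a t - (deriv a t)\<^sup>2) * fst x' + (fst vv' + fst ww'))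
        - 4 * h\<^sup>2 * dA) (at 0)"
    unfolding J_eq by (rule DERIV_cong[OF J]) (simp add: EE0 sqrtG0 fE')
qed

end

section \<open>Product tori\<close>

text \<open>Complex coefficients make this class closed under coordinate derivatives (multiplication
  by the imaginary unit), tangential projection and \<open>christoffel\<close>. All jets of a
  product torus lie in it, and metric products reduce to inner products of coefficients.\<close>

definition torus_map :: "real \<Rightarrow> complex \<Rightarrow> complex \<Rightarrow> surf" where
  "torus_map t P Q = (\<lambda>(u, v). (t, P * cis u, Q * cis v))"

lemma clifford_torus_eq: "clifford_torus t \<alpha> = torus_map t (of_real (cos \<alpha>)) (of_real (sin \<alpha>))"
  by (simp add: clifford_torus_def torus_map_def)

lemma fst_torus_map [simp]: "fst (torus_map t P Q \<theta>) = t"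
  by (simp add: torus_map_def split_beta)

lemma inner_mult_cis: "(P * cis u) \<bullet> (Q * cis u) = P \<bullet> Q"
proof -
  have "(P * cis u) \<bullet> (Q * cis u) = (P \<bullet> Q) * ((cos u)\<^sup>2 + (sin u)\<^sup>2)"
    by (simp add: inner_complex_def power2_eq_square algebra_simps
        del: sin_cos_squared_add sin_cos_squared_add2 sin_cos_squared_add3)
  then show ?thesis by simp
qed

lemma inner_torus_map [simp]:
  "snd (torus_map t P Q \<theta>) \<bullet> snd (torus_map t' P' Q' \<theta>) = P \<bullet> P' + Q \<bullet> Q'"
  by (simp add: torus_map_def split_beta inner_mult_cis)

lemma torus_map_add: "torus_map t P Q \<theta> + torus_map t' P' Q' \<theta> = torus_map (t + t') (P + P') (Q + Q') \<theta>"
  by (simp add: torus_map_def split_beta algebra_simps)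

lemma torus_map_diff: "torus_map t P Q \<theta> - torus_map t' P' Q' \<theta> = torus_map (t - t') (P - P') (Q - Q') \<theta>"
  by (simp add: torus_map_def split_beta algebra_simps)

lemma torus_map_scaleR: "c *\<^sub>R torus_map t P Q \<theta> = torus_map (c * t) (c *\<^sub>R P) (c *\<^sub>R Q) \<theta>"
  by (simp add: torus_map_def split_beta scaleR_conv_of_real)

lemmas torus_map_linear = torus_map_add torus_map_diff torus_map_scaleR

lemma torus_map_of_real:
  "torus_map t (of_real x) (of_real y) \<theta> + torus_map t' (of_real x') (of_real y') \<theta>
    = torus_map (t + t') (of_real (x + x')) (of_real (y + y')) \<theta>"
  "c *\<^sub>R torus_map t (of_real x) (of_real y) \<theta> = torus_map (c * t) (of_real (c * x)) (of_real (c * y)) \<theta>"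
  by (simp_all add: torus_map_linear scaleR_conv_of_real)

lemma tangent_extension_torus_map:
  "tangent_extension (torus_map t' P' Q' \<theta>) (torus_map t P Q \<theta>)
    = torus_map t' (P' - (P' \<bullet> P + Q' \<bullet> Q) *\<^sub>R P) (Q' - (P' \<bullet> P + Q' \<bullet> Q) *\<^sub>R Q) \<theta>"
  unfolding tangent_extension_def inner_torus_map
  by (simp add: torus_map_def split_beta scaleR_conv_of_real algebra_simps)

lemma christoffel_torus_map:
  "christoffel a (torus_map t P Q \<theta>) (torus_map t1 P1 Q1 \<theta>) (torus_map t2 P2 Q2 \<theta>)
    = torus_map (a t * deriv a t * (P1 \<bullet> P2 + Q1 \<bullet> Q2))
        ((deriv a t / a t) *\<^sub>R (t1 *\<^sub>R P2 + t2 *\<^sub>R P1)) ((deriv a t / a t) *\<^sub>R (t1 *\<^sub>R Q2 + t2 *\<^sub>R Q1)) \<theta>"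
  unfolding christoffel_def inner_torus_map
  by (simp add: torus_map_def split_beta scaleR_conv_of_real algebra_simps)

lemma flrw_metric_torus_map [simp]:
  "flrw_metric a (torus_map t P Q \<theta>) (torus_map t1 P1 Q1 \<theta>) (torus_map t2 P2 Q2 \<theta>)
    = (a t)\<^sup>2 * (P1 \<bullet> P2 + Q1 \<bullet> Q2) - t1 * t2"
  by (simp add: flrw_metric_def)

lemma has_derivative_torus_map:
  "(torus_map t P Q has_derivative
      (\<lambda>h. (0, fst h *\<^sub>R (\<i> * P * cis (fst \<theta>)), snd h *\<^sub>R (\<i> * Q * cis (snd \<theta>))))) (at \<theta>)"
proof -
  have c: "((\<lambda>\<theta>. cis (f \<theta>)) has_derivative (\<lambda>h. f' h *\<^sub>R (\<i> * cis (f \<theta>)))) (at \<theta>)"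
    if "(f has_derivative f') (at \<theta>)" for f f' and \<theta> :: "real \<times> real"
    by (rule has_derivative_cis[OF that])
  show ?thesis
    unfolding torus_map_def split_beta
    by (rule has_derivative_eq_rhs, (rule has_derivative_Pair has_derivative_mult_right c has_derivative_const
        has_derivative_fst has_derivative_snd has_derivative_ident)+) (auto simp: fun_eq_iff algebra_simps)
qed

lemma partial_deriv_torus_map:
  "partial_deriv (torus_map t P Q) 1 = torus_map 0 (\<i> * P) 0"
  "partial_deriv (torus_map t P Q) 2 = torus_map 0 0 (\<i> * Q)"
  unfolding partial_deriv_def frechet_derivative_eq[OF has_derivative_torus_map]
  by (simp_all add: coord_dir_def torus_map_def fun_eq_iff)

lemma Ck_on_torus_map [Ck_intros]:
  assumes "open S" "Ck_on k S t" "Ck_on k S P" "Ck_on k S Q" "Ck_on k S \<theta>"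
  shows "Ck_on k S (\<lambda>z. torus_map (t z) (P z) (Q z) (\<theta> z))"
  unfolding torus_map_def split_beta by (intro Ck_intros assms)

lemma periodic_torus_map: "periodic (torus_map t P Q)" "doubly_periodic (torus_map t P Q)"
  by (simp_all add: periodic_def doubly_periodic_def torus_map_def cis_mult[symmetric] flip: cis_mult)

lemma torus_map_in_spacetime:
  "p\<^sup>2 + q\<^sup>2 = 1 \<Longrightarrow> torus_map t (of_real p) (of_real q) \<theta> \<in> spacetime"
  by (simp add: spacetime_def torus_map_def split_beta norm_Pair norm_mult)

lemma inner_of_real_complex:
  "complex_of_real x \<bullet> of_real y = x * y" "(\<i> * complex_of_real x) \<bullet> (\<i> * of_real y) = x * y"
  "(\<i> * complex_of_real x) \<bullet> of_real y = 0" "complex_of_real x \<bullet> (\<i> * of_real y) = 0"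
  by (simp_all add: inner_complex_def)

lemma gram_torus_map:
  "gram a (torus_map t P Q \<theta>) (torus_map 0 (\<i> * of_real p) 0 \<theta>) (torus_map 0 0 (\<i> * of_real q) \<theta>)
    = ((a t)\<^sup>2 * (p * q))\<^sup>2"
  by (simp add: gram_def inner_of_real_complex power2_eq_square)

context flrw begin

text \<open>The spatial part carries the factor \<open>p^2 - q^2\<close>. Its vanishing for
  \<open>p = q\<close> is the minimality of the torus in the slice, and provides the hypothesis
  \<open>E0\<close> of \<open>density_derivatives\<close>.\<close>

lemma jet_trace_torus_map:
  assumes pq: "p\<^sup>2 + q\<^sup>2 = 1" "p \<noteq> 0" "q \<noteq> 0"
  shows "jet_trace a (torus_map t (of_real p) (of_real q) \<theta>) (torus_map 0 (\<i> * of_real p) 0 \<theta>)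
      (torus_map 0 0 (\<i> * of_real q) \<theta>) (torus_map 0 (\<i> * (\<i> * of_real p)) 0 \<theta>) (torus_map 0 0 0 \<theta>)
      (torus_map 0 0 0 \<theta>) (torus_map 0 0 (\<i> * (\<i> * of_real q)) \<theta>)
    = torus_map (2 * (deriv a t / a t)) (of_real ((p\<^sup>2 - q\<^sup>2) / ((a t)\<^sup>2 * p)))
        (of_real ((q\<^sup>2 - p\<^sup>2) / ((a t)\<^sup>2 * q))) \<theta>"
proof -
  define A where "A = a t"
  have A: "A \<noteq> 0" by (simp add: A_def)
  \<comment> \<open>Proved for all \<open>p\<close> and \<open>q\<close>, because it is used a
    second time with the two exchanged. The constraint enters as
    \<open>p^3 - p = - p q^2\<close>.\<close>
  have *: "((A\<^sup>2 * q\<^sup>2) * (p ^ 3 - p) + (A\<^sup>2 * p\<^sup>2) * (q\<^sup>2 * p)) / (A\<^sup>2 * (p * q))\<^sup>2 = (p\<^sup>2 - q\<^sup>2) / (A\<^sup>2 * p)"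
    if "p\<^sup>2 + q\<^sup>2 = 1" "p \<noteq> 0" "q \<noteq> 0" for p q
  proof -
    have "p * (p\<^sup>2 + q\<^sup>2) = p" using that by simp
    then have "p ^ 3 - p = - (p * q\<^sup>2)" by (simp add: power2_eq_square power3_eq_cube algebra_simps)
    then have "(A\<^sup>2 * q\<^sup>2) * (p ^ 3 - p) + (A\<^sup>2 * p\<^sup>2) * (q\<^sup>2 * p) = A\<^sup>2 * p * q\<^sup>2 * (p\<^sup>2 - q\<^sup>2)"
      by (simp only:) (simp add: power2_eq_square algebra_simps)
    then show ?thesis using A that(2,3) by (simp only:) (simp add: power2_eq_square)
  qed
  note 1 = *[OF pq]
  have 2: "((A\<^sup>2 * p\<^sup>2) * (q ^ 3 - q) + (A\<^sup>2 * q\<^sup>2) * (p\<^sup>2 * q)) / (A\<^sup>2 * (p * q))\<^sup>2 = (q\<^sup>2 - p\<^sup>2) / (A\<^sup>2 * q)"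
    using *[of q p] pq by (simp only: mult.commute[of q p] add.commute[of "q\<^sup>2" "p\<^sup>2"] simp_thms)
  have 3: "((A\<^sup>2 * q\<^sup>2) * (A * deriv a t * p\<^sup>2) + (A\<^sup>2 * p\<^sup>2) * (A * deriv a t * q\<^sup>2)) / (A\<^sup>2 * (p * q))\<^sup>2 = 2 * (deriv a t / A)"
    using A pq by (simp add: power2_eq_square field_simps)
  let ?x = "torus_map t (of_real p) (of_real q) \<theta>"
  let ?v = "torus_map 0 (\<i> * of_real p) 0 \<theta>" and ?w = "torus_map 0 0 (\<i> * of_real q) \<theta>"
  have ii: "\<i> * (\<i> * of_real r) = of_real (- r)" for r by simp
  have C11: "jet_hessian a ?x ?v ?v (torus_map 0 (\<i> * (\<i> * of_real p)) 0 \<theta>)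
      = torus_map (A * deriv a t * p\<^sup>2) (of_real (p ^ 3 - p)) (of_real (p\<^sup>2 * q)) \<theta>"
    unfolding jet_hessian_def tangent_extension_torus_map christoffel_torus_map torus_map_add ii A_def
    by (simp add: inner_of_real_complex scaleR_conv_of_real power2_eq_square power3_eq_cube)
  have C22: "jet_hessian a ?x ?w ?w (torus_map 0 0 (\<i> * (\<i> * of_real q)) \<theta>)
      = torus_map (A * deriv a t * q\<^sup>2) (of_real (q\<^sup>2 * p)) (of_real (q ^ 3 - q)) \<theta>"
    unfolding jet_hessian_def tangent_extension_torus_map christoffel_torus_map torus_map_add ii A_def
    by (simp add: inner_of_real_complex scaleR_conv_of_real power2_eq_square power3_eq_cube)
  have g: "flrw_metric a ?x ?v ?v = A\<^sup>2 * p\<^sup>2" "flrw_metric a ?x ?w ?w = A\<^sup>2 * q\<^sup>2" "flrw_metric a ?x ?v ?w = 0"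
    by (simp_all add: inner_of_real_complex A_def power2_eq_square)
  show ?thesis
    unfolding jet_trace_def C11 C22 g gram_torus_map A_def[symmetric] 1[symmetric] 2[symmetric] 3[symmetric]
    by (simp only: scaleR_zero_left diff_0_right torus_map_of_real divide_inverse mult.commute[of _ "inverse _"]
        add.commute[of "A\<^sup>2 * p\<^sup>2 * (q ^ 3 - q)"])
qed

text \<open>The trace has real coefficients and the coordinate vectors imaginary ones, so its
  tangential part is zero. The spatial term becomes a function of \<open>p q\<close> through
  \<open>(p^2 - q^2)^2 = 1 - 4 (p q)^2\<close>.\<close>

lemma jet_curvature_sq_torus_map:
  assumes pq: "p\<^sup>2 + q\<^sup>2 = 1" "p \<noteq> 0" "q \<noteq> 0"
  shows "jet_curvature_sq a (torus_map t (of_real p) (of_real q) \<theta>) (torus_map 0 (\<i> * of_real p) 0 \<theta>)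
      (torus_map 0 0 (\<i> * of_real q) \<theta>) (torus_map 0 (\<i> * (\<i> * of_real p)) 0 \<theta>) (torus_map 0 0 0 \<theta>)
      (torus_map 0 0 0 \<theta>) (torus_map 0 0 (\<i> * (\<i> * of_real q)) \<theta>)
    = (1 / (p * q)\<^sup>2 - 4) / (a t)\<^sup>2 - 4 * (deriv a t / a t)\<^sup>2"
proof -
  have "(a t)\<^sup>2 * ((p\<^sup>2 - q\<^sup>2) / ((a t)\<^sup>2 * p) * ((p\<^sup>2 - q\<^sup>2) / ((a t)\<^sup>2 * p))
      + (q\<^sup>2 - p\<^sup>2) / ((a t)\<^sup>2 * q) * ((q\<^sup>2 - p\<^sup>2) / ((a t)\<^sup>2 * q)))
    = ((p\<^sup>2 - q\<^sup>2)\<^sup>2 * (p\<^sup>2 + q\<^sup>2) / (p * q)\<^sup>2) / (a t)\<^sup>2"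
    using pq(2,3) by (simp add: power2_eq_square field_simps)
  also have "(p\<^sup>2 - q\<^sup>2)\<^sup>2 * (p\<^sup>2 + q\<^sup>2) = (p\<^sup>2 + q\<^sup>2)\<^sup>2 * (p\<^sup>2 + q\<^sup>2) - 4 * (p * q)\<^sup>2 * (p\<^sup>2 + q\<^sup>2)"
    by (simp add: power2_eq_square algebra_simps)
  also have "\<dots> = 1 - 4 * (p * q)\<^sup>2" by (simp add: pq)
  also have "(1 - 4 * (p * q)\<^sup>2) / (p * q)\<^sup>2 = 1 / (p * q)\<^sup>2 - 4"
    using pq(2,3) by (simp add: field_simps)
  finally show ?thesis
    unfolding jet_curvature_sq_def jet_trace_torus_map[OF pq] tangential_norm_sq_def
    by (simp add: inner_of_real_complex power2_eq_square del: of_real_divide of_real_mult of_real_diff of_real_power)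
qed

lemma mean_curvature_sq_torus_map:
  assumes pq: "p\<^sup>2 + q\<^sup>2 = 1" "p \<noteq> 0" "q \<noteq> 0"
  shows "mean_curvature_sq a (torus_map t (of_real p) (of_real q)) \<theta>
    = (1 / (p * q)\<^sup>2 - 4) / (a t)\<^sup>2 - 4 * (deriv a t / a t)\<^sup>2"
proof -
  have "range (torus_map t (of_real p) (of_real q)) \<subseteq> spacetime"
    using torus_map_in_spacetime[OF pq(1)] by blast
  moreover have "torus_map t (of_real p) (of_real q) differentiable at \<theta>"
    using has_derivative_torus_map by (rule differentiableI)
  ultimately show ?thesis
    using pq by (subst mean_curvature_sq_eq)
      (simp_all only: partial_deriv_torus_map mult_zero_right jet_curvature_sq_torus_map[OF pq],
        simp add: gram_torus_map)
qed

lemma det_induced_metric_torus_map: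
  "det (induced_metric a (torus_map t (of_real p) (of_real q)) \<theta>) = ((a t)\<^sup>2 * (p * q))\<^sup>2"
  by (simp add: det_induced_metric partial_deriv_torus_map gram_torus_map)

lemma area_torus_map:
  assumes "0 < p" "0 < q"
  shows "area a (torus_map t (of_real p) (of_real q)) = 4 * pi\<^sup>2 * ((a t)\<^sup>2 * (p * q))"
  using assms
  by (simp add: area_def surface_integral_def det_induced_metric_torus_map real_sqrt_abs abs_mult
      content_Pair power2_eq_square)

lemma willmore_energy_torus_map:
  assumes pq: "p\<^sup>2 + q\<^sup>2 = 1" "0 < p" "0 < q"
  shows "willmore_energy a (torus_map t (of_real p) (of_real q))
    = ((1 / (p * q)\<^sup>2 - 4) / (a t)\<^sup>2 - 4 * (deriv a t / a t)\<^sup>2) * area a (torus_map t (of_real p) (of_real q))"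
  using pq
  by (simp add: willmore_energy_def area_def surface_integral_def mean_curvature_sq_torus_map)

end

section \<open>First variation at the minimal Clifford torus\<close>

lemma frechet_derivative_inner_snd:
  fixes f g :: surf
  assumes "f differentiable at \<theta>" "g differentiable at \<theta>"
  shows "frechet_derivative (\<lambda>\<theta>. snd (f \<theta>) \<bullet> snd (g \<theta>)) (at \<theta>) (coord_dir i)
    = snd (f \<theta>) \<bullet> snd (partial_deriv g i \<theta>) + snd (partial_deriv f i \<theta>) \<bullet> snd (g \<theta>)"
proof -
  have "((\<lambda>\<theta>. snd (f \<theta>) \<bullet> snd (g \<theta>)) has_derivative
      (\<lambda>h. snd (f \<theta>) \<bullet> snd (frechet_derivative g (at \<theta>) h) + snd (frechet_derivative f (at \<theta>) h) \<bullet> snd (g \<theta>))) (at \<theta>)"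
    using assms frechet_derivative_works by (intro has_derivative_inner has_derivative_snd) blast+
  then show ?thesis by (simp add: frechet_derivative_eq partial_deriv_def)
qed

context torus_family begin

lemma zero_mem [simp]: "0 \<in> {-\<epsilon><..<\<epsilon>}"
  using eps by simp

lemma Ck_on_slice_family:
  assumes "s \<in> {-\<epsilon><..<\<epsilon>}"
  shows "Ck_on k UNIV (\<lambda>\<theta>. \<Psi> (s, \<theta>))" "Ck_on k UNIV (\<lambda>\<theta>. D1 i (s, \<theta>))"
proof -
  note * = Ck_on_slice[OF open_greaterThanLessThan _ assms]
  show "Ck_on k UNIV (\<lambda>\<theta>. \<Psi> (s, \<theta>))" by (rule *[OF Ck_on_family(1)[unfolded slab_def]])
  show "Ck_on k UNIV (\<lambda>\<theta>. D1 i (s, \<theta>))" by (rule *[OF Ck_on_family(2)[unfolded slab_def]])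
qed

lemma differentiable_slice_family:
  assumes "s \<in> {-\<epsilon><..<\<epsilon>}"
  shows "(\<lambda>\<theta>. \<Psi> (s, \<theta>)) differentiable at \<theta>" "(\<lambda>\<theta>. D1 i (s, \<theta>)) differentiable at \<theta>"
proof -
  note * = Ck_on_Suc_has_derivative[of 0, OF _ UNIV_I, THEN differentiableI]
  show "(\<lambda>\<theta>. \<Psi> (s, \<theta>)) differentiable at \<theta>" by (rule *[OF Ck_on_slice_family(1)[OF assms]])
  show "(\<lambda>\<theta>. D1 i (s, \<theta>)) differentiable at \<theta>" by (rule *[OF Ck_on_slice_family(2)[OF assms]])
qed

lemma integral_time_laplacian:
  assumes s: "s \<in> {-\<epsilon><..<\<epsilon>}"
  shows "integral torus_domain (\<lambda>\<theta>. fst (D2 i i (s, \<theta>))) = 0"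
proof -
  have C: "Ck_on k UNIV (\<lambda>\<theta>. fst (D1 i (s, \<theta>)))" for k
    by (intro Ck_intros open_UNIV Ck_on_slice_family s)
  have "doubly_periodic (\<lambda>\<theta>. partial_deriv (\<lambda>\<theta>. \<Psi> (s, \<theta>)) i \<theta>)"
    unfolding partial_deriv_def
    by (intro doubly_periodic_frechet_derivative periodic_family differentiable_slice_family s)
  then have per: "doubly_periodic (\<lambda>\<theta>. fst (D1 i (s, \<theta>)))"
    by (simp add: partial_deriv_family[OF s] doubly_periodic_def)
  have "frechet_derivative (\<lambda>\<theta>. fst (D1 i (s, \<theta>))) (at \<theta>) (coord_dir i) = fst (D2 i i (s, \<theta>))" for \<theta>
  proof -
    have "((\<lambda>\<theta>. fst (D1 i (s, \<theta>))) has_derivative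
        (\<lambda>h. fst (frechet_derivative (\<lambda>\<theta>. D1 i (s, \<theta>)) (at \<theta>) h))) (at \<theta>)"
      using differentiable_slice_family(2)[OF s] frechet_derivative_works by (intro has_derivative_fst) blast
    then show ?thesis
      using fun_cong[OF partial_deriv_family(2)[OF s, of i i], of \<theta>]
      by (simp add: frechet_derivative_eq partial_deriv_def)
  qed
  then show ?thesis
    using integral_partial_derivative_zero[OF C per, of i] by simp
qed

text \<open>Since \<open>\<partial>\<^sub>1\<^sup>2 + \<partial>\<^sub>2\<^sup>2\<close> acts as \<open>- 1\<close> on the coordinates \<open>Z\<close> of the torus, this is the
  divergence \<open>\<partial>\<^sub>1 \<langle>\<partial>\<^sub>1 Z, \<Psi>\<rangle> + \<partial>\<^sub>2 \<langle>\<partial>\<^sub>2 Z, \<Psi>\<rangle>\<close>.\<close>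

definition torus_divergence :: "real \<Rightarrow> real \<times> real \<times> real \<Rightarrow> real" where
  "torus_divergence r z =
     snd (torus_map 0 (\<i> * of_real r) 0 (snd z)) \<bullet> snd (D1 1 z)
     + snd (torus_map 0 0 (\<i> * of_real r) (snd z)) \<bullet> snd (D1 2 z)
     - snd (torus_map 0 (of_real r) (of_real r) (snd z)) \<bullet> snd (\<Psi> z)"

lemma Ck_on_torus_divergence: "Ck_on k slab (torus_divergence r)"
  unfolding torus_divergence_def[abs_def]
  by (intro Ck_intros Ck_on_family open_slab)

lemma integral_torus_divergence:
  assumes s: "s \<in> {-\<epsilon><..<\<epsilon>}"
  shows "integral torus_domain (\<lambda>\<theta>. torus_divergence r (s, \<theta>)) = 0"
proof -
  define k1 k2 where "k1 \<theta> = snd (torus_map 0 (\<i> * of_real r) 0 \<theta>) \<bullet> snd (\<Psi> (s, \<theta>))"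
    and "k2 \<theta> = snd (torus_map 0 0 (\<i> * of_real r) \<theta>) \<bullet> snd (\<Psi> (s, \<theta>))" for \<theta>
  have C: "Ck_on k UNIV k1" "Ck_on k UNIV k2" for k
    unfolding k1_def[abs_def] k2_def[abs_def] by (intro Ck_intros open_UNIV Ck_on_slice_family s)+
  have per: "doubly_periodic k1" "doubly_periodic k2"
    using periodic_family[OF s] periodic_torus_map(2)
    unfolding doubly_periodic_def k1_def k2_def by simp_all
  note d = differentiable_slice_family(1)[OF s]
  have "torus_divergence r (s, \<theta>) = frechet_derivative k1 (at \<theta>) (coord_dir 1)
      + frechet_derivative k2 (at \<theta>) (coord_dir 2)" for \<theta>
  proof -
    have "snd (torus_map 0 (\<i> * (\<i> * of_real r)) 0 \<theta>) + snd (torus_map 0 0 (\<i> * (\<i> * of_real r)) \<theta>)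
        = - snd (torus_map 0 (of_real r) (of_real r) \<theta>)"
      by (simp add: torus_map_def split_beta)
    then have "snd (torus_map 0 (\<i> * (\<i> * of_real r)) 0 \<theta>) \<bullet> y + snd (torus_map 0 0 (\<i> * (\<i> * of_real r)) \<theta>) \<bullet> y
        = - (snd (torus_map 0 (of_real r) (of_real r) \<theta>) \<bullet> y)" for y
      unfolding inner_add_left[symmetric] by simp
    from this[of "snd (\<Psi> (s, \<theta>))"] show ?thesis
      unfolding k1_def[abs_def] k2_def[abs_def] torus_divergence_def
        frechet_derivative_inner_snd[OF differentiableI[OF has_derivative_torus_map] d]
        partial_deriv_family[OF s] partial_deriv_torus_map
      by (simp add: algebra_simps)
  qed
  moreover have "continuous_on torus_domain (\<lambda>\<theta>. frechet_derivative k (at \<theta>) v)"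
    if "Ck_on (Suc 0) UNIV k" for k :: "real \<times> real \<Rightarrow> real" and v
    by (rule continuous_on_subset[OF Ck_on_imp_continuous_on[OF Ck_on_frechet_derivative[OF that]] subset_UNIV])
  ultimately show ?thesis
    by (simp add: integral_add integrable_continuous C integral_partial_derivative_zero[OF C(1) per(1)]
        integral_partial_derivative_zero[OF C(2) per(2)] del: Ck_on.simps)
qed

context
  fixes t0 r :: real
  assumes start: "\<And>\<theta>. \<Psi> (0, \<theta>) = torus_map t0 (of_real r) (of_real r) \<theta>"
    and r: "0 < r" "r\<^sup>2 = 1 / 2"
begin

lemma initial_jet:
  "D1 1 (0, \<theta>) = torus_map 0 (\<i> * of_real r) 0 \<theta>" "D1 2 (0, \<theta>) = torus_map 0 0 (\<i> * of_real r) \<theta>"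
  "D2 1 1 (0, \<theta>) = torus_map 0 (\<i> * (\<i> * of_real r)) 0 \<theta>" "D2 1 2 (0, \<theta>) = torus_map 0 0 0 \<theta>"
  "D2 2 1 (0, \<theta>) = torus_map 0 0 0 \<theta>" "D2 2 2 (0, \<theta>) = torus_map 0 0 (\<i> * (\<i> * of_real r)) \<theta>"
proof -
  have 0: "(\<lambda>\<theta>. \<Psi> (0, \<theta>)) = torus_map t0 (of_real r) (of_real r)" using start by blast
  have 1: "(\<lambda>\<theta>. D1 1 (0, \<theta>)) = torus_map 0 (\<i> * of_real r) 0"
    "(\<lambda>\<theta>. D1 2 (0, \<theta>)) = torus_map 0 0 (\<i> * of_real r)"
    using partial_deriv_family(1)[OF zero_mem, unfolded 0 partial_deriv_torus_map]
    by (metis partial_deriv_torus_map)+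
  from fun_cong[OF 1(1)] fun_cong[OF 1(2)]
  show "D1 1 (0, \<theta>) = torus_map 0 (\<i> * of_real r) 0 \<theta>" "D1 2 (0, \<theta>) = torus_map 0 0 (\<i> * of_real r) \<theta>"
    by auto
  note 2 = fun_cong[OF partial_deriv_family(2)[OF zero_mem], of _ _ \<theta>]
  show "D2 1 1 (0, \<theta>) = torus_map 0 (\<i> * (\<i> * of_real r)) 0 \<theta>" "D2 1 2 (0, \<theta>) = torus_map 0 0 0 \<theta>"
    "D2 2 1 (0, \<theta>) = torus_map 0 0 0 \<theta>" "D2 2 2 (0, \<theta>) = torus_map 0 0 (\<i> * (\<i> * of_real r)) \<theta>"
    unfolding 2[symmetric] 1 partial_deriv_torus_map by simp_all
qed

lemma initial_nondegenerate: "{0} \<times> torus_domain \<subseteq> nondegenerate"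
  using r eps by (auto simp: nondegenerate_def slab_iff start initial_jet gram_torus_map)

abbreviation "multiplier \<equiv> - 4 * deriv (deriv a) t0 / a t0"
abbreviation "hubble \<equiv> deriv a t0 / a t0"

text \<open>The Willmore density minus \<open>multiplier\<close> times the area density, corrected by
  divergences such that its derivative vanishes pointwise at time \<open>0\<close>.\<close>

definition reduced_density :: "real \<times> real \<times> real \<Rightarrow> real" where
  "reduced_density z = willmore_density z - multiplier * area_density z
     + 4 * hubble * (fst (D2 1 1 z) + fst (D2 2 2 z))
     + (4 * hubble\<^sup>2 + multiplier) * (a t0)\<^sup>2 * torus_divergence r z"

lemma Ck_on_reduced_density: "Ck_on k nondegenerate reduced_density"
proof -
  have "nondegenerate \<subseteq> slab" by (auto simp: nondegenerate_def)
  then have "Ck_on k nondegenerate (torus_divergence r)"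
    by (rule Ck_on_subset[OF Ck_on_torus_divergence])
  then show ?thesis
    unfolding reduced_density_def[abs_def]
    by (intro Ck_intros Ck_on_densities Ck_on_nondegenerate open_nondegenerate)
qed

lemma reduced_density_derivative:
  "frechet_derivative reduced_density (at (0, \<theta>)) (1, 0) = 0" if "\<theta> \<in> torus_domain"
proof -
  have z: "(0, \<theta>) \<in> nondegenerate" using initial_nondegenerate that by blast
  have zs: "(0, \<theta>) \<in> slab" by (simp add: slab_iff eps)
  have slice: "((\<lambda>s. f (s, \<theta>)) has_vector_derivative frechet_derivative f (at (0, \<theta>)) (1, 0)) (at 0)"
    if "Ck_on (Suc 0) nondegenerate f" for f :: "real \<times> real \<times> real \<Rightarrow> 'c::real_normed_vector"
    by (rule has_derivative_slice(1)[OF Ck_on_Suc_has_derivative[OF that z]])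
  let ?E = "\<lambda>z. jet_trace a (\<Psi> z) (D1 1 z) (D1 2 z) (D2 1 1 z) (D2 1 2 z) (D2 2 1 z) (D2 2 2 z)"
  have "Ck_on (Suc 0) nondegenerate ?E"
    by (intro Ck_intros Ck_on_nondegenerate open_nondegenerate) (auto simp: nondegenerate_def)
  note E = slice[OF this]
  let ?d = "\<lambda>f. frechet_derivative f (at (0, \<theta>)) (1, 0)"
  let ?S = "snd (D1 1 (0, \<theta>)) \<bullet> snd (?d (D1 1)) + snd (D1 2 (0, \<theta>)) \<bullet> snd (?d (D1 2))"
  define dA where "dA = a t0 * deriv a t0 * fst (?d \<Psi>) + (a t0)\<^sup>2 * ?S"
  have t0: "fst (\<Psi> (0, \<theta>)) = t0" by (simp add: start)
  have rr: "r * r = 1 / 2" using r by (simp add: power2_eq_square)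
  note D = density_derivatives[OF slice[OF Ck_on_nondegenerate(1)] slice[OF Ck_on_nondegenerate(2)]
      slice[OF Ck_on_nondegenerate(2)] slice[OF Ck_on_nondegenerate(3)] slice[OF Ck_on_nondegenerate(3)]
      slice[OF Ck_on_nondegenerate(3)] slice[OF Ck_on_nondegenerate(3)] E, unfolded t0, folded dA_def]
  have D': "((\<lambda>s. area_density (s, \<theta>)) has_real_derivative dA) (at 0)"
    "((\<lambda>s. willmore_density (s, \<theta>)) has_real_derivative
      - 4 * hubble * ((deriv (deriv a) t0 * a t0 - (deriv a t0)\<^sup>2) * fst (?d \<Psi>) + (fst (?d (D2 1 1)) + fst (?d (D2 2 2))))
        - 4 * hubble\<^sup>2 * dA) (at 0)"
  proof -
    have time: "fst (D1 1 (0, \<theta>)) = 0" "fst (D1 2 (0, \<theta>)) = 0" "fst (D2 1 1 (0, \<theta>)) = 0"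
      "fst (D2 1 2 (0, \<theta>)) = 0" "fst (D2 2 1 (0, \<theta>)) = 0" "fst (D2 2 2 (0, \<theta>)) = 0"
      by (simp_all only: initial_jet fst_torus_map)
    have orth: "snd (D1 1 (0, \<theta>)) \<bullet> snd (D1 1 (0, \<theta>)) = 1 / 2" "snd (D1 2 (0, \<theta>)) \<bullet> snd (D1 2 (0, \<theta>)) = 1 / 2"
      "snd (D1 1 (0, \<theta>)) \<bullet> snd (D1 2 (0, \<theta>)) = 0"
      by (simp_all add: initial_jet inner_of_real_complex rr)
    have pq: "r\<^sup>2 + r\<^sup>2 = 1" "r \<noteq> 0" using r by simp_all
    have E0: "snd (?E (0, \<theta>)) = 0"
      unfolding start initial_jet jet_trace_torus_map[OF pq pq(2)]
      by (simp add: torus_map_def split_beta zero_prod_def)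
    show "((\<lambda>s. area_density (s, \<theta>)) has_real_derivative dA) (at 0)"
      unfolding area_density_def by (rule D(1)[OF time orth E0])
    show "((\<lambda>s. willmore_density (s, \<theta>)) has_real_derivative
      - 4 * hubble * ((deriv (deriv a) t0 * a t0 - (deriv a t0)\<^sup>2) * fst (?d \<Psi>) + (fst (?d (D2 1 1)) + fst (?d (D2 2 2))))
        - 4 * hubble\<^sup>2 * dA) (at 0)"
      unfolding willmore_density_def area_density_def by (rule D(2)[OF time orth E0])
  qed
  \<comment> \<open>Differentiating the unit length in \<open>s\<close> shows that the velocity is
    tangent to the sphere. This kills the undifferentiated term of \<open>torus_divergence\<close>,
    which pairs the velocity with the position.\<close>
  have "((\<lambda>s. snd (\<Psi> (s, \<theta>)) \<bullet> snd (\<Psi> (s, \<theta>))) has_real_derivative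
      snd (\<Psi> (0, \<theta>)) \<bullet> snd (?d \<Psi>) + snd (?d \<Psi>) \<bullet> snd (\<Psi> (0, \<theta>))) (at 0)"
    by (intro has_real_derivative_inner has_vector_derivative_snd slice Ck_on_nondegenerate)
  moreover have "((\<lambda>s. snd (\<Psi> (s, \<theta>)) \<bullet> snd (\<Psi> (s, \<theta>))) has_real_derivative 0) (at 0)"
  proof (rule has_field_derivative_transform_within_open[of "\<lambda>_. 1"])
    show "1 = snd (\<Psi> (s, \<theta>)) \<bullet> snd (\<Psi> (s, \<theta>))" if "s \<in> {-\<epsilon><..<\<epsilon>}" for s
      using spacetime_inner_self[OF spacetime_family[OF that]] by simp
  qed (use eps in auto)
  ultimately have tang: "snd (\<Psi> (0, \<theta>)) \<bullet> snd (?d \<Psi>) = 0"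
    using DERIV_unique by (fastforce simp: inner_commute)
  have "((\<lambda>s. torus_divergence r (s, \<theta>)) has_real_derivative
      (snd (torus_map 0 (\<i> * of_real r) 0 \<theta>) \<bullet> snd (?d (D1 1)) + 0 \<bullet> snd (D1 1 (0, \<theta>)))
      + (snd (torus_map 0 0 (\<i> * of_real r) \<theta>) \<bullet> snd (?d (D1 2)) + 0 \<bullet> snd (D1 2 (0, \<theta>)))
      - (snd (torus_map 0 (of_real r) (of_real r) \<theta>) \<bullet> snd (?d \<Psi>) + 0 \<bullet> snd (\<Psi> (0, \<theta>)))) (at 0)"
    unfolding torus_divergence_def snd_conv
    by (intro DERIV_diff DERIV_add has_real_derivative_inner has_vector_derivative_const
        has_vector_derivative_snd slice Ck_on_nondegenerate)
  moreover have "snd (torus_map 0 (of_real r) (of_real r) \<theta>) = snd (\<Psi> (0, \<theta>))"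
    by (simp add: start torus_map_def split_beta)
  ultimately have div: "((\<lambda>s. torus_divergence r (s, \<theta>)) has_real_derivative ?S) (at 0)"
    by (simp add: tang initial_jet)
  have "((\<lambda>s. reduced_density (s, \<theta>)) has_real_derivative
      (- 4 * hubble * ((deriv (deriv a) t0 * a t0 - (deriv a t0)\<^sup>2) * fst (?d \<Psi>) + (fst (?d (D2 1 1)) + fst (?d (D2 2 2))))
        - 4 * hubble\<^sup>2 * dA) - multiplier * dA + 4 * hubble * (fst (?d (D2 1 1)) + fst (?d (D2 2 2)))
      + (4 * hubble\<^sup>2 + multiplier) * (a t0)\<^sup>2 * ?S) (at 0)"
    unfolding reduced_density_def
    by (intro DERIV_add DERIV_diff DERIV_cmult D' div has_real_derivative_fst slice Ck_on_nondegenerate)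
  \<comment> \<open>The second derivatives cancel, and the divergence cancels the spatial part of
    \<open>dA\<close>. The remaining coefficient of the time velocity,
    \<open>- 4 h (a a'' - a'^2) - (4 h^2 + multiplier) a a'\<close>, is zero precisely for this
    value of \<open>multiplier\<close> when \<open>a'\<close> is nonzero, and is zero anyway when
    \<open>a' = 0\<close>.\<close>
  then have "((\<lambda>s. reduced_density (s, \<theta>)) has_real_derivative 0) (at 0)"
    by (rule DERIV_cong) (simp add: dA_def power2_eq_square field_simps)
  moreover have "((\<lambda>s. reduced_density (s, \<theta>)) has_real_derivative ?d reduced_density) (at 0)"
    using slice[OF Ck_on_reduced_density] by (simp add: has_real_derivative_iff_has_vector_derivative)
  ultimately show ?thesis by (metis DERIV_unique)
qed

lemma first_variation:
  obtains A' where "((\<lambda>s. area a (\<lambda>\<theta>. \<Psi> (s, \<theta>))) has_real_derivative A') (at 0)"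
    and "((\<lambda>s. willmore_energy a (\<lambda>\<theta>. \<Psi> (s, \<theta>))) has_real_derivative multiplier * A') (at 0)"
proof
  let ?A' = "integral torus_domain (\<lambda>\<theta>. frechet_derivative area_density (at (0, \<theta>)) (1, 0))"
  note integral' = has_derivative_integral_parameter[OF open_nondegenerate _ initial_nondegenerate]
  obtain e where e: "0 < e" "ball 0 e \<times> torus_domain \<subseteq> nondegenerate"
    using eventually_slice_subset[OF open_nondegenerate initial_nondegenerate compact_cbox] by blast
  have sub: "{s} \<times> torus_domain \<subseteq> nondegenerate" and s: "s \<in> {-\<epsilon><..<\<epsilon>}" if "s \<in> ball 0 e" for s
  proof -
    show "{s} \<times> torus_domain \<subseteq> nondegenerate" using that e(2) by blast
    then have "(s, 0, 0) \<in> nondegenerate" by auto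
    then show "s \<in> {-\<epsilon><..<\<epsilon>}" by (simp add: nondegenerate_def slab_iff)
  qed
  show A': "((\<lambda>s. area a (\<lambda>\<theta>. \<Psi> (s, \<theta>))) has_real_derivative ?A') (at 0)"
    by (rule has_field_derivative_transform_within_open[OF integral'[OF Ck_on_densities(1)] open_ball[of 0 e]])
      (use e in \<open>simp_all only: centre_in_ball area_family s\<close>)
  have "integral torus_domain (\<lambda>\<theta>. frechet_derivative reduced_density (at (0, \<theta>)) (1, 0)) = 0"
    using integral_cong[of torus_domain _ "\<lambda>_. 0", OF reduced_density_derivative] by simp
  with integral'[OF Ck_on_reduced_density]
  have R: "((\<lambda>s. integral torus_domain (\<lambda>\<theta>. reduced_density (s, \<theta>))) has_real_derivative 0) (at 0)"
    by simp
  \<comment> \<open>The identity holds on a whole neighbourhood of 0 and can therefore be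
    differentiated.\<close>
  have W: "willmore_energy a (\<lambda>\<theta>. \<Psi> (s, \<theta>))
      = integral torus_domain (\<lambda>\<theta>. reduced_density (s, \<theta>)) + multiplier * area a (\<lambda>\<theta>. \<Psi> (s, \<theta>))"
    if "s \<in> ball 0 e" for s
  proof -
    note s' = s[OF that]
    have int: "(\<lambda>\<theta>. f (s, \<theta>)) integrable_on torus_domain" if "Ck_on 0 nondegenerate f" for f :: "_ \<Rightarrow> real"
      by (rule integrable_continuous, rule continuous_on_compose2[OF Ck_on_imp_continuous_on[OF that]])
        (use sub[OF \<open>s \<in> ball 0 e\<close>] in \<open>auto intro!: continuous_intros\<close>)
    have nd: "nondegenerate \<subseteq> slab" by (auto simp: nondegenerate_def)
    have i1: "(\<lambda>\<theta>. fst (D2 i i (s, \<theta>))) integrable_on torus_domain" for i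
      by (rule int) (intro Ck_intros Ck_on_nondegenerate open_nondegenerate)
    note i = int[OF Ck_on_densities(1)] int[OF Ck_on_densities(2)] i1
      int[OF Ck_on_subset[OF Ck_on_torus_divergence nd]]
    have "integral torus_domain (\<lambda>\<theta>. reduced_density (s, \<theta>))
        = integral torus_domain (\<lambda>\<theta>. willmore_density (s, \<theta>)) - multiplier * integral torus_domain (\<lambda>\<theta>. area_density (s, \<theta>))
          + 4 * hubble * (integral torus_domain (\<lambda>\<theta>. fst (D2 1 1 (s, \<theta>))) + integral torus_domain (\<lambda>\<theta>. fst (D2 2 2 (s, \<theta>))))
          + (4 * hubble\<^sup>2 + multiplier) * (a t0)\<^sup>2 * integral torus_domain (\<lambda>\<theta>. torus_divergence r (s, \<theta>))"
      unfolding reduced_density_def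
      by (simp only: integral_add integral_diff integral_mult_right i integrable_add integrable_diff
          integrable_on_mult_right)
    then show ?thesis
      by (simp add: integral_time_laplacian[OF s'] integral_torus_divergence[OF s']
          willmore_energy_family[OF sub[OF that]] area_family[OF s'])
  qed
  have "((\<lambda>s. integral torus_domain (\<lambda>\<theta>. reduced_density (s, \<theta>)) + multiplier * area a (\<lambda>\<theta>. \<Psi> (s, \<theta>)))
      has_real_derivative 0 + multiplier * ?A') (at 0)"
    by (intro DERIV_add DERIV_cmult R A')
  then have "((\<lambda>s. willmore_energy a (\<lambda>\<theta>. \<Psi> (s, \<theta>))) has_real_derivative 0 + multiplier * ?A') (at 0)"
    by (rule has_field_derivative_transform_within_open[OF _ open_ball[of 0 e]])
      (use e in \<open>simp_all only: centre_in_ball W\<close>)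
  then show "((\<lambda>s. willmore_energy a (\<lambda>\<theta>. \<Psi> (s, \<theta>))) has_real_derivative multiplier * ?A') (at 0)"
    by simp
qed

end

end

section \<open>The Clifford family\<close>

context flrw begin

text \<open>Only the time and the real radii move. The velocity thus has real coefficients, the
  coordinate vectors have imaginary ones, and normality is automatic.\<close>

lemma normal_variation_torus_map:
  fixes t p q :: "real \<Rightarrow> real"
  assumes eps: "0 < \<epsilon>" and C: "\<And>k. Ck_on k {-\<epsilon><..<\<epsilon>} t" "\<And>k. Ck_on k {-\<epsilon><..<\<epsilon>} p"
      "\<And>k. Ck_on k {-\<epsilon><..<\<epsilon>} q"
    and unit: "\<And>s. s \<in> {-\<epsilon><..<\<epsilon>} \<Longrightarrow> (p s)\<^sup>2 + (q s)\<^sup>2 = 1"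
  shows "normal_variation a (torus_map (t 0) (of_real (p 0)) (of_real (q 0)))
    (\<lambda>s. torus_map (t s) (of_real (p s)) (of_real (q s)))"
  unfolding normal_variation_def smooth_variation_def
proof (intro conjI exI[of _ \<epsilon>] ballI allI smooth_onI)
  let ?I = "{-\<epsilon><..<\<epsilon>}"
  have C': "Ck_on k (?I \<times> (UNIV :: (real \<times> real) set)) (\<lambda>z. f (fst z))" if "\<And>k. Ck_on k ?I f"
    for k and f :: "real \<Rightarrow> real"
    by (rule Ck_on_compose[OF _ open_greaterThanLessThan _ that]) (auto intro!: Ck_intros open_Times)
  show "Ck_on k (?I \<times> UNIV) (\<lambda>(s, \<theta>). torus_map (t s) (of_real (p s)) (of_real (q s)) \<theta>)" for k
    unfolding split_beta by (intro Ck_intros C' C open_Times open_UNIV open_greaterThanLessThan)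
  show "periodic (torus_map (t s) (of_real (p s)) (of_real (q s)))" for s
    by (rule periodic_torus_map)
  show "range (torus_map (t s) (of_real (p s)) (of_real (q s))) \<subseteq> spacetime" if "s \<in> ?I" for s
    using torus_map_in_spacetime[OF unit[OF that]] by blast
  show "flrw_metric a (torus_map (t 0) (of_real (p 0)) (of_real (q 0)) \<theta>)
      (initial_velocity (\<lambda>s. torus_map (t s) (of_real (p s)) (of_real (q s))) \<theta>)
      (partial_deriv (torus_map (t 0) (of_real (p 0)) (of_real (q 0))) i \<theta>) = 0" for \<theta> i
  proof -
    have "\<exists>f'. (f has_real_derivative f') (at 0)" if "\<And>k. Ck_on k ?I f" for f :: "real \<Rightarrow> real"
      using Ck_on_Suc_has_derivative[OF that[of "Suc 0"], of 0] eps
      by (metis DERIV_deriv_iff_real_differentiable differentiable_def greaterThanLessThan_iff neg_less_0_iff_less)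
    then obtain t' p' q' where d: "(t has_real_derivative t') (at 0)" "(p has_real_derivative p') (at 0)"
        "(q has_real_derivative q') (at 0)"
      using C by metis
    have of_real: "((\<lambda>s. complex_of_real (f s)) has_vector_derivative of_real f') (at 0)"
      if "(f has_real_derivative f') (at 0)" for f f'
      using that bounded_linear.has_vector_derivative[OF bounded_linear_of_real]
      by (simp add: has_real_derivative_iff_has_vector_derivative)
    have "((\<lambda>s. torus_map (t s) (of_real (p s)) (of_real (q s)) \<theta>) has_vector_derivative
        torus_map t' (of_real p') (of_real q') \<theta>) (at 0)"
      unfolding torus_map_def split_beta
      using d by (intro has_vector_derivative_Pair has_vector_derivative_mult_left of_real)
        (simp_all add: has_real_derivative_iff_has_vector_derivative)
    then have "initial_velocity (\<lambda>s. torus_map (t s) (of_real (p s)) (of_real (q s))) \<theta>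
        = torus_map t' (of_real p') (of_real q') \<theta>"
      unfolding initial_velocity_def by (rule vector_derivative_at)
    moreover have "i = 1 \<or> i = 2" by (rule exhaust_2)
    ultimately show ?thesis
      by (auto simp: partial_deriv_torus_map inner_of_real_complex)
  qed
qed (use eps in auto)

abbreviation minimal_torus :: "real \<Rightarrow> surf" where
  "minimal_torus t \<equiv> clifford_torus t (pi / 4)"

lemma minimal_torus_eq: "minimal_torus t = torus_map t (of_real (sqrt 2 / 2)) (of_real (sqrt 2 / 2))"
  by (simp only: clifford_torus_eq cos_45 sin_45)

lemma half_square: "(sqrt 2 / 2)\<^sup>2 = (1 / 2 :: real)"
  by (simp add: power_divide)

lemma common_lagrange_multiplier_minimal_torus:
  "common_lagrange_multiplier a (minimal_torus t0) (- 4 * deriv (deriv a) t0 / a t0)"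
  unfolding common_lagrange_multiplier_def
proof (intro allI impI)
  fix \<Phi> assume "normal_variation a (minimal_torus t0) \<Phi>"
  then obtain \<epsilon> where \<Phi>: "\<Phi> 0 = minimal_torus t0" "0 < \<epsilon>"
      "smooth_on ({-\<epsilon><..<\<epsilon>} \<times> UNIV) (\<lambda>(s, \<theta>). \<Phi> s \<theta>)"
      "\<And>s. s \<in> {-\<epsilon><..<\<epsilon>} \<Longrightarrow> periodic (\<Phi> s)" "\<And>s. s \<in> {-\<epsilon><..<\<epsilon>} \<Longrightarrow> range (\<Phi> s) \<subseteq> spacetime"
    unfolding normal_variation_def smooth_variation_def by blast
  interpret torus_family a \<epsilon> "\<lambda>(s, \<theta>). \<Phi> s \<theta>"
    by unfold_locales (use \<Phi>(2-5) in \<open>auto simp: periodic_def doubly_periodic_def image_subset_iff\<close>)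
  have start: "(case (0, \<theta>) of (s, \<theta>) \<Rightarrow> \<Phi> s \<theta>) = torus_map t0 (of_real (sqrt 2 / 2)) (of_real (sqrt 2 / 2)) \<theta>" for \<theta>
    by (simp only: prod.case \<Phi>(1) minimal_torus_eq)
  have "0 < sqrt 2 / (2 :: real)" by simp
  from first_variation[OF start this half_square]
  show "\<exists>A'. ((\<lambda>s. area a (\<Phi> s)) has_real_derivative A') (at 0) \<and>
      ((\<lambda>s. willmore_energy a (\<Phi> s)) has_real_derivative - 4 * deriv (deriv a) t0 / a t0 * A') (at 0)"
    by (simp only: prod.case) blast
qed

lemma fully_area_constrained_Willmore_if_multiplier:
  assumes "common_lagrange_multiplier a F \<Lambda>"
  shows "fully_area_constrained_Willmore a F"
  unfolding fully_area_constrained_Willmore_def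
proof (intro allI impI)
  fix \<Phi> assume "normal_variation a F \<Phi>" and const: "\<forall>\<^sub>F s in nhds 0. area a (\<Phi> s) = area a F"
  then obtain A' where A': "((\<lambda>s. area a (\<Phi> s)) has_real_derivative A') (at 0)"
      "((\<lambda>s. willmore_energy a (\<Phi> s)) has_real_derivative \<Lambda> * A') (at 0)"
    using assms unfolding common_lagrange_multiplier_def by blast
  have "((\<lambda>s. area a (\<Phi> s)) has_real_derivative 0) (at 0)"
    by (rule DERIV_cong_ev[OF refl const refl, THEN iffD2]) simp
  with A'(1) have "A' = 0" by (rule DERIV_unique)
  with A'(2) show "((\<lambda>s. willmore_energy a (\<Phi> s)) has_real_derivative 0) (at 0)" by simp
qed

text \<open>Moving the torus in time changes its area to first order, so the multiplier is unique.\<close>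

lemma common_lagrange_multiplier_unique:
  assumes "deriv a t0 \<noteq> 0" and \<mu>: "common_lagrange_multiplier a (minimal_torus t0) \<mu>"
    and \<Lambda>: "common_lagrange_multiplier a (minimal_torus t0) \<Lambda>"
  shows "\<mu> = \<Lambda>"
proof -
  let ?r = "sqrt 2 / (2 :: real)"
  define \<Phi> where "\<Phi> s = torus_map (t0 + s) (of_real ?r) (of_real ?r)" for s
  have rr: "?r\<^sup>2 + ?r\<^sup>2 = 1" by (simp only: half_square)
  have var: "normal_variation a (minimal_torus t0) \<Phi>"
    using normal_variation_torus_map[of 1 "\<lambda>s. t0 + s" "\<lambda>_. ?r" "\<lambda>_. ?r"] rr
    unfolding \<Phi>_def[abs_def] minimal_torus_eq
    by (simp add: Ck_on_add Ck_on_const Ck_on_ident del: of_real_divide)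
  obtain A' where A': "((\<lambda>s. area a (\<Phi> s)) has_real_derivative A') (at 0)"
      "((\<lambda>s. willmore_energy a (\<Phi> s)) has_real_derivative \<mu> * A') (at 0)"
    using \<mu> var unfolding common_lagrange_multiplier_def by blast
  obtain A'' where A'': "((\<lambda>s. area a (\<Phi> s)) has_real_derivative A'') (at 0)"
      "((\<lambda>s. willmore_energy a (\<Phi> s)) has_real_derivative \<Lambda> * A'') (at 0)"
    using \<Lambda> var unfolding common_lagrange_multiplier_def by blast
  have "A'' = A'" using A'' A' DERIV_unique by blast
  have "((\<lambda>s. a (t0 + s)) has_real_derivative deriv a t0) (at 0)"
    using DERIV_shift[of a "deriv a t0" 0 t0] has_derivative_a[of t0] by (simp add: add.commute)
  then have "((\<lambda>s. 4 * pi\<^sup>2 * ((a (t0 + s))\<^sup>2 * (?r * ?r))) has_real_derivative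
      4 * pi\<^sup>2 * ((2 * a t0 * deriv a t0) * (?r * ?r))) (at 0)"
    by (auto intro!: derivative_eq_intros)
  then have "((\<lambda>s. area a (\<Phi> s)) has_real_derivative 4 * pi\<^sup>2 * ((2 * a t0 * deriv a t0) * (?r * ?r))) (at 0)"
    unfolding \<Phi>_def by (subst area_torus_map) simp_all
  with A'(1) have "A' = 4 * pi\<^sup>2 * ((2 * a t0 * deriv a t0) * (?r * ?r))" by (rule DERIV_unique)
  then have "A' \<noteq> 0" using assms(1) by simp
  moreover have "\<mu> * A' = \<Lambda> * A'"
    using DERIV_unique[OF A'(2) A''(2)] \<open>A'' = A'\<close> by simp
  ultimately show ?thesis by simp
qed

section \<open>Extrinsic data of the slice and of the torus within it\<close>

lemma slice_K_eq:
  assumes x: "x \<in> spacetime" and v: "v \<in> tangent_space x"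
  shows "slice_K a x v w = a (fst x) * deriv a (fst x) * (snd v \<bullet> snd w)"
proof -
  have vf: "vector_field (\<lambda>_. d_t)"
    by (simp add: vector_field_def smooth_on_def Ck_on_const tangent_space_def d_t_def)
  have "nabla a (tangent_extension v) (\<lambda>_. d_t) x = christoffel a x v d_t"
    unfolding nabla_eq[OF vector_field_tangent_extension vf x] flrw_connection_def
      directional_deriv_eq[OF has_derivative_const] tangent_extension_at[OF v]
    by (simp add: d_t_def zero_prod_def[symmetric])
  then show ?thesis
    by (simp add: slice_K_def flrw_metric_christoffel) (simp add: d_t_def)
qed

lemma slice_P_torus_map:
  assumes pq: "p\<^sup>2 + q\<^sup>2 = 1" "p \<noteq> 0" "q \<noteq> 0"
  shows "slice_P a (torus_map t (of_real p) (of_real q)) \<theta> = 2 * (deriv a t / a t)"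
proof -
  let ?F = "torus_map t (of_real p) (of_real q)"
  have on: "?F \<theta> \<in> spacetime" by (rule torus_map_in_spacetime[OF pq(1)])
  have "partial_deriv ?F i \<theta> \<in> tangent_space (?F \<theta>)" for i
    using torus_map_in_spacetime[OF pq(1)] differentiableI[OF has_derivative_torus_map]
    by (intro partial_deriv_tangent) auto
  note K = slice_K_eq[OF on this]
  have G: "gram a (?F \<theta>) (partial_deriv ?F 1 \<theta>) (partial_deriv ?F 2 \<theta>) \<noteq> 0"
    using pq by (simp add: partial_deriv_torus_map gram_torus_map)
  show ?thesis
    unfolding slice_P_def induced_trace_eq[OF G] K partial_deriv_torus_map gram_torus_map
    using pq(2,3) by (simp add: inner_of_real_complex power2_eq_square field_simps)
qed

text \<open>\<open>cis u\<close> and its multiple by the imaginary unit form an orthonormal basis of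
  the complex plane, radial and tangential to the circle.\<close>

lemma complex_norm_cis_basis: "z \<bullet> z = (z \<bullet> cis u)\<^sup>2 + (z \<bullet> (\<i> * cis u))\<^sup>2"
proof -
  have "(z \<bullet> cis u)\<^sup>2 + (z \<bullet> (\<i> * cis u))\<^sup>2 = (z \<bullet> z) * ((cos u)\<^sup>2 + (sin u)\<^sup>2)"
    by (simp add: inner_complex_def power2_eq_square algebra_simps
        del: sin_cos_squared_add sin_cos_squared_add2 sin_cos_squared_add3)
  then show ?thesis by simp
qed

text \<open>\<open>\<nu>\<close> is any unit normal, so it is not computed. Differentiating its
  orthogonality to the coordinate vectors expresses B by one radial component \<open>x\<close>, with
  opposite diagonal entries. Orthogonality and unit length determine \<open>x^2\<close>, which
  suffices for the squared norm.\<close>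

lemma trace_free_B_minimal_torus:
  assumes \<nu>: "unit_normal_in_slice a (minimal_torus t) \<nu>"
  shows "induced_norm_sq a (minimal_torus t) \<theta> (trace_free_B a (minimal_torus t) \<nu> \<theta>) = 2 / (a t)\<^sup>2"
    and "snd (\<nu> \<theta>) \<bullet> snd (\<nu> \<theta>) = 1 / (a t)\<^sup>2"
proof -
  define r where "r = sqrt 2 / (2 :: real)"
  have r: "r\<^sup>2 = 1 / 2" "r \<noteq> 0" unfolding r_def by (simp_all only: half_square) simp
  have rr: "r * r = 1 / 2" using r by (simp add: power2_eq_square)
  define F where "F = torus_map t (of_real r) (of_real r)"
  have F: "minimal_torus t = F" unfolding minimal_torus_eq F_def r_def ..
  have on: "F \<theta> \<in> spacetime" for \<theta>
    unfolding F_def by (rule torus_map_in_spacetime) (simp add: r)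
  have tang: "partial_deriv F i \<theta> \<in> tangent_space (F \<theta>)" for i \<theta>
    using on differentiableI[OF has_derivative_torus_map] unfolding F_def
    by (intro partial_deriv_tangent) auto
  have pd: "partial_deriv F 1 = torus_map 0 (\<i> * of_real r) 0" "partial_deriv F 2 = torus_map 0 0 (\<i> * of_real r)"
    by (simp_all add: F_def partial_deriv_torus_map)
  have time: "fst (F \<theta>) = t" "fst (partial_deriv F i \<theta>) = 0" for i \<theta>
    using exhaust_2[of i] by (auto simp: F_def partial_deriv_torus_map)
  have \<nu>': "\<nu> \<theta> \<in> tangent_space (F \<theta>)" "fst (\<nu> \<theta>) = 0" "flrw_metric a (F \<theta>) (\<nu> \<theta>) (\<nu> \<theta>) = 1"
    "flrw_metric a (F \<theta>) (\<nu> \<theta>) (partial_deriv F i \<theta>) = 0" for \<theta> i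
    using \<nu> unfolding unit_normal_in_slice_def F by blast+
  have sm: "\<nu> differentiable at \<theta>" for \<theta>
    using \<nu> smooth_on_has_derivative[of UNIV \<nu> \<theta>] unfolding unit_normal_in_slice_def
    by (auto simp: differentiable_def)
  have normal: "snd (\<nu> \<theta>) \<bullet> snd (partial_deriv F i \<theta>) = 0" for \<theta> i
    using \<nu>'(4)[of \<theta> i] by (simp add: flrw_metric_def \<nu>'(2))
  have norm: "snd (\<nu> \<theta>) \<bullet> snd (\<nu> \<theta>) = 1 / (a t)\<^sup>2" for \<theta>
    using \<nu>'(3)[of \<theta>] by (simp add: flrw_metric_def \<nu>'(2) time field_simps)
  then show "snd (\<nu> \<theta>) \<bullet> snd (\<nu> \<theta>) = 1 / (a t)\<^sup>2" .
  have pdF: "partial_deriv F j differentiable at \<theta>" for j \<theta>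
    using exhaust_2[of j] by (auto simp: pd intro: differentiableI[OF has_derivative_torus_map])
  have B: "slice_B a F \<nu> \<theta> i j = - (a t)\<^sup>2 * (snd (\<nu> \<theta>) \<bullet> snd (partial_deriv (partial_deriv F j) i \<theta>))" for i j
  proof -
    have "frechet_derivative (\<lambda>\<theta>. snd (\<nu> \<theta>) \<bullet> snd (partial_deriv F j \<theta>)) (at \<theta>) (coord_dir i) = 0"
      by (simp add: normal)
    then have N: "snd (partial_deriv \<nu> i \<theta>) \<bullet> snd (partial_deriv F j \<theta>)
        = - (snd (\<nu> \<theta>) \<bullet> snd (partial_deriv (partial_deriv F j) i \<theta>))"
      unfolding frechet_derivative_inner_snd[OF sm pdF] by simp
    have "snd (F \<theta>) \<bullet> snd (partial_deriv F j \<theta>) = 0"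
      using tang[of j \<theta>] by (simp add: tangent_space_def inner_commute)
    then show ?thesis
      unfolding slice_B_def covariant_deriv_along_eq[of F, OF on \<nu>'(1) tang] flrw_metric_add_left
        flrw_metric_christoffel
      by (simp add: flrw_metric_def inner_tangent_extension time \<nu>'(2) N)
  qed
  define x where "x = snd (\<nu> \<theta>) \<bullet> snd (torus_map 0 (of_real r) 0 \<theta>)"
  \<comment> \<open>\<open>\<nu>\<close> is tangent to the sphere, hence orthogonal to the position,
    so its two radial components cancel. This makes B trace-free.\<close>
  have x2: "snd (\<nu> \<theta>) \<bullet> snd (torus_map 0 0 (of_real r) \<theta>) = - x"
  proof -
    have "snd (F \<theta>) = snd (torus_map 0 (of_real r) 0 \<theta>) + snd (torus_map 0 0 (of_real r) \<theta>)"
      by (simp add: F_def torus_map_def split_beta)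
    then show ?thesis
      using \<nu>'(1)[of \<theta>] by (simp add: tangent_space_def inner_add_right x_def)
  qed
  have Bij: "slice_B a F \<nu> \<theta> 1 1 = (a t)\<^sup>2 * x" "slice_B a F \<nu> \<theta> 2 2 = - ((a t)\<^sup>2 * x)"
    "slice_B a F \<nu> \<theta> 1 2 = 0" "slice_B a F \<nu> \<theta> 2 1 = 0"
  proof -
    have minus: "torus_map 0 (\<i> * (\<i> * of_real r)) 0 \<theta> = - torus_map 0 (of_real r) 0 \<theta>"
      "torus_map 0 0 (\<i> * (\<i> * of_real r)) \<theta> = - torus_map 0 0 (of_real r) \<theta>"
      "torus_map 0 0 0 \<theta> = 0"
      by (simp_all add: torus_map_def split_beta zero_prod_def)
    show "slice_B a F \<nu> \<theta> 1 1 = (a t)\<^sup>2 * x" "slice_B a F \<nu> \<theta> 2 2 = - ((a t)\<^sup>2 * x)"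
      "slice_B a F \<nu> \<theta> 1 2 = 0" "slice_B a F \<nu> \<theta> 2 1 = 0"
      unfolding B pd partial_deriv_torus_map mult_zero_right minus
      by (simp_all add: x2 x_def)
  qed
  have xx: "x * x = 1 / (4 * (a t)\<^sup>2)"
  proof -
    define y z u v where "y = fst (snd (\<nu> \<theta>))" and "z = snd (snd (\<nu> \<theta>))" and "u = fst \<theta>" and "v = snd \<theta>"
    have "y \<bullet> (\<i> * cis u) = 0" "z \<bullet> (\<i> * cis v) = 0"
    proof -
      have "y \<bullet> (r *\<^sub>R (\<i> * cis u)) = 0" "z \<bullet> (r *\<^sub>R (\<i> * cis v)) = 0"
        using normal[of \<theta> 1] normal[of \<theta> 2]
        by (simp_all add: pd torus_map_def split_beta inner_prod_def y_def z_def u_def v_def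
            scaleR_conv_of_real mult_ac)
      then show "y \<bullet> (\<i> * cis u) = 0" "z \<bullet> (\<i> * cis v) = 0" using r(2) by simp_all
    qed
    moreover have "r * (y \<bullet> cis u) = x" "r * (z \<bullet> cis v) = - x"
    proof -
      have "y \<bullet> (r *\<^sub>R cis u) = x"
        unfolding x_def
        by (simp add: torus_map_def split_beta inner_prod_def y_def u_def scaleR_conv_of_real)
      moreover have "z \<bullet> (r *\<^sub>R cis v) = - x"
        unfolding x2[symmetric]
        by (simp add: torus_map_def split_beta inner_prod_def z_def v_def scaleR_conv_of_real)
      ultimately
      show "r * (y \<bullet> cis u) = x" "r * (z \<bullet> cis v) = - x" by simp_all
    qed
    then have "x\<^sup>2 = r\<^sup>2 * (y \<bullet> cis u)\<^sup>2" "x\<^sup>2 = r\<^sup>2 * (z \<bullet> cis v)\<^sup>2"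
      by (metis power_mult_distrib, metis power_mult_distrib power2_minus)
    moreover have "snd (\<nu> \<theta>) \<bullet> snd (\<nu> \<theta>) = y \<bullet> y + z \<bullet> z"
      by (simp add: inner_prod_def y_def z_def)
    ultimately have "1 / (a t)\<^sup>2 = 4 * x\<^sup>2"
      using norm[of \<theta>] complex_norm_cis_basis[of y u] complex_norm_cis_basis[of z v] r by simp
    then show ?thesis by (simp add: power2_eq_square field_simps)
  qed
  have G: "gram a (F \<theta>) (partial_deriv F 1 \<theta>) (partial_deriv F 2 \<theta>) = ((a t)\<^sup>2 / 2)\<^sup>2"
    unfolding pd unfolding F_def gram_torus_map rr by simp
  then have "gram a (F \<theta>) (partial_deriv F 1 \<theta>) (partial_deriv F 2 \<theta>) \<noteq> 0" by simp
  note tr = induced_trace_eq[OF this, unfolded G]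
  have tr: "induced_trace a F \<theta> \<beta> = 2 / (a t)\<^sup>2 * (\<beta> 1 1 + \<beta> 2 2)" for \<beta> :: "2 \<Rightarrow> 2 \<Rightarrow> real"
  proof -
    have "flrw_metric a (F \<theta>) (partial_deriv F 1 \<theta>) (partial_deriv F 1 \<theta>) = (a t)\<^sup>2 / 2"
      "flrw_metric a (F \<theta>) (partial_deriv F 2 \<theta>) (partial_deriv F 2 \<theta>) = (a t)\<^sup>2 / 2"
      "flrw_metric a (F \<theta>) (partial_deriv F 1 \<theta>) (partial_deriv F 2 \<theta>) = 0"
      unfolding pd unfolding F_def by (simp_all add: inner_of_real_complex rr)
    then show ?thesis
      unfolding tr by (simp only:) (simp add: power2_eq_square field_simps)
  qed
  have "induced_trace a F \<theta> (slice_B a F \<nu> \<theta>) = 0"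
    by (simp add: tr Bij)
  then have tf: "trace_free_B a F \<nu> \<theta> = slice_B a F \<nu> \<theta>"
    by (simp add: trace_free_B_def fun_eq_iff)
  have "induced_norm_sq a F \<theta> (slice_B a F \<nu> \<theta>) = 2 / (a t)\<^sup>2 * (2 / (a t)\<^sup>2) * (2 * ((a t)\<^sup>2 * (a t)\<^sup>2) * (x * x))"
    unfolding induced_norm_sq_def tr Bij by (simp add: algebra_simps)
  also have "\<dots> = 2 / (a t)\<^sup>2"
    unfolding xx by (simp add: power2_eq_square field_simps)
  finally show "induced_norm_sq a (minimal_torus t) \<theta> (trace_free_B a (minimal_torus t) \<nu> \<theta>) = 2 / (a t)\<^sup>2"
    unfolding F tf .
qed

text \<open>For \<open>\<alpha> \<noteq> \<pi>/4\<close> let time run and adjust the radii such that \<open>a\<^sup>2 p q\<close>, hence the area, is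
  constant; \<open>p\<close> and \<open>q\<close> are recovered from \<open>m = p q\<close> through \<open>(p \<plusminus> q)\<^sup>2 = 1 \<plusminus> 2 m\<close>.\<close>

lemma area_constrained_Willmore_torus_condition:
  assumes pq: "p0\<^sup>2 + q0\<^sup>2 = 1" "0 < p0" "0 < q0" "p0 \<noteq> q0" and H: "deriv a t0 \<noteq> 0"
    and W: "fully_area_constrained_Willmore a (torus_map t0 (of_real p0) (of_real q0))"
  shows "4 * (a t0 * deriv (deriv a) t0 - (deriv a t0)\<^sup>2) = 1 / (p0 * q0)\<^sup>2 + 4"
proof -
  define k where "k = (a t0)\<^sup>2 * (p0 * q0)"
  define m where "m s = k / (a (t0 + s))\<^sup>2" for s
  \<comment> \<open>The square root of \<open>1 - 2 m\<close> at 0 is only the absolute value of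
    \<open>p0 - q0\<close>; the sign recovers which radius is larger.\<close>
  define \<sigma> :: real where "\<sigma> = (if q0 < p0 then 1 else - 1)"
  define p where "p s = (sqrt (1 + 2 * m s) + \<sigma> * sqrt (1 - 2 * m s)) / 2" for s
  define q where "q s = (sqrt (1 + 2 * m s) - \<sigma> * sqrt (1 - 2 * m s)) / 2" for s
  have k: "0 < k" using pq pos[of t0] by (simp add: k_def)
  have m_pos: "0 < m s" for s using k pos[of "t0 + s"] by (simp add: m_def)
  have m0: "m 0 = p0 * q0" by (simp add: m_def k_def)
  have sq: "1 + 2 * m 0 = (p0 + q0)\<^sup>2" "1 - 2 * m 0 = (p0 - q0)\<^sup>2"
    using pq(1) by (simp_all add: m0 power2_eq_square algebra_simps)
  have C: "Ck_on j S m" if "open S" for j S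
    unfolding m_def[abs_def] by (intro Ck_intros that) simp
  have "isCont m 0"
    using C[OF open_UNIV, of 0] by (simp add: continuous_on_eq_continuous_at)
  \<comment> \<open>Here \<open>p0\<close> and \<open>q0\<close> being distinct matters:
    \<open>1 - 2 m\<close> stays positive near 0, where the square root is smooth.\<close>
  moreover have "m 0 < 1 / 2"
  proof -
    have "0 < (p0 - q0)\<^sup>2" using pq(4) by simp
    then show ?thesis using sq(2) by linarith
  qed
  ultimately have "\<forall>\<^sub>F s in nhds 0. m s < 1 / 2"
    using order_tendstoD(2)[of m "m 0" "nhds 0" "1 / 2"] by (simp add: isCont_def tendsto_at_iff_tendsto_nhds)
  then obtain \<epsilon> where eps: "0 < \<epsilon>" and half: "\<And>s. \<bar>s\<bar> < \<epsilon> \<Longrightarrow> m s < 1 / 2"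
    unfolding eventually_nhds_metric by (auto simp: dist_real_def)
  have \<sigma>: "\<sigma> * \<sigma> = 1" by (simp add: \<sigma>_def)
  have sqrt_p: "sqrt (1 + 2 * m s) * sqrt (1 + 2 * m s) = 1 + 2 * m s" for s
    using m_pos[of s] by (simp add: abs_of_pos)
  have sqrt_m: "sqrt (1 - 2 * m s) * sqrt (1 - 2 * m s) = 1 - 2 * m s" if "\<bar>s\<bar> < \<epsilon>" for s
    using half[OF that] by (simp add: abs_of_pos)
  have unit: "(p s)\<^sup>2 + (q s)\<^sup>2 = 1" and prod: "p s * q s = m s" if "\<bar>s\<bar> < \<epsilon>" for s
  proof -
    define A B where "A = sqrt (1 + 2 * m s)" and "B = sqrt (1 - 2 * m s)"
    have AB: "A * A = 1 + 2 * m s" "B * B = 1 - 2 * m s"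
      using sqrt_p[of s] sqrt_m[OF that] by (simp_all add: A_def B_def)
    have pAB: "p s = (A + \<sigma> * B) / 2" and qAB: "q s = (A - \<sigma> * B) / 2"
      by (simp_all only: p_def q_def A_def B_def)
    have "(p s)\<^sup>2 + (q s)\<^sup>2 = (A * A + (\<sigma> * \<sigma>) * (B * B)) / 2"
      unfolding pAB qAB by (simp add: power2_eq_square field_simps)
    then show "(p s)\<^sup>2 + (q s)\<^sup>2 = 1" by (simp add: \<sigma> AB)
    have "p s * q s = (A * A - (\<sigma> * \<sigma>) * (B * B)) / 4"
      unfolding pAB qAB by (simp add: field_simps)
    then show "p s * q s = m s" by (simp add: \<sigma> AB)
  qed
  have pos_pq: "0 < p s" "0 < q s" if "\<bar>s\<bar> < \<epsilon>" for s
  proof -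
    have "0 < p s + q s" using m_pos[of s] by (simp add: p_def q_def field_simps)
    moreover have "0 < p s * q s" using prod[OF that] m_pos by simp
    ultimately show "0 < p s" "0 < q s" by (auto simp: zero_less_mult_iff)
  qed
  have "sqrt (1 + 2 * m 0) = p0 + q0" "\<sigma> * sqrt (1 - 2 * m 0) = p0 - q0"
    using pq unfolding sq by (auto simp: \<sigma>_def)
  then have pq0: "p 0 = p0" "q 0 = q0" by (simp_all add: p_def q_def)
  define \<Phi> where "\<Phi> s = torus_map (t0 + s) (of_real (p s)) (of_real (q s))" for s
  have "normal_variation a (torus_map (t0 + 0) (of_real (p 0)) (of_real (q 0))) \<Phi>"
    unfolding \<Phi>_def[abs_def]
  proof (rule normal_variation_torus_map[OF eps])
    show "Ck_on j {-\<epsilon><..<\<epsilon>} (\<lambda>s. t0 + s)" for j by (intro Ck_intros open_greaterThanLessThan)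
    have pm: "0 < 1 + 2 * m s" for s using m_pos[of s] by simp
    have mm: "0 < 1 - 2 * m s" if "s \<in> {-\<epsilon><..<\<epsilon>}" for s
    proof -
      have "\<bar>s\<bar> < \<epsilon>" using that by auto
      from half[OF this] show ?thesis by linarith
    qed
    show "Ck_on j {-\<epsilon><..<\<epsilon>} p" for j
      unfolding p_def[abs_def] by (intro Ck_intros C open_greaterThanLessThan pm mm) simp_all
    show "Ck_on j {-\<epsilon><..<\<epsilon>} q" for j
      unfolding q_def[abs_def] by (intro Ck_intros C open_greaterThanLessThan pm mm) simp_all
  qed (use unit in auto)
  then have var: "normal_variation a (torus_map t0 (of_real p0) (of_real q0)) \<Phi>"
    by (simp add: pq0)
  have ev: "\<forall>\<^sub>F s in nhds 0. \<bar>s\<bar> < \<epsilon>"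
    using eps unfolding eventually_nhds_metric by (auto simp: dist_real_def)
  have area: "area a (\<Phi> s) = 4 * pi\<^sup>2 * k" if "\<bar>s\<bar> < \<epsilon>" for s
    unfolding \<Phi>_def area_torus_map[OF pos_pq[OF that]] prod[OF that] by (simp add: m_def)
  have area0: "area a (torus_map t0 (of_real p0) (of_real q0)) = 4 * pi\<^sup>2 * k"
    using pq by (simp add: area_torus_map k_def)
  from ev have "\<forall>\<^sub>F s in nhds 0. area a (\<Phi> s) = area a (torus_map t0 (of_real p0) (of_real q0))"
    by eventually_elim (simp add: area area0)
  with W var have W0: "((\<lambda>s. willmore_energy a (\<Phi> s)) has_real_derivative 0) (at 0)"
    unfolding fully_area_constrained_Willmore_def by blast
  \<comment> \<open>\<open>w\<close> is the constant value of \<open>|H|^2\<close> on the torus at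
    parameter \<open>s\<close>, with \<open>p q = k / a^2\<close> inserted. At constant area,
    criticality of the energy is criticality of \<open>w\<close>.\<close>
  define w where "w s = (a (t0 + s))\<^sup>2 / k\<^sup>2 - 4 / (a (t0 + s))\<^sup>2 - 4 * (deriv a (t0 + s) / a (t0 + s))\<^sup>2" for s
  have energy: "willmore_energy a (\<Phi> s) = w s * (4 * pi\<^sup>2 * k)" if "\<bar>s\<bar> < \<epsilon>" for s
  proof -
    have "willmore_energy a (\<Phi> s) = ((1 / (m s)\<^sup>2 - 4) / (a (t0 + s))\<^sup>2 - 4 * (deriv a (t0 + s) / a (t0 + s))\<^sup>2)
        * (4 * pi\<^sup>2 * k)"
      using willmore_energy_torus_map[OF unit pos_pq, OF that that that, of "t0 + s"] area[OF that]
      by (simp add: \<Phi>_def prod[OF that])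
    also have "(1 / (m s)\<^sup>2 - 4) / (a (t0 + s))\<^sup>2 = (a (t0 + s))\<^sup>2 / k\<^sup>2 - 4 / (a (t0 + s))\<^sup>2"
      using k by (simp add: m_def power2_eq_square field_simps)
    finally show ?thesis by (simp add: w_def)
  qed
  from ev have ev': "\<forall>\<^sub>F s in nhds 0. w s = willmore_energy a (\<Phi> s) / (4 * pi\<^sup>2 * k)"
    by eventually_elim (use k in \<open>simp add: energy\<close>)
  have w0: "(w has_real_derivative 0) (at 0)"
    by (rule DERIV_cong_ev[OF refl ev' refl, THEN iffD2]) (rule DERIV_cong[OF DERIV_cdivide[OF W0]], simp)
  have da: "((\<lambda>s. a (t0 + s)) has_real_derivative deriv a t0) (at 0)"
    using DERIV_shift[of a "deriv a t0" 0 t0] has_derivative_a[of t0] by (simp add: add.commute)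
  have da': "((\<lambda>s. deriv a (t0 + s)) has_real_derivative deriv (deriv a) t0) (at 0)"
    using DERIV_shift[of "deriv a" "deriv (deriv a) t0" 0 t0]
      smooth_on_real_has_derivative[OF smooth_on_deriv[OF smooth], of t0] by (simp add: add.commute)
  let ?a = "a t0" and ?a' = "deriv a t0" and ?a'' = "deriv (deriv a) t0"
  have "(w has_real_derivative 2 * ?a * ?a' / k\<^sup>2 + 8 * ?a' / ?a ^ 3 - 8 * (?a' / ?a) * ((?a'' * ?a - ?a' * ?a') / (?a * ?a))) (at 0)"
    unfolding w_def[abs_def]
    by (rule DERIV_cong, (rule DERIV_diff DERIV_cmult DERIV_cdivide DERIV_divide DERIV_power DERIV_const da da'
          | (simp; fail))+)
      (simp add: power2_eq_square power3_eq_cube mult_ac)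
  from DERIV_unique[OF this w0]
  have "2 * ?a * ?a' / k\<^sup>2 + 8 * ?a' / ?a ^ 3 - 8 * (?a' / ?a) * ((?a'' * ?a - ?a' * ?a') / (?a * ?a)) = 0" .
  \<comment> \<open>The derivative factors. Since \<open>a'\<close> is nonzero, the bracket must
    vanish, and \<open>a^2 / k = 1 / (p0 q0)\<close> turns it into the claim.\<close>
  moreover have "2 * ?a * ?a' / k\<^sup>2 + 8 * ?a' / ?a ^ 3 - 8 * (?a' / ?a) * ((?a'' * ?a - ?a' * ?a') / (?a * ?a))
      = 2 * ?a' / ?a ^ 3 * ((?a\<^sup>2 / k)\<^sup>2 + 4 - 4 * (?a * ?a'' - ?a'\<^sup>2))"
    using k by (simp add: power2_eq_square power3_eq_cube field_simps)
  ultimately have "(?a\<^sup>2 / k)\<^sup>2 + 4 - 4 * (?a * ?a'' - ?a'\<^sup>2) = 0"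
    using H by simp
  moreover have "?a\<^sup>2 / k = 1 / (p0 * q0)"
    by (simp add: k_def)
  ultimately show ?thesis by (simp add: power_one_over)
qed

lemma area_constrained_Willmore_clifford_torus_unique:
  assumes H: "deriv a t0 \<noteq> 0" and dec: "dominant_energy_condition a"
    and \<alpha>: "0 < \<alpha>" "\<alpha> < pi / 2"
    and W: "fully_area_constrained_Willmore a (clifford_torus t0 \<alpha>)"
  shows "\<alpha> = pi / 4"
proof (rule ccontr)
  assume "\<alpha> \<noteq> pi / 4"
  let ?p = "cos \<alpha>" and ?q = "sin \<alpha>"
  have pq: "?p\<^sup>2 + ?q\<^sup>2 = 1" "0 < ?p" "0 < ?q"
    using \<alpha> by (auto intro!: cos_gt_zero sin_gt_zero)
  have "?p \<noteq> ?q"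
  proof
    assume "?p = ?q"
    then have "cos (2 * \<alpha>) = cos (pi / 2)" by (simp only: cos_double cos_pi_half diff_self)
    with \<alpha> have "2 * \<alpha> = pi / 2" by - (rule cos_inj_pi, simp_all)
    with \<open>\<alpha> \<noteq> pi / 4\<close> show False by simp
  qed
  from area_constrained_Willmore_torus_condition[OF pq this H W[unfolded clifford_torus_eq]]
  have eq: "4 * (a t0 * deriv (deriv a) t0 - (deriv a t0)\<^sup>2) = 1 / (?p * ?q)\<^sup>2 + 4" .
  have "0 \<le> 1 / (?p * ?q)\<^sup>2" by simp
  moreover have "2 * (?p * ?q) \<le> 1"
    using zero_le_power2[of "?p - ?q"] pq(1) by (simp add: power2_eq_square algebra_simps)
  then have "(?p * ?q)\<^sup>2 < 1"
    using pq(2,3) by (intro power_strict_mono[of _ 1, simplified]) auto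
  then have "1 < 1 / (?p * ?q)\<^sup>2" using pq(2,3) by simp
  \<comment> \<open>The energy condition bounds the left side of \<open>eq\<close> by 4, while the
    right side exceeds 4.\<close>
  moreover have "a t0 * deriv (deriv a) t0 \<le> 1 + (deriv a t0)\<^sup>2"
    using dominant_energy_condition_bound[OF dec, of t0] pos[of t0]
    by (simp add: power2_eq_square field_simps)
  ultimately show False using eq by simp
qed

end

theorem corollary6p6:
  fixes a :: "real \<Rightarrow> real" and t0 :: real
  assumes smooth: "smooth_on UNIV a"
    and pos: "\<And>t. 0 < a t"
    and H0: "deriv a t0 / a t0 \<noteq> 0"
  shows "fully_area_constrained_Willmore a (clifford_torus t0 (pi / 4)) \<and>
    (\<forall>\<theta>. mean_curvature_sq a (clifford_torus t0 (pi / 4)) \<theta>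
            = - (slice_P a (clifford_torus t0 (pi / 4)) \<theta>)\<^sup>2 \<and>
          - (slice_P a (clifford_torus t0 (pi / 4)) \<theta>)\<^sup>2 = - 4 * (deriv a t0 / a t0)\<^sup>2 \<and>
          - 4 * (deriv a t0 / a t0)\<^sup>2 < 0) \<and>
    (\<exists>\<Lambda>. (\<forall>\<mu>. common_lagrange_multiplier a (clifford_torus t0 (pi / 4)) \<mu> \<longleftrightarrow> \<mu> = \<Lambda>) \<and>
       (\<forall>\<nu> \<theta>. unit_normal_in_slice a (clifford_torus t0 (pi / 4)) \<nu> \<longrightarrow>
          \<Lambda> = 1 / 2 * (slice_P a (clifford_torus t0 (pi / 4)) \<theta>)\<^sup>2
            + induced_norm_sq a (clifford_torus t0 (pi / 4)) \<theta>
                (trace_free_B a (clifford_torus t0 (pi / 4)) \<nu> \<theta>)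
            + 2 * Ein a (clifford_torus t0 (pi / 4) \<theta>) (\<nu> \<theta>) (\<nu> \<theta>))) \<and>
    (dominant_energy_condition a \<longrightarrow>
       (\<forall>\<alpha>. 0 < \<alpha> \<and> \<alpha> < pi / 2 \<longrightarrow>
          (fully_area_constrained_Willmore a (clifford_torus t0 \<alpha>) \<longleftrightarrow> \<alpha> = pi / 4)))"
proof -
  interpret flrw a by unfold_locales (use smooth pos in auto)
  let ?F = "clifford_torus t0 (pi / 4)" and ?\<Lambda> = "- 4 * deriv (deriv a) t0 / a t0"
  have a': "deriv a t0 \<noteq> 0" using H0 by auto
  note mult = common_lagrange_multiplier_minimal_torus[of t0]
  have W: "fully_area_constrained_Willmore a ?F"
    by (rule fully_area_constrained_Willmore_if_multiplier[OF mult])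
  have rr: "(sqrt 2 / 2)\<^sup>2 + (sqrt 2 / 2)\<^sup>2 = (1 :: real)" "sqrt 2 / 2 \<noteq> (0 :: real)"
    by (simp_all only: half_square) simp_all
  have P: "slice_P a ?F \<theta> = 2 * (deriv a t0 / a t0)" for \<theta>
    unfolding minimal_torus_eq by (rule slice_P_torus_map[OF rr rr(2)])
  have "1 / (sqrt 2 / 2 * (sqrt 2 / 2))\<^sup>2 = (4 :: real)"
    by (simp add: power2_eq_square[symmetric] power_divide)
  then have H: "mean_curvature_sq a ?F \<theta> = - 4 * (deriv a t0 / a t0)\<^sup>2" for \<theta>
    unfolding minimal_torus_eq mean_curvature_sq_torus_map[OF rr rr(2)] by simp
  have curvature: "mean_curvature_sq a ?F \<theta> = - (slice_P a ?F \<theta>)\<^sup>2 \<and>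
      - (slice_P a ?F \<theta>)\<^sup>2 = - 4 * (deriv a t0 / a t0)\<^sup>2 \<and> - 4 * (deriv a t0 / a t0)\<^sup>2 < 0" for \<theta>
    using H0 by (simp add: H P power_mult_distrib power_divide)
  have formula: "?\<Lambda> = 1 / 2 * (slice_P a ?F \<theta>)\<^sup>2 + induced_norm_sq a ?F \<theta> (trace_free_B a ?F \<nu> \<theta>)
      + 2 * Ein a (?F \<theta>) (\<nu> \<theta>) (\<nu> \<theta>)" if \<nu>: "unit_normal_in_slice a ?F \<nu>" for \<nu> \<theta>
  proof -
    have t: "fst (?F \<theta>) = t0" by (simp only: minimal_torus_eq fst_torus_map)
    have on: "?F \<theta> \<in> spacetime"
      unfolding minimal_torus_eq by (rule torus_map_in_spacetime[OF rr(1)])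
    have "\<nu> \<theta> \<in> tangent_space (?F \<theta>)" "fst (\<nu> \<theta>) = 0"
      using \<nu> unfolding unit_normal_in_slice_def by blast+
    \<comment> \<open>The three summands are \<open>2 h^2\<close>, \<open>2 / a^2\<close> and
      \<open>- 4 a''/a - 2 / a^2 - 2 h^2\<close>, so only \<open>- 4 a''/a\<close> survives.\<close>
    then show ?thesis
      by (simp add: P Ein_eq[OF on] t trace_free_B_minimal_torus[OF \<nu>] power2_eq_square field_simps)
  qed
  have unique: "common_lagrange_multiplier a ?F \<mu> \<longleftrightarrow> \<mu> = ?\<Lambda>" for \<mu>
    using common_lagrange_multiplier_unique[OF a' _ mult] mult by blast
  have family: "fully_area_constrained_Willmore a (clifford_torus t0 \<alpha>) \<longleftrightarrow> \<alpha> = pi / 4"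
    if "dominant_energy_condition a" "0 < \<alpha>" "\<alpha> < pi / 2" for \<alpha>
    using area_constrained_Willmore_clifford_torus_unique[OF a' that] W by blast
  show ?thesis
    using W curvature unique formula family by blast
qed

end
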